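(* Let $d \in \mathbb{N}$ and let $\mu_d$ be the probability distribution on $\mathbb{R}$ which is the limit in moments, for $n\to\infty$, of the sequence $$s_n = \frac{1}{\sqrt{n}} \Bigl( (\gamma_1 + \cdots + \gamma_n) - \frac{n}{d} \Bigr) \in \mathbb{C}[S_\infty]$$ in $(\mathbb{C}[S_\infty], \varphi_d)$; that is, $\int_{\mathbb{R}} t^k \, d\mu_d(t) = \lim_{n\to\infty} \varphi_d(s_n^k)$ for every $k \in \mathbb{N}$. The Laplace transform (or equivalently, the exponential moment-generating function) of $\mu_d$ is defined for all $z \in \mathbb{C}$, and has the explicit formula $$\int_{\mathbb{R}} e^{zt} \, d\mu_d(t) = Q_d(z) \cdot e^{(d-1) z^2/(2d^2)}, \quad z \in \mathbb{C},$$ where $Q_d$ is the polynomial $$Q_d(z) = \sum_{j=0}^{d-1} \frac{1}{d^j \, (j+1)!} \binom{d-1}{j} z^{2j}.$$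
   Context: $\mathbb{N} = \{1,2,\ldots\}$. $S_\infty$ is the group of bijections $\tau : \mathbb{N} \to \mathbb{N}$ for which there is $k_o$ with $\tau(k) = k$ for all $k > k_o$. For $\tau \in S_\infty$, $\|\tau\|$ is the minimal number $m$ of transpositions in a factorization $\tau = \rho_1 \cdots \rho_m$ (with $\|\tau\| = 0$ iff $\tau$ is the identity). $\varphi_d : \mathbb{C}[S_\infty] \to \mathbb{C}$ is the linear functional determined by $\varphi_d(\tau) = (1/d)^{\|\tau\|}$ for $\tau \in S_\infty$. The group algebra $\mathbb{C}[S_\infty]$ has the $*$-operation determined by $\tau^* = \tau^{-1}$, and $\varphi_d$ is a positive functional with $\varphi_d(1)=1$. The star-generators are the transpositions $\gamma_n = (1, n+1)$, $n \in \mathbb{N}$; the scalar $n/d$ in $s_n$ means $n/d$ times the unit. The existence of the limit distribution $\mu_d$ is provided by the central limit theorem for exchangeable sequences. *)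

theory Defs
  imports
    "HOL-Probability.Probability"
    "HOL-Combinatorics.Permutations"
    "HOL-Library.Poly_Mapping"
    "HOL-Computational_Algebra.Polynomial"
begin

text \<open>A bijection of \<open>{1, 2, \<dots>}\<close> is represented by its extension to \<open>nat\<close> that fixes \<open>0\<close>.\<close>

typedef sinf = "{\<tau> :: nat \<Rightarrow> nat. \<tau> permutes {1..} \<and> (\<exists>k0. \<forall>k>k0. \<tau> k = k)}"
  morphisms perm_of Sinf
proof
  show "id \<in> {\<tau> :: nat \<Rightarrow> nat. \<tau> permutes {1..} \<and> (\<exists>k0. \<forall>k>k0. \<tau> k = k)}"
    by (auto simp: permutes_id)
qed

setup_lifting type_definition_sinf

text \<open>The group is written additively (\<open>\<sigma> + \<tau>\<close> is the composition \<open>\<sigma> \<circ> \<tau>\<close>), because the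
  convolution product of \<^theory>\<open>HOL-Library.Poly_Mapping\<close> is formulated for additive monoids.
  The addition is not commutative.\<close>

instantiation sinf :: group_add
begin

lift_definition zero_sinf :: sinf is id
  by (auto simp: permutes_id)

lift_definition plus_sinf :: "sinf \<Rightarrow> sinf \<Rightarrow> sinf" is "\<lambda>\<sigma> \<tau>. \<sigma> \<circ> \<tau>"
proof -
  fix \<sigma> \<tau> :: "nat \<Rightarrow> nat"
  assume "\<sigma> permutes {1..} \<and> (\<exists>k0. \<forall>k>k0. \<sigma> k = k)"
    and "\<tau> permutes {1..} \<and> (\<exists>k0. \<forall>k>k0. \<tau> k = k)"
  then obtain k1 k2 where "\<sigma> permutes {1..}" "\<tau> permutes {1..}"
    and k: "\<forall>k>k1. \<sigma> k = k" "\<forall>k>k2. \<tau> k = k" by blast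
  moreover have "\<forall>k > max k1 k2. (\<sigma> \<circ> \<tau>) k = k" using k by simp
  ultimately show "\<sigma> \<circ> \<tau> permutes {1..} \<and> (\<exists>k0. \<forall>k>k0. (\<sigma> \<circ> \<tau>) k = k)"
    by (blast intro: permutes_compose)
qed

lift_definition uminus_sinf :: "sinf \<Rightarrow> sinf" is inv
  by (metis permutes_inv permutes_inverses(2))

definition minus_sinf :: "sinf \<Rightarrow> sinf \<Rightarrow> sinf" where
  "minus_sinf \<sigma> \<tau> = \<sigma> + - \<tau>"

instance
proof
  fix a b c :: sinf
  show "a + b + c = a + (b + c)" by transfer (simp add: comp_assoc)
  show "0 + a = a" by transfer simp
  show "a + 0 = a" by transfer simp
  show "- a + a = 0" by transfer (auto simp: fun_eq_iff permutes_inverses)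
  show "a + - b = a - b" by (simp add: minus_sinf_def)
qed

end

definition is_transposition :: "sinf \<Rightarrow> bool" where
  "is_transposition \<rho> \<longleftrightarrow> (\<exists>a\<ge>1. \<exists>b\<ge>1. a \<noteq> b \<and> perm_of \<rho> = Transposition.transpose a b)"

definition perm_length :: "sinf \<Rightarrow> nat" where
  "perm_length \<tau> = (LEAST m. \<exists>\<rho>s. length \<rho>s = m \<and> (\<forall>\<rho>\<in>set \<rho>s. is_transposition \<rho>) \<and> \<tau> = sum_list \<rho>s)"

text \<open>Factorizations exist, so the minimum above is taken over a nonempty set.\<close>

lemma ex_transposition_factorization:
  "\<exists>\<rho>s. (\<forall>\<rho>\<in>set \<rho>s. is_transposition \<rho>) \<and> \<tau> = sum_list \<rho>s"
proof -
  have "\<tau> \<in> {\<tau>. perm_of \<tau> permutes {1..} \<and> (\<exists>k0. \<forall>k>k0. perm_of \<tau> k = k)}"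
    using perm_of[of \<tau>] by simp
  then obtain k0 where p: "perm_of \<tau> permutes {1..}" and k0: "\<forall>k>k0. perm_of \<tau> k = k"
    by blast
  have "perm_of \<tau> permutes {1..k0}"
    by (rule permutes_superset[OF p]) (use k0 in auto)
  with finite_atLeastAtMost[of 1 k0]
  have "\<exists>\<rho>s. (\<forall>\<rho>\<in>set \<rho>s. is_transposition \<rho>) \<and> perm_of \<tau> = perm_of (sum_list \<rho>s)"
  proof (induction rule: permutes_rev_induct)
    case id
    show ?case by (rule exI[of _ "[]"]) (simp add: zero_sinf.rep_eq)
  next
    case (swap a b p)
    then obtain \<rho>s where \<rho>s: "\<forall>\<rho>\<in>set \<rho>s. is_transposition \<rho>" "p = perm_of (sum_list \<rho>s)"
      by blast
    have "Transposition.transpose a b permutes {1..}"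
      by (rule permutes_swap_id) (use swap in auto)
    moreover have "\<forall>k > max a b. Transposition.transpose a b k = k" by (auto simp: Transposition.transpose_def)
    ultimately have r: "perm_of (Sinf (Transposition.transpose a b)) = Transposition.transpose a b"
      by (intro Sinf_inverse) blast
    have "is_transposition (Sinf (Transposition.transpose a b))"
      unfolding is_transposition_def r using swap by auto
    then show ?case using \<rho>s r
      by (intro exI[of _ "\<rho>s @ [Sinf (Transposition.transpose a b)]"]) (auto simp: plus_sinf.rep_eq)
  qed
  then show ?thesis by (simp add: perm_of_inject)
qed

lift_definition star_generator :: "nat \<Rightarrow> sinf" is "\<lambda>n. Transposition.transpose 1 (n + 1)"
proof -
  fix n :: nat
  have "Transposition.transpose 1 (n + 1) permutes {1..}" by (rule permutes_swap_id) auto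
  moreover have "\<forall>k > n + 1. Transposition.transpose 1 (n + 1) k = k" by (auto simp: Transposition.transpose_def)
  ultimately show "Transposition.transpose 1 (n + 1) permutes {1..} \<and> (\<exists>k0. \<forall>k>k0. Transposition.transpose 1 (n + 1) k = k)"
    by blast
qed

text \<open>The ring structure on finitely supported functions is the convolution product; the group
  element \<open>\<tau>\<close> is \<open>Poly_Mapping.single \<tau> 1\<close> and the unit of the algebra is
  \<open>Poly_Mapping.single 0 1\<close>.\<close>

type_synonym group_algebra = "sinf \<Rightarrow>\<^sub>0 complex"

definition group_elem :: "sinf \<Rightarrow> group_algebra" where
  "group_elem \<tau> = Poly_Mapping.single \<tau> 1"

definition scalar :: "complex \<Rightarrow> group_algebra" where
  "scalar c = Poly_Mapping.single 0 c"

definition phi :: "nat \<Rightarrow> group_algebra \<Rightarrow> complex" where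
  "phi d x = (\<Sum>\<tau>\<in>Poly_Mapping.keys x. Poly_Mapping.lookup x \<tau> * (1 / of_nat d) ^ perm_length \<tau>)"

text \<open>The following facts characterize \<open>phi d\<close> as the linear functional determined by its values on
  group elements. Multiplication by \<open>scalar c\<close> is the scalar multiplication of the algebra.\<close>

lemma phi_group_elem: "phi d (group_elem \<tau>) = (1 / of_nat d) ^ perm_length \<tau>"
  by (simp add: phi_def group_elem_def)

lemma lookup_scalar_mult: "Poly_Mapping.lookup (scalar c * x) \<tau> = c * Poly_Mapping.lookup x \<tau>"
  by (simp add: scalar_def mult_map_scale_conv_mult[symmetric] map.rep_eq when_def)

lemma phi_superset:
  assumes "finite A" "Poly_Mapping.keys x \<subseteq> A"
  shows "phi d x = (\<Sum>\<tau>\<in>A. Poly_Mapping.lookup x \<tau> * (1 / of_nat d) ^ perm_length \<tau>)"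
  unfolding phi_def by (rule sum.mono_neutral_left) (use assms in \<open>auto simp: in_keys_iff\<close>)

lemma phi_add: "phi d (x + y) = phi d x + phi d y"
proof -
  let ?A = "Poly_Mapping.keys x \<union> Poly_Mapping.keys y"
  have "Poly_Mapping.keys (x + y) \<subseteq> ?A" by (rule keys_add)
  then show ?thesis
    by (simp add: phi_superset[of ?A] lookup_add distrib_right sum.distrib)
qed

lemma phi_scalar_mult: "phi d (scalar c * x) = c * phi d x"
proof -
  have "Poly_Mapping.keys (scalar c * x) \<subseteq> Poly_Mapping.keys x"
    by (auto simp: in_keys_iff lookup_scalar_mult)
  then show ?thesis
    by (simp add: phi_superset[of "Poly_Mapping.keys x"] lookup_scalar_mult sum_distrib_left mult.assoc)
qed

definition s_elem :: "nat \<Rightarrow> nat \<Rightarrow> group_algebra" where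
  "s_elem d n = scalar (1 / of_real (sqrt (real n))) *
     ((\<Sum>i=1..n. group_elem (star_generator i)) - scalar (of_nat n / of_nat d))"

definition limit_in_moments ::
  "(group_algebra \<Rightarrow> complex) \<Rightarrow> (nat \<Rightarrow> group_algebra) \<Rightarrow> real measure \<Rightarrow> bool" where
  "limit_in_moments \<phi> a \<mu> \<longleftrightarrow> real_distribution \<mu> \<and>
     (\<forall>k\<ge>1. integrable \<mu> (\<lambda>t. t ^ k) \<and>
        (\<lambda>n. \<phi> (a n ^ k)) \<longlonglongrightarrow> of_real (\<integral>t. t ^ k \<partial>\<mu>))"

definition Q_poly :: "nat \<Rightarrow> complex poly" where
  "Q_poly d = (\<Sum>j=0..d-1. monom (of_nat ((d - 1) choose j) / (of_nat d ^ j * fact (j + 1))) (2 * j))"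

end

theory Submission
  imports Defs "Jordan_Normal_Form.Determinant"
begin

text \<open>Write \<open>a\<^sub>i = \<gamma>\<^sub>i - 1/d\<close>. Since \<open>d\<close> to the power
  \<open>- \<parallel>\<tau>\<parallel>\<close> is the proportion of the colourings with \<open>d\<close> colours that are invariant under
  \<open>\<tau>\<close>, \<open>phi d\<close> is the normalized trace of the permutation action on tensor powers of
  \<open>\<complex>\<^sup>d\<close>, and there \<open>\<Sum>a\<^sub>i\<close> is a matrix of size \<open>d\<close> (acting on
  the first tensor factor) whose entries are sums of independent identically distributed
  centred matrices acting on the other factors. By the central limit theorem these entries become
  jointly Gaussian with the covariance of a traceless GUE matrix, so the limit moments are
  given by Wick's formula. Removing one matrix entry from a product of traces yields the loop equation. The
  same recursion holds, by integration by parts, for the expectation of products of power sums of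
  \<open>d\<close> variables under the Gaussian weight times the squared Vandermonde determinant,
  so the two agree. Expanding the determinant in Hermite polynomials then gives the Laplace transform.\<close>

text \<open>Only the trace of a single power is wanted, but contracting two entries of one trace
  cuts it in two, so both sides are carried as functionals of lists of exponents, that is, of
  products of traces or of power sums. On such lists the recursion lowers the sum of the exponents
  plus the length, and an exponent 0 splits off a factor \<open>d\<close>; hence it determines a
  functional up to its value at \<open>[]\<close>, and the unknown normalisation of the eigenvalue
  weight cancels. Two entries have covariance 1/d at mutually transposed positions, with an extra
  -1/d^2 when both are diagonal. The negative part cannot come from a real common shift of the
  eigenvalues. The shift is an imaginary multiple of a Gaussian variable, and Gaussian expectation
  is therefore a linear functional on complex polynomials, evaluated on finite grids. The measure
  \<mu> enters only through its moments. Their exponential generating series converges everywhere,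
  which is what makes the Laplace transform exist on the whole plane.\<close>

section \<open>Shuffle convolution and the Wick functional\<close>

text \<open>The sum of \<open>f v * g w\<close> over all splittings of the word \<open>u\<close> into complementary
  subwords \<open>v\<close>, \<open>w\<close>. It turns the joint moments of two tensor-independent families into
  those of their sum.\<close>

primrec conv :: "'x list \<Rightarrow> ('x list \<Rightarrow> complex) \<Rightarrow> ('x list \<Rightarrow> complex) \<Rightarrow> complex" where
  "conv [] f g = f [] * g []"
| "conv (x # u) f g = conv u (\<lambda>v. f (x # v)) g + conv u f (\<lambda>v. g (x # v))"

lemma conv_add_left: "conv u (\<lambda>v. f v + f' v) g = conv u f g + conv u f' g"
  by (induction u arbitrary: f f' g) (auto simp: algebra_simps)

lemma conv_add_right: "conv u f (\<lambda>v. g v + g' v) = conv u f g + conv u f g'"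
  by (induction u arbitrary: f g g') (auto simp: algebra_simps)

lemma conv_mult_right: "conv u f (\<lambda>v. a * g v) = a * conv u f g"
  by (induction u arbitrary: f g) (auto simp: algebra_simps)

lemma conv_mult_left: "conv u (\<lambda>v. a * f v) g = a * conv u f g"
  by (induction u arbitrary: f g) (auto simp: algebra_simps)

lemma conv_zero_left: "conv u (\<lambda>v. 0) g = 0"
  by (induction u arbitrary: g) auto

lemma conv_zero_right: "conv u f (\<lambda>v. 0) = 0"
  by (induction u arbitrary: f) auto

lemma conv_sum_right: "conv u f (\<lambda>v. \<Sum>i\<in>I. g i v) = (\<Sum>i\<in>I. conv u f (g i))"
  by (induction I rule: infinite_finite_induct) (auto simp: conv_add_right conv_zero_right)

lemma conv_unit: "conv u (\<lambda>v. if v = [] then 1 else 0) g = g u"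
  by (induction u arbitrary: g) (auto simp: conv_zero_left)

text \<open>Both sides distribute the letters of \<open>u\<close> over three subwords. The lemma
  moves a marked factor to the front of a convolution power.\<close>

lemma conv_left_commute:
  "conv u f (\<lambda>v. conv v g h) = conv u g (\<lambda>v. conv v f h)"
proof (induction u arbitrary: f g h)
  case (Cons x u)
  show ?case by (simp add: conv_add_right Cons.IH[of f] Cons.IH[of "\<lambda>v. f (x # v)"] algebra_simps)
qed simp

lemma conv_cong:
  assumes "\<And>v. length v \<le> length u \<Longrightarrow> f v = f' v" "\<And>v. length v \<le> length u \<Longrightarrow> g v = g' v"
  shows "conv u f g = conv u f' g'"
  using assms
proof (induction u arbitrary: f g f' g')
  case (Cons x u)
  have "conv u (\<lambda>v. f (x # v)) g = conv u (\<lambda>v. f' (x # v)) g'"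
    by (rule Cons.IH) (use Cons.prems in auto)
  moreover have "conv u f (\<lambda>v. g (x # v)) = conv u f' (\<lambda>v. g' (x # v))"
    by (rule Cons.IH) (use Cons.prems in auto)
  ultimately show ?case by simp
qed simp

text \<open>The hypothesis compares products instead of factors: on a split where one factor
  vanishes, the other one is unconstrained. Arguments that count letters enter through this
  form.\<close>

lemma conv_eq_on_splits:
  assumes "\<And>v w. length v + length w = length u \<Longrightarrow> f v * g w = f' v * g' w"
  shows "conv u f g = conv u f' g'"
  using assms
proof (induction u arbitrary: f g f' g')
  case (Cons x u)
  have "conv u (\<lambda>v. f (x # v)) g = conv u (\<lambda>v. f' (x # v)) g'"
    by (rule Cons.IH) (use Cons.prems in auto)
  moreover have "conv u f (\<lambda>v. g (x # v)) = conv u f' (\<lambda>v. g' (x # v))"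
    by (rule Cons.IH) (use Cons.prems in auto)
  ultimately show ?case by simp
qed simp

text \<open>Joint moments of commuting variables have this property. It allows the words of several
  traces to be reordered in the loop equation.\<close>

definition perm_inv :: "('x list \<Rightarrow> complex) \<Rightarrow> bool" where
  "perm_inv f \<longleftrightarrow> (\<forall>u v. mset u = mset v \<longrightarrow> f u = f v)"

lemma perm_inv_Cons: "perm_inv f \<Longrightarrow> perm_inv (\<lambda>v. f (x # v))"
  by (simp add: perm_inv_def)

lemma conv_move:
  assumes "perm_inv f" "perm_inv g"
  shows "conv (u @ x # v) f g = conv (x # u @ v) f g"
  using assms
proof (induction u arbitrary: f g)
  case (Cons y u)
  have 1: "(\<lambda>v. f (x # y # v)) = (\<lambda>v. f (y # x # v))" "(\<lambda>v. g (x # y # v)) = (\<lambda>v. g (y # x # v))"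
    using Cons.prems by (auto simp: perm_inv_def fun_eq_iff)
  show ?case
    using Cons.prems by (simp add: Cons.IH perm_inv_Cons 1)
qed simp

lemma perm_inv_conv:
  assumes "perm_inv f" "perm_inv g"
  shows "perm_inv (\<lambda>u. conv u f g)"
proof -
  have "conv u f g = conv v f g" if "mset u = mset v" for u v
    using assms that
  proof (induction u arbitrary: f g v)
    case (Cons x u)
    from Cons.prems(3) have "x \<in> set v" by (metis list.set_intros(1) mset_eq_setD)
    then obtain v1 v2 where v: "v = v1 @ x # v2" by (meson split_list)
    with Cons.prems(3) have m: "mset u = mset (v1 @ v2)" by simp
    show ?case
      unfolding v conv_move[OF Cons.prems(1,2)] conv.simps
      by (intro arg_cong2[of _ _ _ _ "(+)"] Cons.IH m perm_inv_Cons Cons.prems(1,2))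
  qed simp
  then show ?thesis unfolding perm_inv_def by blast
qed

text \<open>Deletes one letter \<open>x\<close> of the word in all possible ways, with weight \<open>h x\<close>.\<close>

primrec pick :: "('x \<Rightarrow> complex) \<Rightarrow> ('x list \<Rightarrow> complex) \<Rightarrow> 'x list \<Rightarrow> complex" where
  "pick h w [] = 0"
| "pick h w (x # u) = h x * w u + pick h (\<lambda>v. w (x # v)) u" 

lemma pick_cong:
  assumes "\<And>v. Suc (length v) = length u \<Longrightarrow> w v = w' v"
  shows "pick h w u = pick h w' u"
  using assms
proof (induction u arbitrary: w w')
  case (Cons x u)
  have "pick h (\<lambda>v. w (x # v)) u = pick h (\<lambda>v. w' (x # v)) u"
    by (rule Cons.IH) (use Cons.prems in auto)
  then show ?case using Cons.prems[of u] by simp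
qed simp

lemma pick_mult: "pick h (\<lambda>v. a * w v) u = a * pick h w u"
  by (induction u arbitrary: w) (auto simp: algebra_simps)

text \<open>Deleting a letter is shuffle convolution with a function supported on one-letter words.
  This turns the convolution definition of the Wick sum into a recursion.\<close>

lemma conv_singleton:
  assumes "\<And>v. length v \<noteq> 1 \<Longrightarrow> f v = 0" "\<And>y. f [y] = h y"
  shows "conv u f g = pick h g u"
  using assms
proof (induction u arbitrary: f g)
  case (Cons y u)
  have "f (y # v) = h y * (if v = [] then 1 else 0)" for v
    using Cons.prems by (cases v) auto
  then have "conv u (\<lambda>v. f (y # v)) g = conv u (\<lambda>v. h y * (if v = [] then 1 else 0)) g"
    by presburger
  also have "\<dots> = h y * conv u (\<lambda>v. if v = [] then 1 else 0) g"
    using conv_mult_left[of u "h y" "\<lambda>v. if v = [] then 1 else 0"] by simp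
  also have "\<dots> = h y * g u" by (simp add: conv_unit)
  finally show ?case using Cons.IH[OF Cons.prems] by simp
qed simp

section \<open>Convolution powers and sums over pairings\<close>

text \<open>A sum over ordered divisions of the word into \<open>r\<close> subwords, empty ones
  included; the order is why factorials are divided out later.\<close>

primrec cpow :: "('x list \<Rightarrow> complex) \<Rightarrow> nat \<Rightarrow> 'x list \<Rightarrow> complex" where
  "cpow m 0 = (\<lambda>u. if u = [] then 1 else 0)"
| "cpow m (Suc r) = (\<lambda>u. conv u m (cpow m r))"

lemma perm_inv_cpow: "perm_inv m \<Longrightarrow> perm_inv (cpow m r)"
proof (induction r)
  case 0
  show ?case by (auto simp: perm_inv_def)
next
  case (Suc r)
  then show ?case unfolding cpow.simps by (intro perm_inv_conv)
qed

text \<open>Each of the \<open>r\<close> subwords has to take at least two letters.\<close>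

lemma cpow_eq_0:
  assumes "\<And>v. length v < 2 \<Longrightarrow> m v = 0" "length u < 2 * r"
  shows "cpow m r u = 0"
  using assms(2)
proof (induction r arbitrary: u)
  case (Suc r)
  have "conv u m (cpow m r) = conv u (\<lambda>v. 0) (\<lambda>v. 0)"
  proof (rule conv_eq_on_splits)
    fix v w :: "'a list" assume "length v + length w = length u"
    then have "length v < 2 \<or> length w < 2 * r" using Suc.prems by auto
    then show "m v * cpow m r w = 0 * 0" using assms(1) Suc.IH by auto
  qed
  then show ?case by (simp add: conv_zero_left)
qed simp

text \<open>When only \<open>2 * r\<close> letters are available, each of the \<open>r\<close>
  subwords takes exactly two: a longer one leaves too few letters for the others. So only the
  covariances matter.\<close>

lemma cpow_quadratic_part:
  assumes "\<And>v. length v < 2 \<Longrightarrow> m v = 0" "\<And>v. length v = 2 \<Longrightarrow> q v = m v"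
    and "\<And>v. length v \<noteq> 2 \<Longrightarrow> q v = 0" "length u = 2 * r"
  shows "cpow m r u = cpow q r u"
  using assms(4)
proof (induction r arbitrary: u)
  case (Suc r)
  have "conv u m (cpow m r) = conv u q (cpow q r)"
  proof (rule conv_eq_on_splits)
    fix v w :: "'a list" assume *: "length v + length w = length u"
    consider "length v < 2" | "length v = 2" "length w = 2 * r" | "length v > 2" "length w < 2 * r"
      using * Suc.prems by (cases "length v < 2"; cases "length v = 2") auto
    then show "m v * cpow m r w = q v * cpow q r w"
      by cases (use assms Suc.IH cpow_eq_0[of m w r] in auto)
  qed
  then show ?case by simp
qed simp

text \<open>The letter \<open>x\<close> falls into one of the \<open>Suc p\<close> factors, and by
  commutativity all of these contribute equally.\<close>

lemma cpow_Suc_Cons: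
  "cpow q (Suc p) (x # u) = of_nat (Suc p) * conv u (\<lambda>v. q (x # v)) (cpow q p)"
proof (induction p arbitrary: u)
  case 0
  show ?case by (simp add: conv_zero_right)
next
  case (Suc p)
  have "cpow q (Suc (Suc p)) (x # u) =
    conv u (\<lambda>v. q (x # v)) (cpow q (Suc p)) + conv u q (\<lambda>v. cpow q (Suc p) (x # v))"
    by (simp only: cpow.simps conv.simps)
  also have "conv u q (\<lambda>v. cpow q (Suc p) (x # v)) =
      of_nat (Suc p) * conv u q (\<lambda>v. conv v (\<lambda>v. q (x # v)) (cpow q p))"
    unfolding Suc.IH conv_mult_right ..
  also have "conv u q (\<lambda>v. conv v (\<lambda>v. q (x # v)) (cpow q p)) =
      conv u (\<lambda>v. q (x # v)) (cpow q (Suc p))"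
    by (subst conv_left_commute) simp
  finally show ?case by (simp add: algebra_simps)
qed

text \<open>The sum over all pairings of \<open>u\<close>: the \<open>p\<close>-th convolution power chooses
  \<open>p = length u div 2\<close> disjoint pairs in order.\<close>

definition wick :: "('x \<Rightarrow> 'x \<Rightarrow> complex) \<Rightarrow> 'x list \<Rightarrow> complex" where
  "wick h u = (if even (length u)
     then cpow (\<lambda>v. if length v = 2 then h (v ! 0) (v ! 1) else 0) (length u div 2) u / fact (length u div 2) else 0)"

lemma wick_Nil: "wick h [] = 1"
  by (simp add: wick_def)

text \<open>The pair containing \<open>x\<close> can stand at any of \<open>p + 1\<close> places in
  the ordered choice of pairs, which cancels one factor of the factorial. Together with the value at
  \<open>[]\<close>, this recursion determines \<open>wick\<close>.\<close>

lemma wick_Cons: "wick h (x # u) = pick (h x) (wick h) u"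
proof (cases "even (length u)")
  case True
  \<comment> \<open>Zero is written as a product so that \<open>pick_mult\<close> extracts a factor
    0.\<close>
  have "pick (h x) (wick h) u = pick (h x) (\<lambda>v. 0 * 0) u"
  proof (rule pick_cong)
    fix v :: "'a list" assume "Suc (length v) = length u"
    then have "odd (length v)" using True by (metis even_Suc)
    then show "wick h v = 0 * 0" by (simp add: wick_def)
  qed
  also have "\<dots> = 0" unfolding pick_mult by simp
  finally show ?thesis using True by (simp add: wick_def)
next
  case False
  define q where "q = (\<lambda>v. if length v = 2 then h (v ! 0) (v ! 1) else 0)"
  from False obtain p where p: "length u = Suc (2 * p)" by (auto elim: oddE)
  have "wick h (x # u) = cpow q (Suc p) (x # u) / fact (Suc p)"
    using p by (simp add: wick_def q_def del: cpow.simps fact_Suc)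
  also have "\<dots> = conv u (\<lambda>v. q (x # v)) (cpow q p) / fact p"
    unfolding cpow_Suc_Cons by (simp add: fact_Suc del: of_nat_Suc)
  also have "\<dots> = pick (h x) (cpow q p) u / fact p"
    by (subst conv_singleton[of _ "h x"]) (auto simp: q_def)
  also have "\<dots> = pick (h x) (\<lambda>v. 1 / fact p * cpow q p v) u"
    unfolding pick_mult by simp
  also have "\<dots> = pick (h x) (wick h) u"
    by (rule pick_cong) (use p in \<open>auto simp: wick_def q_def\<close>)
  finally show ?thesis .
qed

lemma perm_inv_wick:
  assumes "\<And>x y. h x y = h y x"
  shows "perm_inv (wick h)"
proof -
  define q where "q = (\<lambda>v. if length v = 2 then h (v ! 0) (v ! 1) else 0)"
  have "q u = q v" if "mset u = mset v" for u v
  proof (cases "length u = 2")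
    case True
    then obtain a b where u: "u = [a, b]" by (auto simp: length_Suc_conv numeral_2_eq_2)
    have l: "length v = 2" using that True by (metis size_mset)
    then obtain c e where v: "v = [c, e]" by (auto simp: length_Suc_conv numeral_2_eq_2)
    have "(a = c \<and> b = e) \<or> (a = e \<and> b = c)" using that unfolding u v
      by (auto simp: add_eq_conv_ex)
    then show ?thesis using assms by (auto simp: q_def u v)
  next
    case False
    then have "length v \<noteq> 2" using that by (metis size_mset)
    with False show ?thesis by (simp add: q_def)
  qed
  then have "perm_inv q" unfolding perm_inv_def by blast
  then have "perm_inv (cpow q r)" for r by (rule perm_inv_cpow)
  then have *: "cpow q r u = cpow q r v" if "mset u = mset v" for r u v
    using that unfolding perm_inv_def by blast
  have "wick h u = wick h v" if "mset u = mset v" for u v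
  proof -
    have "length u = length v" using that by (metis size_mset)
    then show ?thesis using *[OF that] by (simp add: wick_def q_def)
  qed
  then show ?thesis unfolding perm_inv_def by blast
qed

section \<open>Central limit theorem for convolution powers\<close>

text \<open>\<open>m\<close> is the convolution unit plus its part on nonempty words, and the power
  is expanded by the binomial theorem. The nonempty part starts at length two, so its powers beyond
  \<open>N\<close> vanish on words of length at most \<open>N\<close>, and the cutoff is independent
  of \<open>n\<close>.\<close>

lemma conv_power_binomial:
  assumes T0: "\<And>u. T 0 u = (if u = [] then 1 else 0)"
    and TS: "\<And>n u. T (Suc n) u = conv u m (T n)"
    and m: "m [] = 1" "\<And>v. length v = 1 \<Longrightarrow> m v = 0"
    and N: "length u \<le> N"
  shows "T n u = (\<Sum>r\<le>N. of_nat (n choose r) * cpow (\<lambda>v. if v = [] then 0 else m v) r u)"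
  using N
proof (induction n arbitrary: u)
  case 0
  have "(\<Sum>r\<le>N. of_nat (0 choose r) * cpow (\<lambda>v. if v = [] then 0 else m v) r u) =
    (\<Sum>r\<le>N. if r = 0 then (if u = [] then 1 else 0) else 0)"
    by (rule sum.cong) (auto simp: binomial_eq_0)
  then show ?case by (simp add: T0)
next
  case (Suc n)
  define c where "c = cpow (\<lambda>v. if v = [] then 0 else m v)"
  have vanish: "c (Suc N) u = 0"
    unfolding c_def
  proof (rule cpow_eq_0)
    show "(if v = [] then 0 else m v) = 0" if "length v < 2" for v
      using that m(2)[of v] by (cases v) auto
  qed (use Suc.prems in simp)
  have "T (Suc n) u = conv u (\<lambda>v. (if v = [] then 1 else 0) + (if v = [] then 0 else m v)) (T n)"
    unfolding TS by (rule conv_cong) (auto simp: m)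
  also have "\<dots> = T n u + conv u (\<lambda>v. if v = [] then 0 else m v) (T n)"
    by (simp add: conv_add_left conv_unit)
  also have "conv u (\<lambda>v. if v = [] then 0 else m v) (T n) =
      conv u (\<lambda>v. if v = [] then 0 else m v) (\<lambda>v. \<Sum>r\<le>N. of_nat (n choose r) * c r v)"
    by (rule conv_cong) (use Suc in \<open>auto simp: c_def\<close>)
  also have "\<dots> = (\<Sum>r\<le>N. of_nat (n choose r) * c (Suc r) u)"
    by (simp add: conv_sum_right conv_mult_right c_def)
  also have "T n u = (\<Sum>r\<le>N. of_nat (n choose r) * c r u)"
    using Suc by (simp add: c_def)
  also have "\<dots> = (\<Sum>r\<le>Suc N. of_nat (n choose r) * c r u)"
    by (simp add: vanish)
  also have "\<dots> = c 0 u + (\<Sum>r\<le>N. of_nat (n choose Suc r) * c (Suc r) u)"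
    unfolding sum.atMost_Suc_shift by simp
  also have "\<dots> + (\<Sum>r\<le>N. of_nat (n choose r) * c (Suc r) u) =
      c 0 u + (\<Sum>r\<le>N. of_nat (Suc n choose Suc r) * c (Suc r) u)"
    by (simp add: sum.distrib[symmetric] algebra_simps)
  also have "\<dots> = (\<Sum>r\<le>Suc N. of_nat (Suc n choose r) * c r u)"
    unfolding sum.atMost_Suc_shift by simp
  also have "\<dots> = (\<Sum>r\<le>N. of_nat (Suc n choose r) * c r u)"
    by (simp add: vanish)
  finally show ?case by (simp add: c_def)
qed

lemma binomial_over_power_tendsto:
  "(\<lambda>n. real (n choose r) / real n ^ r) \<longlonglongrightarrow> 1 / fact r"
proof (induction r)
  case (Suc r)
  have "(\<lambda>n. 1 - real r * (1 / real n)) \<longlonglongrightarrow> 1 - real r * 0"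
    by (intro tendsto_intros lim_1_over_n)
  then have "(\<lambda>n. real (n choose r) / real n ^ r * ((1 - real r * (1 / real n)) / real (Suc r)))
      \<longlonglongrightarrow> 1 / fact r * ((1 - real r * 0) / real (Suc r))"
    by (intro tendsto_intros Suc) auto
  moreover have "real (n choose r) / real n ^ r * ((1 - real r * (1 / real n)) / real (Suc r)) =
      real (n choose Suc r) / real n ^ Suc r" if "n > 0" for n
  proof -
    have "real (Suc r) * real (n choose Suc r) = (real n - real r) * real (n choose r)"
    proof (cases "r \<le> n")
      case True
      then show ?thesis
        using arg_cong[OF trans[OF binomial_absorption binomial_absorb_comp[symmetric]], of real r n]
        by (simp only: of_nat_mult of_nat_diff)
    qed (simp add: binomial_eq_0)
    then have "real (n choose Suc r) = (real n - real r) * real (n choose r) / real (Suc r)"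
      by (simp add: field_simps)
    moreover have "1 - real r * (1 / real n) = (real n - real r) / real n"
      using that by (simp add: field_simps)
    ultimately show ?thesis by (simp add: mult_ac)
  qed
  then have "\<forall>\<^sub>F n in sequentially. real (n choose r) / real n ^ r * ((1 - real r * (1 / real n)) / real (Suc r)) =
      real (n choose Suc r) / real n ^ Suc r"
    by (rule eventually_mono[OF eventually_gt_at_top[of 0]])
  ultimately have "(\<lambda>n. real (n choose Suc r) / real n ^ Suc r) \<longlonglongrightarrow>
      1 / fact r * ((1 - real r * 0) / real (Suc r))"
    by (rule Lim_transform_eventually)
  then show ?case by (simp add: mult.commute)
qed simp

text \<open>After rescaling, term \<open>r\<close> of the binomial expansion has order
  \<open>n\<close> to the power \<open>r - k/2\<close>, where \<open>k\<close> is the length of the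
  word. Terms with \<open>2 * r > k\<close> vanish identically and those with
  \<open>2 * r < k\<close> tend to 0. In the remaining one every subword has two letters, so only
  the covariances of \<open>m\<close> survive.\<close>

lemma conv_power_clt:
  fixes T :: "nat \<Rightarrow> 'x list \<Rightarrow> complex"
  assumes T0: "\<And>u. T 0 u = (if u = [] then 1 else 0)"
    and TS: "\<And>n u. T (Suc n) u = conv u m (T n)"
    and m: "m [] = 1" "\<And>v. length v = 1 \<Longrightarrow> m v = 0"
  shows "(\<lambda>n. T n u * of_real (1 / sqrt (real n)) ^ length u) \<longlonglongrightarrow> wick (\<lambda>x y. m [x, y]) u"
proof -
  define k where "k = length u"
  define c where "c r = cpow (\<lambda>v. if v = [] then 0 else m v) r u" for r
  have m': "(if v = [] then 0 else m v) = 0" if "length v < 2" for v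
    using that m(2)[of v] by (cases v) auto
  have lim: "(\<lambda>n. of_real (real (n choose r) * (1 / sqrt (real n)) ^ k) * c r) \<longlonglongrightarrow>
      (if 2 * r = k then c r / fact r else 0)" if "r \<le> k" for r
  proof (cases "2 * r \<le> k")
    case False
    then have "c r = 0" unfolding c_def by (intro cpow_eq_0 m') (auto simp: k_def)
    then show ?thesis by simp
  next
    case True
    then obtain j where j: "k = 2 * r + j" using le_Suc_ex by blast
    have "(\<lambda>n. 1 / sqrt (real n)) \<longlonglongrightarrow> 0"
      using tendsto_real_sqrt[OF lim_1_over_n] by (simp add: real_sqrt_divide)
    \<comment> \<open>Here \<open>0 ^ j\<close> is 1 for \<open>j = 0\<close>, the surviving term,
      and 0 otherwise.\<close>
    then have "(\<lambda>n. real (n choose r) / real n ^ r * (1 / sqrt (real n)) ^ j) \<longlonglongrightarrow> 1 / fact r * 0 ^ j"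
      by (intro tendsto_mult tendsto_power binomial_over_power_tendsto)
    moreover have "real (n choose r) / real n ^ r * (1 / sqrt (real n)) ^ j =
        real (n choose r) * (1 / sqrt (real n)) ^ k" for n
      unfolding j by (simp add: power_add power_mult power_divide)
    ultimately have "(\<lambda>n. real (n choose r) * (1 / sqrt (real n)) ^ k) \<longlonglongrightarrow> 1 / fact r * 0 ^ j"
      by simp
    then have "(\<lambda>n. of_real (real (n choose r) * (1 / sqrt (real n)) ^ k) * c r) \<longlonglongrightarrow>
        of_real (1 / fact r * 0 ^ j) * c r"
      by (rule tendsto_mult[OF tendsto_of_real tendsto_const])
    then show ?thesis using j by (cases "j = 0") (simp_all add: power_0_left)
  qed
  have "(\<lambda>n. \<Sum>r\<le>k. of_real (real (n choose r) * (1 / sqrt (real n)) ^ k) * c r) \<longlonglongrightarrow>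
      (\<Sum>r\<le>k. if 2 * r = k then c r / fact r else 0)"
    by (intro tendsto_sum lim) auto
  also have "(\<lambda>n. \<Sum>r\<le>k. of_real (real (n choose r) * (1 / sqrt (real n)) ^ k) * c r) =
      (\<lambda>n. T n u * of_real (1 / sqrt (real n)) ^ length u)"
    using conv_power_binomial[where T = T and m = m and u = u and N = k, OF T0 TS m]
    by (simp add: fun_eq_iff k_def c_def sum_distrib_right sum_distrib_left mult_ac)
  also have "(\<Sum>r\<le>k. if 2 * r = k then c r / fact r else 0) = wick (\<lambda>x y. m [x, y]) u"
  proof (cases "even k")
    case True
    then obtain p where p: "k = 2 * p" by blast
    have "c p = cpow (\<lambda>v. if length v = 2 then m [v ! 0, v ! 1] else 0) p u"
      unfolding c_def
    proof (rule cpow_quadratic_part)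
      fix v :: "'x list" assume "length v = 2"
      then obtain a b where "v = [a, b]" by (auto simp: length_Suc_conv numeral_2_eq_2)
      then show "(if length v = 2 then m [v ! 0, v ! 1] else 0) = (if v = [] then 0 else m v)" by simp
    qed (use m' p k_def in auto)
    moreover have "(\<Sum>r\<le>k. if 2 * r = k then c r / fact r else 0) = (\<Sum>r\<le>k. if r = p then c p / fact p else 0)"
      by (rule sum.cong) (auto simp: p)
    ultimately show ?thesis using p by (simp add: wick_def k_def[symmetric])
  next
    case False
    then have "2 * r \<noteq> k" for r by auto
    then show ?thesis using False by (simp add: wick_def k_def)
  qed
  finally show ?thesis .
qed

section \<open>Closed walks and the loop equation\<close>

lemma pick_append:
  "pick h w (u @ v) = pick h (\<lambda>s. w (s @ v)) u + pick h (\<lambda>s. w (u @ s)) v"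
  by (induction u arbitrary: w) auto

lemma pick_add: "pick h (\<lambda>v. w v + w' v) u = pick h w u + pick h w' u"
  by (induction u arbitrary: w w') (auto simp: algebra_simps)

lemma pick_zero: "pick h (\<lambda>v. 0) u = 0"
  by (induction u) auto

lemma pick_sum: "pick h (\<lambda>v. \<Sum>i\<in>I. w i v) u = (\<Sum>i\<in>I. pick h (w i) u)"
  by (induction I rule: infinite_finite_induct) (auto simp: pick_add pick_zero)

section \<open>Walks as index sequences of matrix products\<close>

text \<open>Summing the products of matrix entries along \<open>walks d k a b\<close> gives the
  entry \<open>(a, b)\<close> of the \<open>k\<close>-th power of the matrix.\<close>

fun walks :: "nat \<Rightarrow> nat \<Rightarrow> nat \<Rightarrow> nat \<Rightarrow> (nat \<times> nat) list set" where
  "walks d 0 a b = (if a = b then {[]} else {})"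
| "walks d (Suc k) a b = (\<Union>c<d. (#) (a, c) ` walks d k c b)"

lemma finite_walks: "finite (walks d k a b)"
  by (induction k arbitrary: a) auto

lemma sum_walks_Suc:
  "(\<Sum>u\<in>walks d (Suc k) a b. g u) = (\<Sum>c<d. \<Sum>u\<in>walks d k c b. g ((a, c) # u))"
proof -
  have "(\<Sum>u\<in>walks d (Suc k) a b. g u) = (\<Sum>c<d. \<Sum>u\<in>(#) (a, c) ` walks d k c b. g u)"
    unfolding walks.simps by (rule sum.UNION_disjoint) (auto simp: finite_walks)
  also have "\<dots> = (\<Sum>c<d. \<Sum>u\<in>walks d k c b. g ((a, c) # u))"
    by (simp add: sum.reindex)
  finally show ?thesis .
qed

lemma sum_walks_0: "(\<Sum>u\<in>walks d 0 a b. g u) = (if a = b then g [] else 0)"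
  by simp

lemma length_walks: "u \<in> walks d k a b \<Longrightarrow> length u = k"
  by (induction k arbitrary: a u) (auto split: if_splits)

declare walks.simps [simp del]

lemma sum_walks_glue:
  assumes "a < d"
  shows "(\<Sum>c<d. \<Sum>s\<in>walks d i a c. \<Sum>t\<in>walks d j c b. g (s @ t)) = (\<Sum>u\<in>walks d (i + j) a b. g u)"
  using assms
proof (induction i arbitrary: a g)
  case 0
  then show ?case by (simp add: sum_walks_0 sum.delta)
next
  case (Suc i)
  have "(\<Sum>c<d. \<Sum>s\<in>walks d (Suc i) a c. \<Sum>t\<in>walks d j c b. g (s @ t)) =
    (\<Sum>e<d. \<Sum>c<d. \<Sum>s\<in>walks d i e c. \<Sum>t\<in>walks d j c b. g ((a, e) # s @ t))"
    unfolding sum_walks_Suc by (subst sum.swap) simp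
  also have "\<dots> = (\<Sum>e<d. \<Sum>u\<in>walks d (i + j) e b. g ((a, e) # u))"
    by (intro sum.cong refl Suc.IH) auto
  finally show ?case by (simp add: sum_walks_Suc)
qed

text \<open>This is the derivative of a matrix power with respect to its entries: deleting a step
  from \<open>c\<close> to \<open>e\<close> leaves a walk from \<open>a\<close> to \<open>c\<close>
  and one from \<open>e\<close> to \<open>b\<close>.\<close>

lemma sum_walks_pick:
  assumes "a < d"
  shows "(\<Sum>u\<in>walks d k a b. pick h g u) =
    (\<Sum>i<k. \<Sum>c<d. \<Sum>e<d. \<Sum>s\<in>walks d i a c. \<Sum>t\<in>walks d (k - 1 - i) e b. h (c, e) * g (s @ t))"
  using assms
proof (induction k arbitrary: a g)
  case 0
  then show ?case by (simp add: sum_walks_0)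
next
  case (Suc k)
  have "(\<Sum>u\<in>walks d (Suc k) a b. pick h g u) =
      (\<Sum>e<d. \<Sum>t\<in>walks d k e b. h (a, e) * g t) +
      (\<Sum>c'<d. \<Sum>u\<in>walks d k c' b. pick h (\<lambda>v. g ((a, c') # v)) u)"
    by (simp add: sum_walks_Suc sum.distrib)
  also have "(\<Sum>e<d. \<Sum>t\<in>walks d k e b. h (a, e) * g t) =
      (\<Sum>c<d. \<Sum>e<d. \<Sum>s\<in>walks d 0 a c. \<Sum>t\<in>walks d (Suc k - 1 - 0) e b. h (c, e) * g (s @ t))"
    using Suc.prems by (subst sum.swap) (simp add: sum_walks_0 sum.delta)
  also have "(\<Sum>c'<d. \<Sum>u\<in>walks d k c' b. pick h (\<lambda>v. g ((a, c') # v)) u) =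
     (\<Sum>c'<d. \<Sum>i<k. \<Sum>c<d. \<Sum>e<d. \<Sum>s\<in>walks d i c' c. \<Sum>t\<in>walks d (k - 1 - i) e b.
        h (c, e) * g ((a, c') # s @ t))"
    by (intro sum.cong refl Suc.IH) auto
  also have "\<dots> = (\<Sum>i<k. \<Sum>c'<d. \<Sum>c<d. \<Sum>e<d. \<Sum>s\<in>walks d i c' c. \<Sum>t\<in>walks d (k - 1 - i) e b.
        h (c, e) * g ((a, c') # s @ t))"
    by (rule sum.swap)
  also have "\<dots> = (\<Sum>i<k. \<Sum>c<d. \<Sum>e<d. \<Sum>s\<in>walks d (Suc i) a c.
      \<Sum>t\<in>walks d (Suc k - 1 - Suc i) e b. h (c, e) * g (s @ t))"
  proof (rule sum.cong[OF refl])
    fix i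
    have "(\<Sum>c'<d. \<Sum>c<d. \<Sum>e<d. \<Sum>s\<in>walks d i c' c. \<Sum>t\<in>walks d (k - 1 - i) e b.
        h (c, e) * g ((a, c') # s @ t)) =
      (\<Sum>c<d. \<Sum>c'<d. \<Sum>e<d. \<Sum>s\<in>walks d i c' c. \<Sum>t\<in>walks d (k - 1 - i) e b.
        h (c, e) * g ((a, c') # s @ t))"
      by (rule sum.swap)
    also have "\<dots> = (\<Sum>c<d. \<Sum>e<d. \<Sum>c'<d. \<Sum>s\<in>walks d i c' c. \<Sum>t\<in>walks d (k - 1 - i) e b.
        h (c, e) * g ((a, c') # s @ t))"
      by (intro sum.cong refl sum.swap)
    also have "\<dots> = (\<Sum>c<d. \<Sum>e<d. \<Sum>s\<in>walks d (Suc i) a c.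
      \<Sum>t\<in>walks d (Suc k - 1 - Suc i) e b. h (c, e) * g (s @ t))"
      by (simp add: sum_walks_Suc)
    finally show "(\<Sum>c'<d. \<Sum>c<d. \<Sum>e<d. \<Sum>s\<in>walks d i c' c. \<Sum>t\<in>walks d (k - 1 - i) e b.
        h (c, e) * g ((a, c') # s @ t)) = \<dots>" .
  qed
  finally show ?case unfolding sum.lessThan_Suc_shift .
qed

text \<open>\<open>A\<close> couples transposed positions as in a Hermitian Gaussian matrix, and
  \<open>B\<close> is the effect of adding a Gaussian multiple of the identity. The trace has
  variance \<open>A * d + B * d^2\<close>, which is 0 for \<open>A = 1/d\<close> and
  \<open>B = - 1/d^2\<close>.\<close>

definition entry_cov :: "complex \<Rightarrow> complex \<Rightarrow> nat \<times> nat \<Rightarrow> nat \<times> nat \<Rightarrow> complex" where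
  "entry_cov A B x y = A * of_bool (fst x = snd y \<and> snd x = fst y) + B * of_bool (fst x = snd x \<and> fst y = snd y)"

lemma entry_cov_sym: "entry_cov A B x y = entry_cov A B y x"
proof -
  have 1: "(fst x = snd y \<and> snd x = fst y) = (fst y = snd x \<and> snd y = fst x)"
    by (rule iffI; elim conjE; rule conjI; erule sym)
  have 2: "(fst x = snd x \<and> fst y = snd y) = (fst y = snd y \<and> fst x = snd x)"
    by (rule conj_commute)
  show ?thesis unfolding entry_cov_def
    by (rule arg_cong2[where f = "\<lambda>p q. A * of_bool p + B * of_bool q", OF 1 2])
qed

lemma sum_of_bool_delta:
  fixes f :: "nat \<Rightarrow> complex"
  assumes "c < d"
  shows "(\<Sum>x<d. of_bool (x = c) * f x) = f c"
proof -
  have "(\<Sum>x<d. of_bool (x = c) * f x) = (\<Sum>x<d. if x = c then f x else 0)"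
    by (rule sum.cong) auto
  then show ?thesis using assms by (simp add: sum.delta)
qed

text \<open>The \<open>A\<close> part of the covariance forces the deleted step to be
  \<open>(c, a)\<close>, so the two remaining pieces end in \<open>c\<close> and start in
  \<open>a\<close>. The \<open>B\<close> part pairs only diagonal entries: the deleted step is a
  loop at some vertex, and the pieces close up to a walk with one step less, for each of the
  \<open>l\<close> places.\<close>

lemma sum_walks_pick_cov:
  assumes "a < d" "c < d" "p < d"
  shows "(\<Sum>u\<in>walks d l p q. pick (entry_cov A B (a, c)) G u) =
    A * (\<Sum>i<l. \<Sum>s\<in>walks d i p c. \<Sum>t\<in>walks d (l - 1 - i) a q. G (s @ t)) +
    (if a = c then B * of_nat l * (\<Sum>u\<in>walks d (l - 1) p q. G u) else 0)"
proof -
  define X where "X i c' e = (\<Sum>s\<in>walks d i p c'. \<Sum>t\<in>walks d (l - 1 - i) e q. G (s @ t))" for i c' e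
  have "(\<Sum>u\<in>walks d l p q. pick (entry_cov A B (a, c)) G u) =
    (\<Sum>i<l. \<Sum>c'<d. \<Sum>e<d. entry_cov A B (a, c) (c', e) * X i c' e)"
    unfolding sum_walks_pick[OF assms(3)] X_def by (simp only: sum_distrib_left)
  also have "\<dots> = (\<Sum>i<l. A * X i c a + of_bool (a = c) * B * (\<Sum>c'<d. X i c' c'))"
  proof (rule sum.cong[OF refl])
    fix i
    have "(\<Sum>c'<d. \<Sum>e<d. entry_cov A B (a, c) (c', e) * X i c' e) =
      (\<Sum>c'<d. \<Sum>e<d. of_bool (c' = c) * (of_bool (e = a) * (A * X i c' e)) +
         of_bool (e = c') * (of_bool (a = c) * B * X i c' e))"
      by (intro sum.cong refl) (auto simp: entry_cov_def algebra_simps)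
    also have "\<dots> = (\<Sum>c'<d. of_bool (c' = c) * (\<Sum>e<d. of_bool (e = a) * (A * X i c' e)) +
        (\<Sum>e<d. of_bool (e = c') * (of_bool (a = c) * B * X i c' e)))"
      by (simp only: sum.distrib sum_distrib_left)
    also have "\<dots> = (\<Sum>c'<d. of_bool (c' = c) * (A * X i c' a) + of_bool (a = c) * B * X i c' c')"
    proof (rule sum.cong[OF refl])
      fix c' assume "c' \<in> {..<d}"
      then have "c' < d" by simp
      then show "of_bool (c' = c) * (\<Sum>e<d. of_bool (e = a) * (A * X i c' e)) +
        (\<Sum>e<d. of_bool (e = c') * (of_bool (a = c) * B * X i c' e)) =
        of_bool (c' = c) * (A * X i c' a) + of_bool (a = c) * B * X i c' c'"
        using sum_of_bool_delta[of c' d "\<lambda>e. of_bool (a = c) * B * X i c' e"]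
          sum_of_bool_delta[OF assms(1), of "\<lambda>e. A * X i c' e"] by simp
    qed
    also have "\<dots> = A * X i c a + of_bool (a = c) * B * (\<Sum>c'<d. X i c' c')"
      using sum_of_bool_delta[OF assms(2), of "\<lambda>c'. A * X i c' a"] by (simp only: sum.distrib sum_distrib_left)
    finally show "(\<Sum>c'<d. \<Sum>e<d. entry_cov A B (a, c) (c', e) * X i c' e) = \<dots>" .
  qed
  also have "\<dots> = (\<Sum>i<l. A * X i c a + of_bool (a = c) * B * (\<Sum>u\<in>walks d (l - 1) p q. G u))"
    by (intro sum.cong refl) (simp add: X_def sum_walks_glue[OF assms(3)])
  also have "\<dots> = A * (\<Sum>i<l. X i c a) + (if a = c then B * of_nat l * (\<Sum>u\<in>walks d (l - 1) p q. G u) else 0)"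
    by (auto simp: sum.distrib sum_distrib_left mult_ac)
  finally show ?thesis by (simp only: X_def)
qed

section \<open>Products of traces and the loop equation\<close>

text \<open>If \<open>g\<close> gives the joint moments of the matrix entries, this is the mean of
  the product of the traces of the powers listed. An exponent 0 contributes the trace
  \<open>d\<close> of the identity.\<close>

primrec loop_sum :: "nat \<Rightarrow> nat list \<Rightarrow> ((nat \<times> nat) list \<Rightarrow> complex) \<Rightarrow> complex" where
  "loop_sum d [] g = g []"
| "loop_sum d (k # ks) g = (\<Sum>a<d. \<Sum>u\<in>walks d k a a. loop_sum d ks (\<lambda>v. g (u @ v)))"

lemma loop_sum_add: "loop_sum d ks (\<lambda>v. g v + g' v) = loop_sum d ks g + loop_sum d ks g'"
  by (induction ks arbitrary: g g') (auto simp: sum.distrib)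

lemma loop_sum_mult: "loop_sum d ks (\<lambda>v. z * g v) = z * loop_sum d ks g"
  by (induction ks arbitrary: g) (auto simp: sum_distrib_left)

lemma loop_sum_zero: "loop_sum d ks (\<lambda>v. 0) = 0"
  by (induction ks) auto

lemma loop_sum_pick:
  "loop_sum d ks (\<lambda>v. pick h (\<lambda>s. g s v) u) = pick h (\<lambda>s. loop_sum d ks (g s)) u"
  by (induction u arbitrary: g) (auto simp: loop_sum_zero loop_sum_add loop_sum_mult)

text \<open>The shape of the Leibniz rule for a product indexed by a list: \<open>H\<close> receives
  the differentiated factor and the list of the others.\<close>

primrec pickl :: "('a \<Rightarrow> 'a list \<Rightarrow> complex) \<Rightarrow> 'a list \<Rightarrow> complex" where
  "pickl H [] = 0"
| "pickl H (l # ks) = H l ks + pickl (\<lambda>l' r. H l' (l # r)) ks"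

lemma pickl_add: "pickl (\<lambda>l r. H l r + H' l r) ks = pickl H ks + pickl H' ks"
  by (induction ks arbitrary: H H') (auto simp: algebra_simps)

lemma pickl_mult: "pickl (\<lambda>l r. z * H l r) ks = z * pickl H ks"
  by (induction ks arbitrary: H) (auto simp: algebra_simps)

lemma pickl_zero: "pickl (\<lambda>l r. 0) ks = 0"
  by (induction ks) auto

lemma pickl_sum: "pickl (\<lambda>l r. \<Sum>i\<in>I. H i l r) ks = (\<Sum>i\<in>I. pickl (H i) ks)"
  by (induction I rule: infinite_finite_induct) (auto simp: pickl_add pickl_zero)

lemma pickl_cong:
  assumes "\<And>l r. mset (l # r) = mset ks \<Longrightarrow> H l r = H' l r"
  shows "pickl H ks = pickl H' ks"
  using assms
proof (induction ks arbitrary: H H')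
  case (Cons k ks)
  have "pickl (\<lambda>l' r. H l' (k # r)) ks = pickl (\<lambda>l' r. H' l' (k # r)) ks"
    by (rule Cons.IH) (use Cons.prems in auto)
  then show ?case using Cons.prems[of k ks] by simp
qed simp

lemma sum_swap4:
  "(\<Sum>a\<in>I. \<Sum>u\<in>U a. \<Sum>b\<in>J. \<Sum>v\<in>V b. f a u b v) = (\<Sum>b\<in>J. \<Sum>v\<in>V b. \<Sum>a\<in>I. \<Sum>u\<in>U a. f a u b v)"
proof -
  have "(\<Sum>a\<in>I. \<Sum>u\<in>U a. \<Sum>b\<in>J. \<Sum>v\<in>V b. f a u b v) =
      (\<Sum>a\<in>I. \<Sum>b\<in>J. \<Sum>u\<in>U a. \<Sum>v\<in>V b. f a u b v)"
    by (intro sum.cong refl sum.swap)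
  also have "\<dots> = (\<Sum>b\<in>J. \<Sum>a\<in>I. \<Sum>u\<in>U a. \<Sum>v\<in>V b. f a u b v)"
    by (rule sum.swap)
  also have "\<dots> = (\<Sum>b\<in>J. \<Sum>a\<in>I. \<Sum>v\<in>V b. \<Sum>u\<in>U a. f a u b v)"
    by (intro sum.cong refl sum.swap)
  also have "\<dots> = (\<Sum>b\<in>J. \<Sum>v\<in>V b. \<Sum>a\<in>I. \<Sum>u\<in>U a. f a u b v)"
    by (intro sum.cong refl sum.swap)
  finally show ?thesis .
qed

lemma perm_inv_append: "perm_inv g \<Longrightarrow> perm_inv (\<lambda>v. g (u @ v))"
  by (simp add: perm_inv_def)

text \<open>The deleted letter lies in the word of one of the traces. Invariance under reordering
  moves that word to the front, and the remaining traces again form a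
  \<open>loop_sum\<close>.\<close>

lemma loop_sum_pick_word:
  assumes "perm_inv g"
  shows "loop_sum d ks (pick h g) =
    pickl (\<lambda>l r. \<Sum>a<d. \<Sum>u\<in>walks d l a a. pick h (\<lambda>s. loop_sum d r (\<lambda>v. g (s @ v))) u) ks"
  using assms
proof (induction ks arbitrary: g)
  case (Cons l ks)
  have swap: "g (u @ s @ v) = g (s @ u @ v)" for u s v
    using Cons.prems unfolding perm_inv_def by (metis mset_append union_assoc union_commute)
  have "loop_sum d (l # ks) (pick h g) =
      (\<Sum>a<d. \<Sum>u\<in>walks d l a a. pick h (\<lambda>s. loop_sum d ks (\<lambda>v. g (s @ v))) u) +
      (\<Sum>a<d. \<Sum>u\<in>walks d l a a. loop_sum d ks (pick h (\<lambda>s. g (u @ s))))"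
    by (simp add: pick_append loop_sum_add loop_sum_pick sum.distrib)
  also have "(\<Sum>a<d. \<Sum>u\<in>walks d l a a. loop_sum d ks (pick h (\<lambda>s. g (u @ s)))) =
     (\<Sum>a<d. \<Sum>u\<in>walks d l a a. pickl (\<lambda>l r. \<Sum>a<d. \<Sum>u'\<in>walks d l a a.
        pick h (\<lambda>s. loop_sum d r (\<lambda>v. g (u @ s @ v))) u') ks)"
    by (intro sum.cong refl Cons.IH perm_inv_append Cons.prems)
  also have "\<dots> = pickl (\<lambda>l' r. \<Sum>a'<d. \<Sum>u'\<in>walks d l' a' a'.
        pick h (\<lambda>s. loop_sum d (l # r) (\<lambda>v. g (s @ v))) u') ks"
    unfolding pickl_sum[symmetric] loop_sum.simps pick_sum swap
    by (rule pickl_cong) (rule sum_swap4)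
  finally show ?case by simp
qed simp

text \<open>Gaussian integration by parts for the first entry of the first trace. An
  \<open>A\<close> contraction inside this trace cuts it into \<open>i\<close> and
  \<open>k - 1 - i\<close>; one with another trace fuses both into length \<open>k + l - 1\<close>,
  in \<open>l\<close> ways. A \<open>B\<close> contraction just deletes the two entries. Where the
  subtraction of naturals would truncate, the factor \<open>of_nat k\<close> or
  \<open>of_nat l\<close> is 0.\<close>

lemma loop_equation:
  fixes d :: nat and A B :: complex
  defines "W \<equiv> wick (entry_cov A B)"
  shows "loop_sum d (Suc k # ks) W =
    A * ((\<Sum>i<k. loop_sum d (i # (k - 1 - i) # ks) W) +
         pickl (\<lambda>l r. of_nat l * loop_sum d ((k + l - 1) # r) W) ks) +
    B * (of_nat k * loop_sum d ((k - 1) # ks) W + pickl (\<lambda>l r. of_nat l * loop_sum d (k # (l - 1) # r) W) ks)"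
proof -
  let ?h = "\<lambda>a c. entry_cov A B (a, c)"
  have inv: "perm_inv W" unfolding W_def by (rule perm_inv_wick) (rule entry_cov_sym)
  define H where "H r s = loop_sum d r (\<lambda>v. W (s @ v))" for r s
  have H_perm: "H r (u @ s @ t) = H r (s @ u @ t)" for r u s t
  proof -
    have "W ((u @ s @ t) @ v) = W ((s @ u @ t) @ v)" for v
      by (rule inv[unfolded perm_inv_def, rule_format]) (simp add: ac_simps)
    then show ?thesis by (simp add: H_def)
  qed
  have one: "loop_sum d (l # r) W = (\<Sum>a<d. \<Sum>u\<in>walks d l a a. H r u)" for l r
    by (simp add: H_def)
  have two: "loop_sum d (l # l' # r) W =
      (\<Sum>a<d. \<Sum>u\<in>walks d l a a. \<Sum>b<d. \<Sum>v\<in>walks d l' b b. H r (u @ v))" for l l' r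
    by (simp add: H_def)
  have cut: "(\<Sum>a<d. \<Sum>c<d. \<Sum>u\<in>walks d k c a. pick (?h a c) (H ks) u) =
      A * (\<Sum>i<k. loop_sum d (i # (k - 1 - i) # ks) W) + B * (of_nat k * loop_sum d ((k - 1) # ks) W)"
  proof -
    have "(\<Sum>a<d. \<Sum>c<d. \<Sum>u\<in>walks d k c a. pick (?h a c) (H ks) u) =
      (\<Sum>a<d. \<Sum>c<d. A * (\<Sum>i<k. \<Sum>s\<in>walks d i c c. \<Sum>t\<in>walks d (k - 1 - i) a a. H ks (s @ t)) +
         (if a = c then B * of_nat k * (\<Sum>u\<in>walks d (k - 1) c a. H ks u) else 0))"
      by (intro sum.cong refl sum_walks_pick_cov) auto
    also have "\<dots> = A * (\<Sum>a<d. \<Sum>c<d. \<Sum>i<k. \<Sum>s\<in>walks d i c c. \<Sum>t\<in>walks d (k - 1 - i) a a. H ks (s @ t)) +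
        (\<Sum>a<d. B * of_nat k * (\<Sum>u\<in>walks d (k - 1) a a. H ks u))"
      by (simp add: sum.distrib sum_distrib_left sum.delta')
    also have "(\<Sum>a<d. \<Sum>c<d. \<Sum>i<k. \<Sum>s\<in>walks d i c c. \<Sum>t\<in>walks d (k - 1 - i) a a. H ks (s @ t)) =
       (\<Sum>c<d. \<Sum>a<d. \<Sum>i<k. \<Sum>s\<in>walks d i c c. \<Sum>t\<in>walks d (k - 1 - i) a a. H ks (s @ t))"
      by (rule sum.swap)
    also have "\<dots> = (\<Sum>c<d. \<Sum>i<k. \<Sum>a<d. \<Sum>s\<in>walks d i c c. \<Sum>t\<in>walks d (k - 1 - i) a a. H ks (s @ t))"
      by (intro sum.cong refl sum.swap)
    also have "\<dots> = (\<Sum>c<d. \<Sum>i<k. \<Sum>s\<in>walks d i c c. \<Sum>a<d. \<Sum>t\<in>walks d (k - 1 - i) a a. H ks (s @ t))"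
      by (intro sum.cong refl sum.swap)
    also have "\<dots> = (\<Sum>i<k. loop_sum d (i # (k - 1 - i) # ks) W)"
      unfolding two by (rule sum.swap)
    also have "(\<Sum>a<d. B * of_nat k * (\<Sum>u\<in>walks d (k - 1) a a. H ks u)) = 
        B * (of_nat k * loop_sum d ((k - 1) # ks) W)"
      unfolding one by (simp add: sum_distrib_left mult_ac)
    finally show ?thesis .
  qed
  have join: "(\<Sum>a<d. \<Sum>c<d. \<Sum>u\<in>walks d k c a. \<Sum>p<d. \<Sum>v\<in>walks d l p p. pick (?h a c) (\<lambda>s. H r (u @ s)) v) =
      A * (of_nat l * loop_sum d ((k + l - 1) # r) W) + B * (of_nat l * loop_sum d (k # (l - 1) # r) W)" for l r
  proof -
    have "(\<Sum>a<d. \<Sum>c<d. \<Sum>u\<in>walks d k c a. \<Sum>p<d. \<Sum>v\<in>walks d l p p. pick (?h a c) (\<lambda>s. H r (u @ s)) v) =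
      (\<Sum>a<d. \<Sum>c<d. \<Sum>u\<in>walks d k c a. \<Sum>p<d.
        A * (\<Sum>i<l. \<Sum>s\<in>walks d i p c. \<Sum>t\<in>walks d (l - 1 - i) a p. H r (u @ s @ t)) +
        (if a = c then B * of_nat l * (\<Sum>v\<in>walks d (l - 1) p p. H r (u @ v)) else 0))"
      by (intro sum.cong refl sum_walks_pick_cov) auto
    also have "\<dots> = A * (\<Sum>a<d. \<Sum>c<d. \<Sum>u\<in>walks d k c a. \<Sum>p<d. \<Sum>i<l. \<Sum>s\<in>walks d i p c. \<Sum>t\<in>walks d (l - 1 - i) a p. H r (u @ s @ t)) +
        (\<Sum>a<d. \<Sum>c<d. if a = c then B * of_nat l * (\<Sum>u\<in>walks d k c a. \<Sum>p<d. \<Sum>v\<in>walks d (l - 1) p p. H r (u @ v)) else 0)"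
    proof -
      have "(\<Sum>u\<in>walks d k c a. \<Sum>p<d. if a = c then B * of_nat l * (\<Sum>v\<in>walks d (l - 1) p p. H r (u @ v)) else 0) =
         (if a = c then B * of_nat l * (\<Sum>u\<in>walks d k c a. \<Sum>p<d. \<Sum>v\<in>walks d (l - 1) p p. H r (u @ v)) else 0)" for a c
        by (cases "a = c") (simp_all add: sum_distrib_left)
      then show ?thesis by (simp only: sum.distrib sum_distrib_left)
    qed
    also have "(\<Sum>a<d. \<Sum>c<d. if a = c then B * of_nat l * (\<Sum>u\<in>walks d k c a. \<Sum>p<d. \<Sum>v\<in>walks d (l - 1) p p. H r (u @ v)) else 0) =
       B * (of_nat l * loop_sum d (k # (l - 1) # r) W)"
      unfolding two by (simp add: sum.delta' sum_distrib_left mult_ac)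
    \<comment> \<open>The word \<open>u\<close> leads from \<open>c\<close> to \<open>a\<close>. By
      \<open>H_perm\<close> it is inserted between \<open>s\<close> and \<open>t\<close>, which
      makes a single closed walk based at \<open>p\<close>.\<close>
    also have "(\<Sum>a<d. \<Sum>c<d. \<Sum>u\<in>walks d k c a. \<Sum>p<d. \<Sum>i<l. \<Sum>s\<in>walks d i p c. \<Sum>t\<in>walks d (l - 1 - i) a p. H r (u @ s @ t)) =
      (\<Sum>i<l. \<Sum>p<d. \<Sum>c<d. \<Sum>s\<in>walks d i p c. \<Sum>a<d. \<Sum>u\<in>walks d k c a. \<Sum>t\<in>walks d (l - 1 - i) a p. H r (s @ u @ t))"
    proof -
      have "(\<Sum>a<d. \<Sum>c<d. \<Sum>u\<in>walks d k c a. \<Sum>p<d. \<Sum>i<l. \<Sum>s\<in>walks d i p c. \<Sum>t\<in>walks d (l - 1 - i) a p. H r (u @ s @ t)) =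
        (\<Sum>c<d. \<Sum>a<d. \<Sum>u\<in>walks d k c a. \<Sum>p<d. \<Sum>i<l. \<Sum>s\<in>walks d i p c. \<Sum>t\<in>walks d (l - 1 - i) a p. H r (s @ u @ t))"
        unfolding H_perm by (rule sum.swap)
      also have "\<dots> = (\<Sum>c<d. \<Sum>p<d. \<Sum>i<l. \<Sum>a<d. \<Sum>u\<in>walks d k c a. \<Sum>s\<in>walks d i p c. \<Sum>t\<in>walks d (l - 1 - i) a p. H r (s @ u @ t))"
        by (intro sum.cong refl sum_swap4)
      also have "\<dots> = (\<Sum>p<d. \<Sum>c<d. \<Sum>i<l. \<Sum>a<d. \<Sum>u\<in>walks d k c a. \<Sum>s\<in>walks d i p c. \<Sum>t\<in>walks d (l - 1 - i) a p. H r (s @ u @ t))"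
        by (rule sum.swap)
      also have "\<dots> = (\<Sum>p<d. \<Sum>i<l. \<Sum>c<d. \<Sum>a<d. \<Sum>u\<in>walks d k c a. \<Sum>s\<in>walks d i p c. \<Sum>t\<in>walks d (l - 1 - i) a p. H r (s @ u @ t))"
        by (intro sum.cong refl sum.swap)
      also have "\<dots> = (\<Sum>i<l. \<Sum>p<d. \<Sum>c<d. \<Sum>a<d. \<Sum>u\<in>walks d k c a. \<Sum>s\<in>walks d i p c. \<Sum>t\<in>walks d (l - 1 - i) a p. H r (s @ u @ t))"
        by (rule sum.swap)
      also have "\<dots> = (\<Sum>i<l. \<Sum>p<d. \<Sum>c<d. \<Sum>a<d. \<Sum>s\<in>walks d i p c. \<Sum>u\<in>walks d k c a. \<Sum>t\<in>walks d (l - 1 - i) a p. H r (s @ u @ t))"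
        by (intro sum.cong refl sum.swap)
      also have "\<dots> = (\<Sum>i<l. \<Sum>p<d. \<Sum>c<d. \<Sum>s\<in>walks d i p c. \<Sum>a<d. \<Sum>u\<in>walks d k c a. \<Sum>t\<in>walks d (l - 1 - i) a p. H r (s @ u @ t))"
        by (intro sum.cong refl sum.swap)
      finally show ?thesis .
    qed
    also have "\<dots> = (\<Sum>i<l. loop_sum d ((k + l - 1) # r) W)"
    proof (rule sum.cong[OF refl])
      fix i assume "i \<in> {..<l}"
      then have i: "i + (k + (l - 1 - i)) = k + l - 1" by auto
      have "(\<Sum>p<d. \<Sum>c<d. \<Sum>s\<in>walks d i p c. \<Sum>a<d. \<Sum>u\<in>walks d k c a. \<Sum>t\<in>walks d (l - 1 - i) a p. H r (s @ u @ t)) =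
        (\<Sum>p<d. \<Sum>c<d. \<Sum>s\<in>walks d i p c. \<Sum>u\<in>walks d (k + (l - 1 - i)) c p. H r (s @ u))"
        by (intro sum.cong refl sum_walks_glue) auto
      also have "\<dots> = (\<Sum>p<d. \<Sum>u\<in>walks d (k + l - 1) p p. H r u)"
        unfolding i[symmetric] by (intro sum.cong refl sum_walks_glue) auto
      finally show "(\<Sum>p<d. \<Sum>c<d. \<Sum>s\<in>walks d i p c. \<Sum>a<d. \<Sum>u\<in>walks d k c a. \<Sum>t\<in>walks d (l - 1 - i) a p. H r (s @ u @ t)) =
        loop_sum d ((k + l - 1) # r) W" unfolding one .
    qed
    finally show ?thesis by simp
  qed
  have "loop_sum d (Suc k # ks) W =
      (\<Sum>a<d. \<Sum>c<d. \<Sum>u\<in>walks d k c a. loop_sum d ks (\<lambda>v. pick (?h a c) W (u @ v)))"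
    by (simp add: sum_walks_Suc W_def wick_Cons)
  also have "\<dots> = (\<Sum>a<d. \<Sum>c<d. \<Sum>u\<in>walks d k c a. pick (?h a c) (H ks) u) +
     (\<Sum>a<d. \<Sum>c<d. \<Sum>u\<in>walks d k c a. loop_sum d ks (pick (?h a c) (\<lambda>s. W (u @ s))))"
    by (simp add: pick_append loop_sum_add loop_sum_pick H_def[abs_def] sum.distrib)
  also have "(\<Sum>a<d. \<Sum>c<d. \<Sum>u\<in>walks d k c a. loop_sum d ks (pick (?h a c) (\<lambda>s. W (u @ s)))) =
     (\<Sum>a<d. \<Sum>c<d. \<Sum>u\<in>walks d k c a. pickl (\<lambda>l r. \<Sum>p<d. \<Sum>v\<in>walks d l p p.
       pick (?h a c) (\<lambda>s. H r (u @ s)) v) ks)"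
    by (simp add: loop_sum_pick_word perm_inv_append inv H_def)
  also have "\<dots> = pickl (\<lambda>l r. \<Sum>a<d. \<Sum>c<d. \<Sum>u\<in>walks d k c a. \<Sum>p<d. \<Sum>v\<in>walks d l p p.
       pick (?h a c) (\<lambda>s. H r (u @ s)) v) ks"
    by (simp only: pickl_sum)
  also have "\<dots> = A * pickl (\<lambda>l r. of_nat l * loop_sum d ((k + l - 1) # r) W) ks +
      B * pickl (\<lambda>l r. of_nat l * loop_sum d (k # (l - 1) # r) W) ks"
    unfolding join pickl_add pickl_mult ..
  finally show ?thesis unfolding cut by (simp add: algebra_simps)
qed

section \<open>The Gaussian functional and Hermite polynomials\<close>

fun gauss_moment :: "nat \<Rightarrow> complex" where
  "gauss_moment 0 = 1"
| "gauss_moment (Suc 0) = 0"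
| "gauss_moment (Suc (Suc k)) = of_nat (Suc k) * gauss_moment k"

definition gauss :: "complex poly \<Rightarrow> complex" where
  "gauss q = (\<Sum>k\<le>degree q. coeff q k * gauss_moment k)"

lemma gauss_superset: "degree q \<le> n \<Longrightarrow> gauss q = (\<Sum>k\<le>n. coeff q k * gauss_moment k)"
  unfolding gauss_def by (rule sum.mono_neutral_left) (auto simp: coeff_eq_0)

lemma gauss_add: "gauss (p + q) = gauss p + gauss q"
proof -
  let ?n = "max (degree p) (degree q)"
  have "degree (p + q) \<le> ?n" by (rule degree_add_le) auto
  then show ?thesis
    by (simp add: gauss_superset[of _ ?n] sum.distrib distrib_right)
qed

lemma gauss_smult: "gauss (Polynomial.smult c p) = c * gauss p"
  by (simp add: gauss_superset[of _ "degree p"] degree_smult_le sum_distrib_left mult.assoc)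

lemma gauss_0 [simp]: "gauss 0 = 0"
  by (simp add: gauss_def)

lemma gauss_const: "gauss [:c:] = c"
  by (simp add: gauss_def)

lemma gauss_sum: "gauss (\<Sum>i\<in>I. p i) = (\<Sum>i\<in>I. gauss (p i))"
  by (induction I rule: infinite_finite_induct) (auto simp: gauss_add)

lemma gauss_diff: "gauss (p - q) = gauss p - gauss q"
  using gauss_add[of "p - q" q] by simp

lemma gauss_monom: "gauss (monom c k) = c * gauss_moment k"
proof -
  have "gauss (monom c k) = (\<Sum>j\<le>k. if j = k then c * gauss_moment k else 0)"
    unfolding gauss_superset[OF degree_monom_le] by (rule sum.cong) auto
  then show ?thesis by (simp add: sum.delta)
qed

lemma gauss_by_parts: "gauss (pCons 0 q) = gauss (pderiv q)"
proof -
  define n where "n = degree q"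
  have "degree (pCons 0 q) \<le> Suc n" by (simp add: n_def degree_pCons_le)
  then have "gauss (pCons 0 q) = (\<Sum>k\<le>Suc n. coeff (pCons 0 q) k * gauss_moment k)"
    by (rule gauss_superset)
  also have "\<dots> = (\<Sum>k\<le>n. coeff q k * gauss_moment (Suc k))"
    by (subst sum.atMost_Suc_shift) simp
  also have "\<dots> = (\<Sum>k\<le>Suc n. coeff q k * gauss_moment (Suc k))"
    by (simp add: n_def coeff_eq_0)
  also have "\<dots> = (\<Sum>k\<le>n. coeff q (Suc k) * gauss_moment (Suc (Suc k)))"
    by (subst sum.atMost_Suc_shift) simp
  also have "\<dots> = (\<Sum>k\<le>n. coeff (pderiv q) k * gauss_moment k)"
    by (simp add: coeff_pderiv mult_ac)
  also have "\<dots> = gauss (pderiv q)"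
    by (rule gauss_superset[symmetric]) (simp add: n_def degree_pderiv)
  finally show ?thesis .
qed

text \<open>Lagrange interpolation turns the Gaussian functional on polynomials of bounded degree into
  a finite sum with (complex) weights, so that multivariate Gaussian expectations become sums over
  finite grids.\<close>

lemma ex_quadrature:
  "\<exists>N w. finite N \<and> (\<forall>q. degree q \<le> M \<longrightarrow> (\<Sum>x\<in>N. w x * poly q x) = gauss q)"
proof -
  define N where "N = (of_nat :: nat \<Rightarrow> complex) ` {..M}"
  have fin: "finite N" and card: "card N = Suc M"
    by (simp_all add: N_def card_image inj_on_def)
  define l where "l x = (\<Prod>y\<in>N - {x}. Polynomial.smult (1 / (x - y)) [:- y, 1:])" for x
  have l: "poly (l x) y = (if x = y then 1 else 0)" if "x \<in> N" "y \<in> N" for x y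
  proof (cases "x = y")
    case True
    have "poly (l x) y = (\<Prod>z\<in>N - {x}. 1)"
      unfolding l_def poly_prod using True
    proof (intro prod.cong refl)
      fix z assume "z \<in> N - {x}"
      then have "y - z \<noteq> 0" using True by auto
      then show "poly (Polynomial.smult (1 / (x - z)) [:- z, 1:]) y = 1"
        using True by (simp only: poly_smult poly_pCons poly_0) (simp add: divide_simps)
    qed
    with True show ?thesis by simp
  next
    case False
    then have "y \<in> N - {x}" using that by simp
    moreover have "poly (Polynomial.smult (1 / (x - y)) [:- y, 1:]) y = 0" by simp
    ultimately have "poly (l x) y = 0"
      unfolding l_def poly_prod using fin by (intro prod_zero) blast+
    with False show ?thesis by simp
  qed
  have deg: "degree (l x) \<le> M" if "x \<in> N" for x
  proof -
    have "degree (l x) \<le> (\<Sum>y\<in>N - {x}. degree (Polynomial.smult (1 / (x - y)) [:- y, 1:]))"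
      unfolding l_def using degree_prod_sum_le[of "N - {x}" "\<lambda>y. Polynomial.smult (1 / (x - y)) [:- y, 1:]"] fin
      by (simp only: comp_def finite_Diff)
    also have "\<dots> \<le> (\<Sum>y\<in>N - {x}. 1)"
      by (intro sum_mono order_trans[OF degree_smult_le]) simp
    finally have "degree (l x) \<le> (\<Sum>y\<in>N - {x}. 1)" .
    then show ?thesis using that fin card by simp
  qed
  have "(\<Sum>x\<in>N. gauss (l x) * poly q x) = gauss q" if "degree q \<le> M" for q
  proof -
    have "q = (\<Sum>x\<in>N. Polynomial.smult (poly q x) (l x))"
    proof (rule poly_eqI_degree)
      fix y assume y: "y \<in> N"
      have "poly (\<Sum>x\<in>N. Polynomial.smult (poly q x) (l x)) y = (\<Sum>x\<in>N. if x = y then poly q y else 0)"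
        unfolding poly_sum by (rule sum.cong) (auto simp: l y)
      then show "poly q y = poly (\<Sum>x\<in>N. Polynomial.smult (poly q x) (l x)) y"
        using y fin by (simp add: sum.delta)
    next
      have "degree (\<Sum>x\<in>N. Polynomial.smult (poly q x) (l x)) \<le> M"
        by (intro degree_sum_le fin order_trans[OF degree_smult_le] deg)
      then show "degree (\<Sum>x\<in>N. Polynomial.smult (poly q x) (l x)) < card N" using card by simp
    qed (use that card in simp)
    then have "gauss q = gauss (\<Sum>x\<in>N. Polynomial.smult (poly q x) (l x))" by (rule arg_cong)
    then show ?thesis by (simp add: gauss_sum gauss_smult mult.commute)
  qed
  with fin show ?thesis by (intro exI[of _ N] exI[of _ "\<lambda>x. gauss (l x)"]) simp
qed

section \<open>Hermite polynomials\<close>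

text \<open>The probabilists' normalisation, generated by the raising operator that is adjoint to
  differentiation under \<open>gauss\<close>.\<close>

primrec herm :: "nat \<Rightarrow> complex poly" where
  "herm 0 = 1"
| "herm (Suc n) = pCons 0 (herm n) - pderiv (herm n)"

declare herm.simps(2) [simp del]
lemmas herm_Suc = herm.simps(2)

lemma pderiv_herm: "pderiv (herm (Suc n)) = Polynomial.smult (of_nat (Suc n)) (herm n)"
proof (induction n)
  case (Suc n)
  have "pderiv (herm (Suc (Suc n))) = herm (Suc n) + pCons 0 (pderiv (herm (Suc n))) - pderiv (pderiv (herm (Suc n)))"
    unfolding herm_Suc[of "Suc n"] pderiv_diff pderiv_pCons by (rule refl)
  also have "\<dots> = herm (Suc n) + Polynomial.smult (of_nat (Suc n)) (pCons 0 (herm n) - pderiv (herm n))"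
    unfolding Suc.IH pderiv_smult by (simp add: smult_diff_right)
  also have "\<dots> = Polynomial.smult (of_nat (Suc (Suc n))) (herm (Suc n))"
    unfolding herm_Suc[of n, symmetric] by (simp only: of_nat_Suc[of "Suc n"] smult_add_left smult_1_left)
  finally show ?case .
qed (simp add: herm_Suc pderiv_pCons)

lemma herm_monic: "degree (herm n) = n \<and> coeff (herm n) n = 1"
proof (induction n)
  case (Suc n)
  have le: "degree (herm (Suc n)) \<le> Suc n"
    unfolding herm_Suc using Suc
    by (intro degree_diff_le order_trans[OF degree_pCons_le]) (auto simp: degree_pderiv)
  have "coeff (herm (Suc n)) (Suc n) = 1"
    using Suc by (simp add: herm_Suc coeff_pderiv coeff_eq_0)
  with le show ?case by (metis le_degree le_antisym one_neq_zero)
qed simp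

text \<open>\<open>herm n\<close> is the \<open>n\<close>-th iterate of the raising operator at 1,
  and integration by parts moves each of the \<open>n\<close> operators to the other factor as a
  derivative.\<close>

lemma gauss_herm_mult: "gauss (herm n * q) = gauss ((pderiv ^^ n) q)"
proof (induction n arbitrary: q)
  case (Suc n)
  have "gauss (herm (Suc n) * q) = gauss (pCons 0 (herm n * q)) - gauss (pderiv (herm n) * q)"
    by (simp add: herm_Suc left_diff_distrib gauss_diff)
  also have "\<dots> = gauss (herm n * pderiv q)"
    by (simp add: gauss_by_parts pderiv_mult gauss_add mult.commute)
  finally show ?case by (simp add: Suc funpow_Suc_right del: funpow.simps)
qed simp

lemma higher_pderiv_herm:
  "j \<le> n \<Longrightarrow> (pderiv ^^ (n - j)) (herm n) = Polynomial.smult (fact n / fact j) (herm j)"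
proof (induction n)
  case (Suc n)
  show ?case
  proof (cases "j = Suc n")
    case False
    then have "Suc n - j = Suc (n - j)" "j \<le> n" using Suc.prems by auto
    then show ?thesis
      using Suc.IH by (simp add: funpow_Suc_right pderiv_herm higher_pderiv_smult del: funpow.simps)
  qed (simp del: fact_Suc)
qed simp

lemma pderiv_sum: "pderiv (\<Sum>i\<in>I. p i) = (\<Sum>i\<in>I. pderiv (p i))"
  by (induction I rule: infinite_finite_induct) (auto simp: pderiv_add)

lemma higher_pderiv_mult:
  fixes p q :: "complex poly"
  shows "(pderiv ^^ n) (p * q) = (\<Sum>j\<le>n. Polynomial.smult (of_nat (n choose j)) ((pderiv ^^ (n - j)) p * (pderiv ^^ j) q))"
proof (induction n)
  case (Suc n)
  define D where "D i j = (pderiv ^^ i) p * (pderiv ^^ j) q" for i j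
  have step: "pderiv (D i j) = D i (Suc j) + D (Suc i) j" for i j
    by (simp add: D_def pderiv_mult mult.commute)
  have "(pderiv ^^ Suc n) (p * q) = (\<Sum>j\<le>n. Polynomial.smult (of_nat (n choose j)) (D (n - j) (Suc j) + D (Suc (n - j)) j))"
    by (simp add: Suc.IH pderiv_sum pderiv_smult D_def[symmetric] step)
  also have "\<dots> = (\<Sum>j\<le>n. Polynomial.smult (of_nat (n choose j)) (D (Suc n - Suc j) (Suc j))) +
      (\<Sum>j\<le>n. Polynomial.smult (of_nat (n choose j)) (D (Suc n - j) j))"
    by (simp add: smult_add_right sum.distrib Suc_diff_le)
  also have "(\<Sum>j\<le>n. Polynomial.smult (of_nat (n choose j)) (D (Suc n - j) j)) =
      (\<Sum>j\<le>Suc n. Polynomial.smult (of_nat (n choose j)) (D (Suc n - j) j))"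
    by (simp add: binomial_eq_0)
  also have "\<dots> = D (Suc n) 0 + (\<Sum>j\<le>n. Polynomial.smult (of_nat (n choose Suc j)) (D (Suc n - Suc j) (Suc j)))"
    by (subst sum.atMost_Suc_shift) simp
  also have "(\<Sum>j\<le>n. Polynomial.smult (of_nat (n choose j)) (D (Suc n - Suc j) (Suc j))) + \<dots> =
      D (Suc n) 0 + (\<Sum>j\<le>n. Polynomial.smult (of_nat (Suc n choose Suc j)) (D (Suc n - Suc j) (Suc j)))"
    by (simp add: sum.distrib[symmetric] smult_add_left)
  also have "\<dots> = (\<Sum>j\<le>Suc n. Polynomial.smult (of_nat (Suc n choose j)) (D (Suc n - j) j))"
    by (subst sum.atMost_Suc_shift) simp
  finally show ?case by (simp add: D_def)
qed simp

lemma higher_pderiv_eq_0: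
  fixes p :: "complex poly"
  assumes "degree p < n"
  shows "(pderiv ^^ n) p = 0"
proof -
  obtain m where m: "n = Suc m" using assms by (cases n) auto
  have "degree ((pderiv ^^ m) p) = 0" using assms m by (simp add: degree_higher_pderiv)
  then have "pderiv ((pderiv ^^ m) p) = 0" using pderiv_eq_0_iff by blast
  then show ?thesis by (simp add: m)
qed

lemma gauss_herm_herm: "gauss (herm m * herm n) = (if m = n then fact m else 0)"
proof -
  have less: "gauss (herm m * herm n) = 0" if "n < m" for m n
    using that by (simp add: gauss_herm_mult higher_pderiv_eq_0 herm_monic)
  have "gauss (herm m * herm m) = fact m"
    using higher_pderiv_herm[of 0 m] by (simp add: gauss_herm_mult gauss_const)
  then show ?thesis using less[of m n] less[of n m] by (cases m n rule: linorder_cases) (auto simp: mult.commute)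
qed

lemma gauss_higher_pderiv_monom:
  "gauss ((pderiv ^^ r) (monom 1 k)) = (if r \<le> k then fact k / fact (k - r) * gauss_moment (k - r) else 0)"
proof (cases "r \<le> k")
  case True
  have "(pderiv ^^ r) (monom (1 :: complex) k) = monom (fact k / fact (k - r)) (k - r)"
    using True
  proof (induction r)
    case (Suc r)
    then have "k - r = Suc (k - Suc r)" by simp
    moreover have "of_nat (Suc (k - Suc r)) \<noteq> (0 :: complex)" by (simp only: of_nat_eq_0_iff)
    ultimately show ?case using Suc by (simp add: pderiv_monom fact_Suc del: of_nat_Suc)
  qed simp
  then show ?thesis using True by (simp add: gauss_monom)
next
  case False
  then show ?thesis by (simp add: higher_pderiv_eq_0 degree_monom_eq)
qed

text \<open>One factor \<open>herm m\<close> becomes \<open>m\<close> derivatives, distributed by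
  the Leibniz rule. If \<open>m - j\<close> of them hit the other Hermite factor, a multiple of
  \<open>herm j\<close> is left, which becomes \<open>j\<close> further derivatives of the monomial,
  \<open>2 * j\<close> in total.\<close>

lemma gauss_herm_square_monom:
  "gauss (herm m * herm m * monom 1 k) / fact m =
    (\<Sum>j\<le>m. of_nat (m choose j) / fact j *
       (if 2 * j \<le> k then fact k / fact (k - 2 * j) * gauss_moment (k - 2 * j) else 0))"
proof -
  have "gauss (herm m * herm m * monom 1 k) =
      (\<Sum>j\<le>m. of_nat (m choose j) * gauss ((pderiv ^^ (m - j)) (herm m) * (pderiv ^^ j) (monom 1 k)))"
    by (simp add: mult.assoc gauss_herm_mult higher_pderiv_mult gauss_sum gauss_smult)
  also have "\<dots> = (\<Sum>j\<le>m. of_nat (m choose j) * (fact m / fact j * gauss ((pderiv ^^ (2 * j)) (monom 1 k))))"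
  proof (rule sum.cong[OF refl])
    fix j assume "j \<in> {..m}"
    then show "of_nat (m choose j) * gauss ((pderiv ^^ (m - j)) (herm m) * (pderiv ^^ j) (monom 1 k)) =
      of_nat (m choose j) * (fact m / fact j * gauss ((pderiv ^^ (2 * j)) (monom 1 k)))"
      by (simp add: higher_pderiv_herm gauss_smult gauss_herm_mult funpow_add mult_2)
  qed
  finally have "gauss (herm m * herm m * monom 1 k) / fact m =
      (\<Sum>j\<le>m. of_nat (m choose j) / fact j * gauss ((pderiv ^^ (2 * j)) (monom 1 k)))"
    by (simp add: sum_divide_distrib mult_ac)
  then show ?thesis unfolding gauss_higher_pderiv_monom .
qed

section \<open>Exponential generating function of the Gaussian moments\<close>

lemma gauss_moment_over_fact: "gauss_moment (2 * p) / fact (2 * p) = 1 / (2 ^ p * fact p)"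
proof (induction p)
  case (Suc p)
  have nz: "of_nat (Suc (2 * p)) \<noteq> (0 :: complex)" by (simp only: of_nat_eq_0_iff)
  have "gauss_moment (2 * Suc p) / fact (2 * Suc p) =
      (of_nat (Suc (2 * p)) * gauss_moment (2 * p)) / (of_nat (Suc (2 * p)) * (of_nat (2 * Suc p) * fact (2 * p)))"
    by (simp del: of_nat_Suc add: fact_Suc mult_ac)
  also have "\<dots> = (gauss_moment (2 * p) / fact (2 * p)) / of_nat (2 * Suc p)"
    using nz by (simp only: mult_divide_mult_cancel_left divide_divide_eq_left mult.commute[of "fact (2 * p)"] simp_thms)
  also have "\<dots> = 1 / (2 ^ Suc p * fact (Suc p))"
  proof -
    have "of_nat (2 * Suc p) = 2 * (of_nat (Suc p) :: complex)"
      by (simp only: of_nat_mult of_nat_numeral)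
    then show ?thesis unfolding Suc.IH by (simp only: fact_Suc power_Suc divide_divide_eq_left mult_ac)
  qed
  finally show ?case .
qed simp

lemma gauss_moment_odd: "gauss_moment (Suc (2 * p)) = 0"
  by (induction p) auto

lemma gauss_moment_sums: "(\<lambda>k. gauss_moment k * z ^ k / fact k) sums exp (z\<^sup>2 / 2)"
proof -
  have "(\<lambda>p. gauss_moment (2 * p) * z ^ (2 * p) / fact (2 * p)) sums exp (z\<^sup>2 / 2)"
  proof -
    have "gauss_moment (2 * p) * z ^ (2 * p) / fact (2 * p) = (z\<^sup>2 / 2) ^ p /\<^sub>R fact p" for p
    proof -
      have "gauss_moment (2 * p) * z ^ (2 * p) / fact (2 * p) = gauss_moment (2 * p) / fact (2 * p) * z ^ (2 * p)"
        by simp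
      also have "\<dots> = (z\<^sup>2 / 2) ^ p /\<^sub>R fact p"
        unfolding gauss_moment_over_fact power_mult[of z 2 p] power_divide
        by (simp add: scaleR_conv_of_real divide_simps)
      finally show ?thesis .
    qed
    then show ?thesis using exp_converges[of "z\<^sup>2 / 2"] by simp
  qed
  then show ?thesis
  proof (subst (asm) sums_mono_reindex)
    show "gauss_moment n * z ^ n / fact n = 0" if "n \<notin> range (\<lambda>p. 2 * p)" for n
    proof -
      have "odd n" using that by (metis evenE rangeI)
      then obtain p where "n = Suc (2 * p)" by (auto elim: oddE)
      then show ?thesis using gauss_moment_odd by simp
    qed
  qed (auto simp: strict_mono_def)
qed

text \<open>Gaussian moments are nonnegative reals, so the series of norms is the same series
  evaluated at \<open>norm z\<close>.\<close>

lemma summable_norm_gauss_moment: "summable (\<lambda>k. norm (gauss_moment k * z ^ k / fact k))"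
proof -
  have nn: "gauss_moment k = of_real (Re (gauss_moment k)) \<and> Re (gauss_moment k) \<ge> 0" for k
    by (induction k rule: gauss_moment.induct) auto
  then have "norm (gauss_moment k) = Re (gauss_moment k)" for k
    by (metis norm_of_real abs_of_nonneg)
  then have "norm (gauss_moment k * z ^ k / fact k) = Re (gauss_moment k * of_real (norm z) ^ k / fact k)" for k
    using nn[of k] by (metis (no_types, lifting) Re_complex_of_real norm_divide norm_fact norm_mult norm_power of_real_divide of_real_fact of_real_mult of_real_power)
  moreover have "summable (\<lambda>k. Re (gauss_moment k * of_real (norm z) ^ k / fact k))"
    by (intro summable_Re sums_summable[OF gauss_moment_sums])
  ultimately show ?thesis by simp
qed

section \<open>Vandermonde determinants\<close>

text \<open>As a function of the last point \<open>t\<close>, the determinant is a polynomial of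
  degree at most \<open>n\<close> that vanishes at the other \<open>n\<close> points and has the
  smaller determinant as its coefficient of \<open>t ^ n\<close>. This identifies it when those
  points are distinct; otherwise both sides are 0.\<close>

lemma det_monic_vandermonde:
  fixes H :: "nat \<Rightarrow> complex poly" and x :: "nat \<Rightarrow> complex"
  assumes H: "\<And>j. degree (H j) = j" "\<And>j. coeff (H j) j = 1"
  shows "det (mat n n (\<lambda>(i, j). poly (H j) (x i))) = (\<Prod>b<n. \<Prod>a<b. x b - x a)"
proof (induction n)
  case (Suc n)
  let ?A = "\<lambda>t. mat (Suc n) (Suc n) (\<lambda>(i, j). poly (H j) (if i = n then t else x i))"
  have A: "?A t \<in> carrier_mat (Suc n) (Suc n)" for t by simp
  have A_eq: "?A (x n) = mat (Suc n) (Suc n) (\<lambda>(i, j). poly (H j) (x i))"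
    by (rule eq_matI) auto
  show ?case
  proof (cases "inj_on x {..<n}")
    case False
    then obtain a b where ab: "a < n" "b < n" "a \<noteq> b" "x a = x b" by (auto simp: inj_on_def)
    have "row (?A (x n)) a = row (?A (x n)) b"
      using ab by (intro eq_vecI) auto
    then have "det (?A (x n)) = 0"
      using ab by (intro det_identical_rows[OF A, of a b]) auto
    moreover have "(\<Prod>b<Suc n. \<Prod>a<b. x b - x a) = 0"
    proof -
      have "\<exists>b<n. \<exists>a<b. x b - x a = 0"
        using ab by (metis cancel_comm_monoid_add_class.diff_cancel linorder_neqE_nat)
      then obtain b a where "b < n" "a < b" "x b - x a = 0" by blast
      then have "(\<Prod>a<b. x b - x a) = 0" "b \<in> {..<Suc n}" by (auto intro!: prod_zero)
      then show ?thesis by (intro prod_zero) auto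
    qed
    ultimately show ?thesis by (simp only: A_eq)
  next
    case True
    define c where "c j = (-1) ^ (n + j) * det (mat_delete (?A 0) n j)" for j
    define q where "q = (\<Sum>j<Suc n. Polynomial.smult (c j) (H j))"
    have del: "mat_delete (?A t) n j = mat_delete (?A 0) n j" for t j
      by (rule eq_matI) (auto simp: mat_delete_def)
    have det: "det (?A t) = poly q t" for t
    proof -
      have "det (?A t) = (\<Sum>j<Suc n. ?A t $$ (n, j) * cofactor (?A t) n j)"
        by (rule laplace_expansion_row[OF A]) simp
      also have "\<dots> = (\<Sum>j<Suc n. c j * poly (H j) t)"
      proof (rule sum.cong[OF refl])
        fix j assume "j \<in> {..<Suc n}"
        then show "?A t $$ (n, j) * cofactor (?A t) n j = c j * poly (H j) t"
          unfolding cofactor_def del[of t j] c_def[symmetric] by simp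
      qed
      finally show ?thesis by (simp add: q_def poly_sum)
    qed
    have "mat_delete (?A 0) n n = mat n n (\<lambda>(i, j). poly (H j) (x i))"
      by (rule eq_matI) (auto simp: mat_delete_def)
    then have cn: "c n = (\<Prod>b<n. \<Prod>a<b. x b - x a)"
      using Suc.IH by (simp add: c_def flip: mult_2)
    have "q = Polynomial.smult (c n) (\<Prod>a<n. [:- x a, 1:])"
    proof (rule poly_eqI_degree_lead_coeff[where A = "x ` {..<n}"])
      show "n \<le> card (x ` {..<n})" using True by (simp add: card_image)
      show deg: "degree q \<le> n" unfolding q_def
        by (intro degree_sum_le order_trans[OF degree_smult_le]) (auto simp: H)
      have lin: "degree (\<Prod>a<n. [:- x a, 1:]) = n \<and> coeff (\<Prod>a<n. [:- x a, 1:]) n = 1"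
      proof -
        have "degree (\<Prod>a<n. [:- x a, 1:]) = (\<Sum>a<n. degree [:- x a, 1:])"
          by (rule degree_prod_eq_sum_degree) auto
        then have d: "degree (\<Prod>a<n. [:- x a, 1:]) = n" by simp
        have "lead_coeff (\<Prod>a<n. [:- x a, 1:]) = 1" by (simp add: lead_coeff_prod)
        with d show ?thesis by simp
      qed
      show "degree (Polynomial.smult (c n) (\<Prod>a<n. [:- x a, 1:])) \<le> n"
        using lin by (intro order_trans[OF degree_smult_le]) simp
      have "coeff q n = (\<Sum>j<Suc n. c j * coeff (H j) n)" by (simp add: q_def coeff_sum)
      also have "\<dots> = c n" using H by (simp add: coeff_eq_0)
      finally show "coeff q n = coeff (Polynomial.smult (c n) (\<Prod>a<n. [:- x a, 1:])) n" using lin by simp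
    next
      fix z assume "z \<in> x ` {..<n}"
      then obtain a where a: "a < n" "z = x a" by auto
      have "row (?A z) a = row (?A z) n" using a by (intro eq_vecI) auto
      then have "det (?A z) = 0" using a by (intro det_identical_rows[OF A, of a n]) auto
      moreover have "poly (\<Prod>a<n. [:- x a, 1:]) z = 0"
        unfolding poly_prod by (rule prod_zero) (use a in auto)
      ultimately show "poly q z = poly (Polynomial.smult (c n) (\<Prod>a<n. [:- x a, 1:])) z" by (simp add: det)
    qed
    then have "det (?A (x n)) = c n * (\<Prod>a<n. x n - x a)"
      by (simp add: det poly_prod)
    then show ?thesis unfolding A_eq by (simp add: cn)
  qed
qed simp

text \<open>Each unordered pair occurs twice with opposite signs, so the constant is a sign, -1 to
  the number of pairs. Only \<open>c \<noteq> 0\<close> is recorded, because the constant cancels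
  against the normalisation.\<close>

lemma prod_differences_eq_square:
  "\<exists>c \<noteq> 0. \<forall>x :: nat \<Rightarrow> complex. (\<Prod>a<n. \<Prod>b\<in>{..<n} - {a}. x a - x b) = c * (\<Prod>b<n. \<Prod>a<b. x b - x a)\<^sup>2"
proof (induction n)
  case 0
  show ?case by (intro exI[of _ 1]) simp
next
  case (Suc n)
  then obtain c where c: "c \<noteq> 0" "\<And>x :: nat \<Rightarrow> complex. (\<Prod>a<n. \<Prod>b\<in>{..<n} - {a}. x a - x b) = c * (\<Prod>b<n. \<Prod>a<b. x b - x a)\<^sup>2"
    by blast
  have "(\<Prod>a<Suc n. \<Prod>b\<in>{..<Suc n} - {a}. x a - x b) = ((-1) ^ n * c) * (\<Prod>b<Suc n. \<Prod>a<b. x b - x a)\<^sup>2"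
    for x :: "nat \<Rightarrow> complex"
  proof -
    have "(\<Prod>a<Suc n. \<Prod>b\<in>{..<Suc n} - {a}. x a - x b) =
      (\<Prod>a<n. \<Prod>b\<in>{..<Suc n} - {a}. x a - x b) * (\<Prod>b\<in>{..<Suc n} - {n}. x n - x b)"
      by simp
    also have "{..<Suc n} - {n} = {..<n}" by auto
    also have "(\<Prod>a<n. \<Prod>b\<in>{..<Suc n} - {a}. x a - x b) = (\<Prod>a<n. (x a - x n) * (\<Prod>b\<in>{..<n} - {a}. x a - x b))"
    proof (rule prod.cong[OF refl])
      fix a assume "a \<in> {..<n}"
      then have "{..<Suc n} - {a} = insert n ({..<n} - {a})" by auto
      then show "(\<Prod>b\<in>{..<Suc n} - {a}. x a - x b) = (x a - x n) * (\<Prod>b\<in>{..<n} - {a}. x a - x b)"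
        by simp
    qed
    also have "\<dots> = (\<Prod>a<n. x a - x n) * (c * (\<Prod>b<n. \<Prod>a<b. x b - x a)\<^sup>2)"
      by (simp add: prod.distrib c(2))
    also have "(\<Prod>a<n. x a - x n) = (\<Prod>a<n. (-1) * (x n - x a))" by simp
    also have "\<dots> = (-1) ^ n * (\<Prod>a<n. x n - x a)" unfolding prod.distrib by simp
    finally show ?thesis by (simp add: power2_eq_square mult_ac)
  qed
  then show ?case using c(1) by (intro exI[of _ "(-1) ^ n * c"]) simp
qed

section \<open>Eigenvalue expectations\<close>

lemma poly_pderiv_prod_list:
  "poly (pderiv (\<Prod>l\<leftarrow>ks. P l)) t = pickl (\<lambda>l r. poly (pderiv (P l)) t * (\<Prod>l\<leftarrow>r. poly (P l) t)) ks"
  for P :: "'a \<Rightarrow> complex poly"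
proof (induction ks)
  case (Cons k ks)
  have "pickl (\<lambda>l r. poly (pderiv (P l)) t * (\<Prod>l\<leftarrow>k # r. poly (P l) t)) ks =
      pickl (\<lambda>l r. poly (P k) t * (poly (pderiv (P l)) t * (\<Prod>l\<leftarrow>r. poly (P l) t))) ks"
    by (rule pickl_cong) (simp add: mult_ac)
  moreover have "poly (\<Prod>l\<leftarrow>ks. P l) t = (\<Prod>l\<leftarrow>ks. poly (P l) t)"
    by (induction ks) auto
  ultimately show ?case using Cons by (simp add: pderiv_mult pickl_mult)
qed simp

text \<open>The identity also holds at the roots, where both sides vanish because \<open>2 / 0 = 0\<close>.\<close>

lemma poly_pderiv_prod_squares:
  fixes z :: "'a \<Rightarrow> complex"
  assumes "finite J"
  shows "poly (pderiv (\<Prod>b\<in>J. [:- z b, 1:]\<^sup>2)) t = (\<Prod>b\<in>J. (t - z b)\<^sup>2) * (\<Sum>b\<in>J. 2 / (t - z b))"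
  using assms
proof (induction J rule: finite_induct)
  case (insert c J)
  let ?R = "\<Prod>b\<in>J. [:- z b, 1:]\<^sup>2"
  have R: "poly ?R t = (\<Prod>b\<in>J. (t - z b)\<^sup>2)"
    by (simp add: poly_prod)
  have "poly (pderiv ([:- z c, 1:]\<^sup>2)) t = 2 * (t - z c)"
    by (simp add: pderiv_power pderiv_pCons algebra_simps)
  then have "poly (pderiv ([:- z c, 1:]\<^sup>2 * ?R)) t = 
      (t - z c)\<^sup>2 * poly (pderiv ?R) t + (\<Prod>b\<in>J. (t - z b)\<^sup>2) * (2 * (t - z c))"
    unfolding pderiv_mult poly_add poly_mult R by simp
  also have "2 * (t - z c) = (t - z c)\<^sup>2 * (2 / (t - z c))"
    by (simp add: power2_eq_square)
  finally show ?case
    using insert by (simp add: algebra_simps)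
qed simp

section \<open>The squared Vandermonde weight and sums over finite grids\<close>

text \<open>The squared Vandermonde determinant up to sign, over ordered pairs, so that all indices
  enter symmetrically and any one of them can be isolated.\<close>

definition vdm2 :: "nat \<Rightarrow> (nat \<Rightarrow> complex) \<Rightarrow> complex" where
  "vdm2 d x = (\<Prod>a<d. \<Prod>b\<in>{..<d} - {a}. x a - x b)"

text \<open>Every other index meets \<open>i\<close> once in each order, which gives the square;
  signs and the factors free of \<open>t\<close> go into \<open>C\<close>.\<close>

lemma vdm2_upd:
  assumes "i < d"
  shows "\<exists>C. \<forall>t. vdm2 d (y(i := t)) = C * (\<Prod>b\<in>{..<d} - {i}. (t - y b)\<^sup>2)"
proof -
  define J where "J = {..<d} - {i}"
  have d: "{..<d} = insert i J" "i \<notin> J" "finite J" using assms by (auto simp: J_def)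
  have "vdm2 d (y(i := t)) = (\<Prod>a\<in>J. - (\<Prod>b\<in>J - {a}. y a - y b)) * (\<Prod>b\<in>J. (t - y b)\<^sup>2)" for t
  proof -
    have "vdm2 d (y(i := t)) = (\<Prod>b\<in>J. (y(i := t)) i - (y(i := t)) b) *
        (\<Prod>a\<in>J. \<Prod>b\<in>insert i J - {a}. (y(i := t)) a - (y(i := t)) b)"
      unfolding vdm2_def d(1) using d(2,3) by simp
    also have "(\<Prod>b\<in>J. (y(i := t)) i - (y(i := t)) b) = (\<Prod>b\<in>J. t - y b)"
      by (rule prod.cong) (use d in auto)
    also have "(\<Prod>a\<in>J. \<Prod>b\<in>insert i J - {a}. (y(i := t)) a - (y(i := t)) b) =
        (\<Prod>a\<in>J. (t - y a) * - (\<Prod>b\<in>J - {a}. y a - y b))"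
    proof (rule prod.cong[OF refl])
      fix a assume a: "a \<in> J"
      then have "insert i J - {a} = insert i (J - {a})" using d by auto
      moreover have "(\<Prod>b\<in>J - {a}. (y(i := t)) a - (y(i := t)) b) = (\<Prod>b\<in>J - {a}. y a - y b)"
        by (rule prod.cong) (use a d in auto)
      moreover have "(y(i := t)) a - (y(i := t)) i = - (t - y a)" using a d by auto
      ultimately show "(\<Prod>b\<in>insert i J - {a}. (y(i := t)) a - (y(i := t)) b) =
          (t - y a) * - (\<Prod>b\<in>J - {a}. y a - y b)"
        using d a by (simp add: algebra_simps)
    qed
    finally show ?thesis by (simp only: prod.distrib power2_eq_square mult_ac)
  qed
  then show ?thesis unfolding J_def by blast
qed

text \<open>\<open>M\<close> is fixed once it is known which moment is to be computed. The degree
  hypotheses below keep all polynomials within the range of exactness.\<close>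

locale quadrature =
  fixes M :: nat and N :: "complex set" and w :: "complex \<Rightarrow> complex"
  assumes finite_N: "finite N"
    and quad: "degree q \<le> M \<Longrightarrow> (\<Sum>x\<in>N. w x * poly q x) = gauss q"
begin

lemma quad_by_parts:
  assumes "degree q < M"
  shows "(\<Sum>t\<in>N. w t * (t * poly q t)) = (\<Sum>t\<in>N. w t * poly (pderiv q) t)"
proof -
  have "(\<Sum>t\<in>N. w t * (t * poly q t)) = (\<Sum>t\<in>N. w t * poly (pCons 0 q) t)" by simp
  also have "\<dots> = gauss (pCons 0 q)"
    by (rule quad) (use assms in \<open>simp add: degree_pCons_eq_if\<close>)
  also have "\<dots> = gauss (pderiv q)" by (rule gauss_by_parts)
  also have "\<dots> = (\<Sum>t\<in>N. w t * poly (pderiv q) t)"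
    by (rule quad[symmetric]) (use assms in \<open>simp add: degree_pderiv\<close>)
  finally show ?thesis .
qed

text \<open>On functions polynomial of degree at most \<open>M\<close> in each variable, this is the
  expectation over \<open>d\<close> independent standard Gaussian variables.\<close>

definition grid_sum :: "nat \<Rightarrow> ((nat \<Rightarrow> complex) \<Rightarrow> complex) \<Rightarrow> complex" where
  "grid_sum d F = (\<Sum>x\<in>{..<d} \<rightarrow>\<^sub>E N. (\<Prod>j<d. w (x j)) * F x)"

lemma grid_sum_split:
  assumes "i < d"
  shows "grid_sum d F = (\<Sum>y\<in>({..<d} - {i}) \<rightarrow>\<^sub>E N. (\<Prod>j\<in>{..<d} - {i}. w (y j)) * (\<Sum>t\<in>N. w t * F (y(i := t))))"
proof -
  define J where "J = {..<d} - {i}"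
  have d: "{..<d} = insert i J" "i \<notin> J" "finite J" using assms by (auto simp: J_def)
  have w: "(\<Prod>j\<in>insert i J. w ((y(i := t)) j)) = w t * (\<Prod>j\<in>J. w (y j))" for y t
  proof -
    have "(\<Prod>j\<in>J. w ((y(i := t)) j)) = (\<Prod>j\<in>J. w (y j))"
      by (rule prod.cong) (use d in auto)
    then show ?thesis using d by simp
  qed
  have "grid_sum d F = (\<Sum>(t, y)\<in>N \<times> (J \<rightarrow>\<^sub>E N). (\<Prod>j\<in>insert i J. w ((y(i := t)) j)) * F (y(i := t)))"
    unfolding grid_sum_def d(1) PiE_insert_eq
    by (subst sum.reindex[OF inj_combinator[OF d(2)]]) (simp add: case_prod_unfold)
  also have "\<dots> = (\<Sum>(t, y)\<in>N \<times> (J \<rightarrow>\<^sub>E N). w t * (\<Prod>j\<in>J. w (y j)) * F (y(i := t)))"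
    unfolding w ..
  also have "\<dots> = (\<Sum>t\<in>N. \<Sum>y\<in>J \<rightarrow>\<^sub>E N. w t * (\<Prod>j\<in>J. w (y j)) * F (y(i := t)))"
    by (rule sum.cartesian_product[symmetric])
  also have "\<dots> = (\<Sum>y\<in>J \<rightarrow>\<^sub>E N. \<Sum>t\<in>N. w t * (\<Prod>j\<in>J. w (y j)) * F (y(i := t)))"
    by (rule sum.swap)
  moreover have "(\<Sum>t\<in>N. w t * P * G t) = P * (\<Sum>t\<in>N. w t * G t)" for P G
    by (subst sum_distrib_left) (simp only: mult_ac)
  ultimately show ?thesis by (simp only: J_def)
qed

text \<open>Integration by parts in the variable \<open>i\<close> with the others frozen at
  \<open>y\<close>. \<open>F'\<close> only has to agree with the derivative as a function, so it may
  be a formula with quotients that are 0 at coinciding points.\<close>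

lemma grid_sum_by_parts:
  assumes "i < d"
    and "\<And>y. \<exists>q. degree q < M \<and> (\<forall>t. F (y(i := t)) = poly q t \<and> F' (y(i := t)) = poly (pderiv q) t)"
  shows "grid_sum d (\<lambda>x. x i * F x) = grid_sum d F'"
proof -
  have "(\<Sum>t\<in>N. w t * ((y(i := t)) i * F (y(i := t)))) = (\<Sum>t\<in>N. w t * F' (y(i := t)))" for y
  proof -
    obtain q where "degree q < M" "\<And>t. F (y(i := t)) = poly q t" "\<And>t. F' (y(i := t)) = poly (pderiv q) t"
      using assms(2) by blast
    then show ?thesis using quad_by_parts[of q] by simp
  qed
  then show ?thesis unfolding grid_sum_split[OF assms(1)] by simp
qed

lemma grid_sum_add: "grid_sum d (\<lambda>x. F x + G x) = grid_sum d F + grid_sum d G"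
  by (simp add: grid_sum_def distrib_left sum.distrib)

lemma grid_sum_mult: "grid_sum d (\<lambda>x. c * F x) = c * grid_sum d F"
  by (simp add: grid_sum_def sum_distrib_left mult_ac)

lemma grid_sum_zero: "grid_sum d (\<lambda>x. 0) = 0"
  by (simp add: grid_sum_def)

lemma grid_sum_sum: "grid_sum d (\<lambda>x. \<Sum>i\<in>I. F i x) = (\<Sum>i\<in>I. grid_sum d (F i))"
  by (induction I rule: infinite_finite_induct) (auto simp: grid_sum_add grid_sum_zero)

lemma grid_sum_pickl: "grid_sum d (\<lambda>x. pickl (\<lambda>l r. H l r x) ks) = pickl (\<lambda>l r. grid_sum d (H l r)) ks"
  by (induction ks arbitrary: H) (auto simp: grid_sum_add grid_sum_zero)

end

text \<open>Used with \<open>\<alpha>\<^sup>2 = 1/d\<close> and \<open>\<beta>\<^sup>2 = - 1/d\<^sup>2\<close>: the common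
  shift by the imaginary Gaussian \<open>\<beta> * g\<close> removes the variance of the trace.\<close>

definition psum :: "nat \<Rightarrow> complex \<Rightarrow> complex \<Rightarrow> complex \<Rightarrow> (nat \<Rightarrow> complex) \<Rightarrow> nat \<Rightarrow> complex" where
  "psum d \<alpha> \<beta> g x l = (\<Sum>j<d. (\<alpha> * x j + \<beta> * g) ^ l)"

text \<open>Symmetrising in \<open>i\<close> and \<open>b\<close> turns the quotients into a
  difference of \<open>k\<close>-th powers divided by \<open>x i - x b\<close>, a geometric sum.
  Completing it by the diagonal gives products of power sums and the correction with
  \<open>psum d \<alpha> \<beta> g x (k - 1)\<close>. The factor \<open>vdm2 d x\<close> covers
  coinciding points, where both sides are 0.\<close>

lemma vdm2_repulsion:
  "vdm2 d x * (\<Sum>i<d. (\<alpha> * x i + \<beta> * g) ^ k * (\<Sum>b\<in>{..<d} - {i}. 2 / (x i - x b))) =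
   vdm2 d x * (\<alpha> * ((\<Sum>a<k. psum d \<alpha> \<beta> g x a * psum d \<alpha> \<beta> g x (k - 1 - a)) - of_nat k * psum d \<alpha> \<beta> g x (k - 1)))"
proof (cases "vdm2 d x = 0")
  case False
  define L where "L i = \<alpha> * x i + \<beta> * g" for i
  have ne: "x i \<noteq> x b" if "i < d" "b < d" "i \<noteq> b" for i b
  proof
    assume "x i = x b"
    then have "(\<Prod>b\<in>{..<d} - {i}. x i - x b) = 0" using that by (intro prod_zero) auto
    then have "vdm2 d x = 0" unfolding vdm2_def using that by (intro prod_zero) auto
    with False show False by simp
  qed
  \<comment> \<open>The added term \<open>b = i\<close> is \<open>2 / 0 = 0\<close>.\<close>
  have "(\<Sum>i<d. L i ^ k * (\<Sum>b\<in>{..<d} - {i}. 2 / (x i - x b))) = (\<Sum>i<d. L i ^ k * (\<Sum>b<d. 2 / (x i - x b)))"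
    by (intro sum.cong refl arg_cong2[of _ _ _ _ "(*)"] sum.mono_neutral_left) auto
  also have "\<dots> = (\<Sum>i<d. \<Sum>b<d. L i ^ k / (x i - x b)) + (\<Sum>i<d. \<Sum>b<d. L i ^ k / (x i - x b))"
  proof -
    have "L i ^ k * (2 / z) = L i ^ k / z + L i ^ k / z" for i z by simp
    then show ?thesis by (simp only: sum_distrib_left sum.distrib)
  qed
  also have "\<dots> = (\<Sum>i<d. \<Sum>b<d. L i ^ k / (x i - x b)) + (\<Sum>b<d. \<Sum>i<d. L i ^ k / (x i - x b))"
    by (rule arg_cong2[of _ _ _ _ "(+)", OF refl sum.swap])
  also have "\<dots> = (\<Sum>i<d. \<Sum>b<d. L i ^ k / (x i - x b) + L b ^ k / (x b - x i))"
    by (simp add: sum.distrib)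
  \<comment> \<open>For \<open>i = b\<close> the quotients are 0, while the geometric sum has
    \<open>k\<close> equal terms; these are subtracted again.\<close>
  also have "\<dots> = (\<Sum>i<d. \<Sum>b<d. \<alpha> * (\<Sum>a<k. L i ^ a * L b ^ (k - 1 - a)) - (if i = b then \<alpha> * of_nat k * L i ^ (k - 1) else 0))"
  proof (intro sum.cong refl)
    fix i b assume ib: "i \<in> {..<d}" "b \<in> {..<d}"
    show "L i ^ k / (x i - x b) + L b ^ k / (x b - x i) = 
      \<alpha> * (\<Sum>a<k. L i ^ a * L b ^ (k - 1 - a)) - (if i = b then \<alpha> * of_nat k * L i ^ (k - 1) else 0)"
    proof (cases "i = b")
      case True
      have "(\<Sum>a<k. L b ^ a * L b ^ (k - 1 - a)) = (\<Sum>a<k. L b ^ (k - 1))"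
        by (rule sum.cong) (auto simp flip: power_add)
      then show ?thesis using True by simp
    next
      case False
      with ib have n: "x i - x b \<noteq> 0" using ne by auto
      have "x b - x i = - (x i - x b)" by simp
      then have "L b ^ k / (x b - x i) = - (L b ^ k / (x i - x b))" by (simp only: divide_minus_right)
      then have "L i ^ k / (x i - x b) + L b ^ k / (x b - x i) = (L i ^ k - L b ^ k) / (x i - x b)"
        by (simp only: diff_divide_distrib add_uminus_conv_diff)
      also have "L i ^ k - L b ^ k = (L i - L b) * (\<Sum>a<k. L b ^ (k - Suc a) * L i ^ a)"
        by (rule power_diff_sumr2)
      also have "L i - L b = \<alpha> * (x i - x b)" by (simp add: L_def algebra_simps)
      finally show ?thesis using False n by (simp add: mult.commute)
    qed
  qed
  also have "\<dots> = (\<Sum>i<d. \<Sum>b<d. \<alpha> * (\<Sum>a<k. L i ^ a * L b ^ (k - 1 - a))) - (\<Sum>i<d. \<alpha> * of_nat k * L i ^ (k - 1))"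
    by (simp add: sum_subtractf)
  also have "(\<Sum>i<d. \<Sum>b<d. \<alpha> * (\<Sum>a<k. L i ^ a * L b ^ (k - 1 - a))) =
      \<alpha> * (\<Sum>i<d. \<Sum>b<d. \<Sum>a<k. L i ^ a * L b ^ (k - 1 - a))"
    by (simp only: sum_distrib_left)
  also have "(\<Sum>i<d. \<Sum>b<d. \<Sum>a<k. L i ^ a * L b ^ (k - 1 - a)) = (\<Sum>i<d. \<Sum>a<k. \<Sum>b<d. L i ^ a * L b ^ (k - 1 - a))"
    by (intro sum.cong refl sum.swap)
  also have "(\<Sum>i<d. \<Sum>a<k. \<Sum>b<d. L i ^ a * L b ^ (k - 1 - a)) = (\<Sum>a<k. (\<Sum>i<d. L i ^ a) * (\<Sum>b<d. L b ^ (k - 1 - a)))"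
    unfolding sum_product by (rule sum.swap)
  also have "(\<Sum>i<d. \<alpha> * of_nat k * L i ^ (k - 1)) = \<alpha> * (of_nat k * (\<Sum>i<d. L i ^ (k - 1)))"
    by (simp only: sum_distrib_left mult.assoc)
  finally show ?thesis
    unfolding L_def psum_def right_diff_distrib[symmetric] by (rule arg_cong)
qed simp

lemma psum_upd:
  assumes "i < d"
  shows "psum d \<alpha> \<beta> g (y(i := t)) l = (\<alpha> * t + \<beta> * g) ^ l + (\<Sum>j\<in>{..<d} - {i}. (\<alpha> * y j + \<beta> * g) ^ l)"
  unfolding psum_def using assms by (subst sum.remove[of _ i]) auto

lemma degree_prod_list_family:
  assumes "\<And>l. degree (P l) \<le> l"
  shows "degree (\<Prod>l\<leftarrow>ks. P l) \<le> sum_list ks"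
  by (induction ks) (auto intro: order_trans[OF degree_mult_le] add_mono assms)

section \<open>Integration by parts in the eigenvalues and in the common shift\<close>

context quadrature
begin

text \<open>The derivative in \<open>x i\<close> hits the power, one of the power sums, or the
  weight. The last contributes the logarithmic derivative of \<open>vdm2\<close>, whose degree in
  one variable is at most \<open>2 * d\<close>.\<close>

lemma repulsion_by_parts:
  assumes i: "i < d" and deg: "k + sum_list ks + 2 * d < M"
  shows "grid_sum d (\<lambda>x. x i * ((\<alpha> * x i + \<beta> * g) ^ k * (\<Prod>l\<leftarrow>ks. psum d \<alpha> \<beta> g x l) * vdm2 d x)) =
    grid_sum d (\<lambda>x. (\<alpha> * of_nat k * (\<alpha> * x i + \<beta> * g) ^ (k - 1) * (\<Prod>l\<leftarrow>ks. psum d \<alpha> \<beta> g x l) +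
       \<alpha> * pickl (\<lambda>l r. of_nat l * (\<alpha> * x i + \<beta> * g) ^ (k + l - 1) * (\<Prod>l\<leftarrow>r. psum d \<alpha> \<beta> g x l)) ks +
       (\<alpha> * x i + \<beta> * g) ^ k * (\<Sum>b\<in>{..<d} - {i}. 2 / (x i - x b)) * (\<Prod>l\<leftarrow>ks. psum d \<alpha> \<beta> g x l)) * vdm2 d x)"
proof (rule grid_sum_by_parts[OF i])
  fix y
  define J where "J = {..<d} - {i}"
  obtain C where C: "\<And>t. vdm2 d (y(i := t)) = C * (\<Prod>b\<in>J. (t - y b)\<^sup>2)"
    using vdm2_upd[OF i] unfolding J_def by blast
  define L where "L = [:\<beta> * g, \<alpha>:]"
  define P where "P l = L ^ l + [:\<Sum>j\<in>J. (\<alpha> * y j + \<beta> * g) ^ l:]" for l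
  define R where "R = Polynomial.smult C (\<Prod>b\<in>J. [:- y b, 1:]\<^sup>2)"
  have L: "poly L t = \<alpha> * t + \<beta> * g" "pderiv L = [:\<alpha>:]" for t
    by (simp_all add: L_def pderiv_pCons mult.commute)
  have L_pow: "poly (pderiv (L ^ l)) t = \<alpha> * of_nat l * (\<alpha> * t + \<beta> * g) ^ (l - 1)" for l t
    by (simp add: pderiv_power L mult_ac)
  have P: "poly (P l) t = psum d \<alpha> \<beta> g (y(i := t)) l" for l t
    unfolding P_def psum_upd[OF i] J_def by (simp add: L poly_power)
  have P': "poly (pderiv (P l)) t = \<alpha> * of_nat l * (\<alpha> * t + \<beta> * g) ^ (l - 1)" for l t
    by (simp add: P_def pderiv_add L_pow pderiv_pCons)
  have R: "poly R t = vdm2 d (y(i := t))" for t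
    by (simp add: R_def C poly_prod)
  have R': "poly (pderiv R) t = vdm2 d (y(i := t)) * (\<Sum>b\<in>J. 2 / (t - y b))" for t
    by (simp add: R_def C pderiv_smult poly_pderiv_prod_squares J_def)
  define q where "q = L ^ k * (\<Prod>l\<leftarrow>ks. P l) * R"
  have prodP: "poly (\<Prod>l\<leftarrow>r. P l) t = (\<Prod>l\<leftarrow>r. psum d \<alpha> \<beta> g (y(i := t)) l)" for r t
    by (induction r) (simp_all add: P del: fun_upd_apply)
  show "\<exists>q. degree q < M \<and> (\<forall>t.
    ((\<alpha> * (y(i := t)) i + \<beta> * g) ^ k * (\<Prod>l\<leftarrow>ks. psum d \<alpha> \<beta> g (y(i := t)) l) * vdm2 d (y(i := t))) = poly q t \<and>
    (\<alpha> * of_nat k * (\<alpha> * (y(i := t)) i + \<beta> * g) ^ (k - 1) * (\<Prod>l\<leftarrow>ks. psum d \<alpha> \<beta> g (y(i := t)) l) +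
       \<alpha> * pickl (\<lambda>l r. of_nat l * (\<alpha> * (y(i := t)) i + \<beta> * g) ^ (k + l - 1) * (\<Prod>l\<leftarrow>r. psum d \<alpha> \<beta> g (y(i := t)) l)) ks +
       (\<alpha> * (y(i := t)) i + \<beta> * g) ^ k * (\<Sum>b\<in>{..<d} - {i}. 2 / ((y(i := t)) i - (y(i := t)) b)) *
         (\<Prod>l\<leftarrow>ks. psum d \<alpha> \<beta> g (y(i := t)) l)) * vdm2 d (y(i := t)) = poly (pderiv q) t)"
  proof (intro exI[of _ q] conjI allI)
    have "degree L \<le> 1" by (simp add: L_def)
    then have dL: "degree (L ^ l) \<le> l" for l
      using order_trans[OF degree_power_le[of L l] mult_le_mono1[of "degree L" 1 l]] by simp
    then have dP: "degree (P l) \<le> l" for l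
      unfolding P_def by (intro degree_add_le) auto
    have "degree R \<le> (\<Sum>b\<in>J. degree ([:- y b, 1:]\<^sup>2))"
      unfolding R_def using degree_prod_sum_le[of J "\<lambda>b. [:- y b, 1:]\<^sup>2"]
      by (intro order_trans[OF degree_smult_le]) (simp add: J_def comp_def)
    also have "\<dots> \<le> (\<Sum>b\<in>J. 2)"
      by (intro sum_mono order_trans[OF degree_power_le]) simp
    also have "\<dots> \<le> 2 * d"
      using card_mono[of "{..<d}" J] by (auto simp: J_def)
    finally have dR: "degree R \<le> 2 * d" .
    have "degree q \<le> degree (L ^ k) + degree (\<Prod>l\<leftarrow>ks. P l) + degree R"
      unfolding q_def by (intro order_trans[OF degree_mult_le] add_mono degree_mult_le order_refl)
    also have "\<dots> \<le> k + sum_list ks + 2 * d"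
      by (intro add_mono dL dR degree_prod_list_family dP)
    finally show "degree q < M" using deg by simp
    fix t
    let ?y = "y(i := t)" and ?l = "\<alpha> * t + \<beta> * g"
    show "(\<alpha> * ?y i + \<beta> * g) ^ k * (\<Prod>l\<leftarrow>ks. psum d \<alpha> \<beta> g ?y l) * vdm2 d ?y = poly q t"
      by (simp add: q_def prodP R L)
    \<comment> \<open>Splitting the exponent needs \<open>l > 0\<close>; for \<open>l = 0\<close>
      both sides have the factor \<open>of_nat l = 0\<close>.\<close>
    have e1: "pickl (\<lambda>l r. of_nat l * ?l ^ (k + l - 1) * (\<Prod>l\<leftarrow>r. psum d \<alpha> \<beta> g ?y l)) ks =
      ?l ^ k * pickl (\<lambda>l r. of_nat l * ?l ^ (l - 1) * (\<Prod>l\<leftarrow>r. psum d \<alpha> \<beta> g ?y l)) ks"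
      unfolding pickl_mult[symmetric]
    proof (rule pickl_cong)
      fix l r
      show "of_nat l * ?l ^ (k + l - 1) * (\<Prod>l\<leftarrow>r. psum d \<alpha> \<beta> g ?y l) = ?l ^ k * (of_nat l * ?l ^ (l - 1) * (\<Prod>l\<leftarrow>r. psum d \<alpha> \<beta> g ?y l))"
        by (cases l) (simp_all add: power_add)
    qed
    have e2: "poly (pderiv (\<Prod>l\<leftarrow>ks. P l)) t = \<alpha> * pickl (\<lambda>l r. of_nat l * ?l ^ (l - 1) * (\<Prod>l\<leftarrow>r. psum d \<alpha> \<beta> g ?y l)) ks"
      unfolding poly_pderiv_prod_list P' P pickl_mult[symmetric] by (simp only: mult.assoc)
    have pk: "\<alpha> * pickl (\<lambda>l r. of_nat l * ?l ^ (k + l - 1) * (\<Prod>l\<leftarrow>r. psum d \<alpha> \<beta> g ?y l)) ks =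
      ?l ^ k * poly (pderiv (\<Prod>l\<leftarrow>ks. P l)) t"
      unfolding e1 e2 by (rule mult.left_commute)
    have sum: "(\<Sum>b\<in>{..<d} - {i}. 2 / (t - ?y b)) = (\<Sum>b\<in>J. 2 / (t - y b))"
      unfolding J_def by (rule sum.cong) auto
    have "poly (pderiv q) t = (\<alpha> * of_nat k * ?l ^ (k - 1) * (\<Prod>l\<leftarrow>ks. psum d \<alpha> \<beta> g ?y l) +
       ?l ^ k * poly (pderiv (\<Prod>l\<leftarrow>ks. P l)) t + ?l ^ k * (\<Sum>b\<in>J. 2 / (t - y b)) * (\<Prod>l\<leftarrow>ks. psum d \<alpha> \<beta> g ?y l)) * vdm2 d ?y"
      unfolding q_def pderiv_mult poly_add poly_mult R R' L_pow prodP poly_power L(1)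
      by (simp only: distrib_left distrib_right mult_ac add_ac)
    then show "(\<alpha> * of_nat k * (\<alpha> * ?y i + \<beta> * g) ^ (k - 1) * (\<Prod>l\<leftarrow>ks. psum d \<alpha> \<beta> g ?y l) +
       \<alpha> * pickl (\<lambda>l r. of_nat l * (\<alpha> * ?y i + \<beta> * g) ^ (k + l - 1) * (\<Prod>l\<leftarrow>r. psum d \<alpha> \<beta> g ?y l)) ks +
       (\<alpha> * ?y i + \<beta> * g) ^ k * (\<Sum>b\<in>{..<d} - {i}. 2 / (?y i - ?y b)) *
         (\<Prod>l\<leftarrow>ks. psum d \<alpha> \<beta> g ?y l)) * vdm2 d ?y = poly (pderiv q) t"
      unfolding fun_upd_same sum pk by (rule sym)
  qed
qed

text \<open>The unnormalised mean of a product of power sums of the shifted eigenvalues; the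
  normalisation is the value at \<open>[]\<close>.\<close>

definition eigen_sum :: "nat \<Rightarrow> complex \<Rightarrow> complex \<Rightarrow> nat list \<Rightarrow> complex" where
  "eigen_sum d \<alpha> \<beta> ks = (\<Sum>g\<in>N. w g * grid_sum d (\<lambda>x. (\<Prod>l\<leftarrow>ks. psum d \<alpha> \<beta> g x l) * vdm2 d x))"

lemma eigen_sum_0: "eigen_sum d \<alpha> \<beta> (0 # ks) = of_nat d * eigen_sum d \<alpha> \<beta> ks"
  by (simp add: eigen_sum_def psum_def mult.assoc grid_sum_mult sum_distrib_left mult.left_commute)

text \<open>Differentiating the \<open>k\<close>-th power yields a term with
  \<open>psum d \<alpha> \<beta> g x (k - 1)\<close>, which cancels exactly the diagonal correction
  in \<open>vdm2_repulsion\<close>. What remains are the cutting and fusing terms of the loop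
  equation.\<close>

lemma eigen_sum_by_parts_x:
  assumes deg: "k + sum_list ks + 2 * d < M"
  shows "(\<Sum>i<d. grid_sum d (\<lambda>x. \<alpha> * (x i * ((\<alpha> * x i + \<beta> * g) ^ k * (\<Prod>l\<leftarrow>ks. psum d \<alpha> \<beta> g x l) * vdm2 d x)))) =
    \<alpha>\<^sup>2 * grid_sum d (\<lambda>x. ((\<Sum>i<k. psum d \<alpha> \<beta> g x i * psum d \<alpha> \<beta> g x (k - 1 - i)) * (\<Prod>l\<leftarrow>ks. psum d \<alpha> \<beta> g x l) +
      pickl (\<lambda>l r. of_nat l * psum d \<alpha> \<beta> g x (k + l - 1) * (\<Prod>l\<leftarrow>r. psum d \<alpha> \<beta> g x l)) ks) * vdm2 d x)"
proof -
  have pointwise: "(\<Sum>i<d. \<alpha> * ((\<alpha> * of_nat k * (\<alpha> * x i + \<beta> * g) ^ (k - 1) * (\<Prod>l\<leftarrow>ks. psum d \<alpha> \<beta> g x l) +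
       \<alpha> * pickl (\<lambda>l r. of_nat l * (\<alpha> * x i + \<beta> * g) ^ (k + l - 1) * (\<Prod>l\<leftarrow>r. psum d \<alpha> \<beta> g x l)) ks +
       (\<alpha> * x i + \<beta> * g) ^ k * (\<Sum>b\<in>{..<d} - {i}. 2 / (x i - x b)) * (\<Prod>l\<leftarrow>ks. psum d \<alpha> \<beta> g x l)) * vdm2 d x)) =
     \<alpha>\<^sup>2 * (((\<Sum>i<k. psum d \<alpha> \<beta> g x i * psum d \<alpha> \<beta> g x (k - 1 - i)) * (\<Prod>l\<leftarrow>ks. psum d \<alpha> \<beta> g x l) +
      pickl (\<lambda>l r. of_nat l * psum d \<alpha> \<beta> g x (k + l - 1) * (\<Prod>l\<leftarrow>r. psum d \<alpha> \<beta> g x l)) ks) * vdm2 d x)" for x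
  proof -
    let ?L = "\<lambda>i. \<alpha> * x i + \<beta> * g" and ?Q = "\<Prod>l\<leftarrow>ks. psum d \<alpha> \<beta> g x l"
    let ?pk = "\<lambda>y. pickl (\<lambda>l r. of_nat l * y (k + l - 1) * (\<Prod>l\<leftarrow>r. psum d \<alpha> \<beta> g x l)) ks"
    have "(\<Sum>i<d. \<alpha> * ((\<alpha> * of_nat k * ?L i ^ (k - 1) * ?Q + \<alpha> * ?pk (\<lambda>m. ?L i ^ m) +
        ?L i ^ k * (\<Sum>b\<in>{..<d} - {i}. 2 / (x i - x b)) * ?Q) * vdm2 d x)) =
      \<alpha>\<^sup>2 * of_nat k * (\<Sum>i<d. ?L i ^ (k - 1)) * ?Q * vdm2 d x + \<alpha>\<^sup>2 * (\<Sum>i<d. ?pk (\<lambda>m. ?L i ^ m)) * vdm2 d x +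
      \<alpha> * (vdm2 d x * (\<Sum>i<d. ?L i ^ k * (\<Sum>b\<in>{..<d} - {i}. 2 / (x i - x b)))) * ?Q"
      by (simp add: sum_distrib_left sum_distrib_right sum.distrib[symmetric] power2_eq_square algebra_simps)
    also have "(\<Sum>i<d. ?pk (\<lambda>m. ?L i ^ m)) = ?pk (psum d \<alpha> \<beta> g x)"
      by (simp add: pickl_sum[symmetric] psum_def sum_distrib_left sum_distrib_right)
    also have "(\<Sum>i<d. ?L i ^ (k - 1)) = psum d \<alpha> \<beta> g x (k - 1)"
      by (simp add: psum_def)
    finally show ?thesis
      unfolding vdm2_repulsion by (simp add: power2_eq_square algebra_simps)
  qed
  have "(\<Sum>i<d. grid_sum d (\<lambda>x. \<alpha> * (x i * ((\<alpha> * x i + \<beta> * g) ^ k * (\<Prod>l\<leftarrow>ks. psum d \<alpha> \<beta> g x l) * vdm2 d x)))) =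
    (\<Sum>i<d. grid_sum d (\<lambda>x. \<alpha> * ((\<alpha> * of_nat k * (\<alpha> * x i + \<beta> * g) ^ (k - 1) * (\<Prod>l\<leftarrow>ks. psum d \<alpha> \<beta> g x l) +
       \<alpha> * pickl (\<lambda>l r. of_nat l * (\<alpha> * x i + \<beta> * g) ^ (k + l - 1) * (\<Prod>l\<leftarrow>r. psum d \<alpha> \<beta> g x l)) ks +
       (\<alpha> * x i + \<beta> * g) ^ k * (\<Sum>b\<in>{..<d} - {i}. 2 / (x i - x b)) * (\<Prod>l\<leftarrow>ks. psum d \<alpha> \<beta> g x l)) * vdm2 d x)))"
    unfolding grid_sum_mult by (intro sum.cong refl arg_cong2[of _ _ _ _ "(*)"] repulsion_by_parts deg) auto
  also have "\<dots> = grid_sum d (\<lambda>x. \<Sum>i<d. \<alpha> * ((\<alpha> * of_nat k * (\<alpha> * x i + \<beta> * g) ^ (k - 1) * (\<Prod>l\<leftarrow>ks. psum d \<alpha> \<beta> g x l) +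
       \<alpha> * pickl (\<lambda>l r. of_nat l * (\<alpha> * x i + \<beta> * g) ^ (k + l - 1) * (\<Prod>l\<leftarrow>r. psum d \<alpha> \<beta> g x l)) ks +
       (\<alpha> * x i + \<beta> * g) ^ k * (\<Sum>b\<in>{..<d} - {i}. 2 / (x i - x b)) * (\<Prod>l\<leftarrow>ks. psum d \<alpha> \<beta> g x l)) * vdm2 d x))"
    by (rule grid_sum_sum[symmetric])
  finally show ?thesis
    unfolding pointwise grid_sum_mult[of _ "\<alpha>\<^sup>2"] .
qed

text \<open>The variable \<open>g\<close> shifts all eigenvalues by the same amount, so
  differentiating a power sum merely lowers its exponent. The weight is a function of
  \<open>x\<close> alone and contributes nothing; this produces the \<open>B\<close> terms of the
  loop equation.\<close>

lemma eigen_sum_by_parts_g: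
  assumes deg: "k + sum_list ks < M"
  shows "(\<Sum>g\<in>N. w g * (g * (psum d \<alpha> \<beta> g x k * (\<Prod>l\<leftarrow>ks. psum d \<alpha> \<beta> g x l)))) =
    \<beta> * (\<Sum>g\<in>N. w g * (of_nat k * psum d \<alpha> \<beta> g x (k - 1) * (\<Prod>l\<leftarrow>ks. psum d \<alpha> \<beta> g x l) +
      pickl (\<lambda>l r. of_nat l * psum d \<alpha> \<beta> g x k * psum d \<alpha> \<beta> g x (l - 1) * (\<Prod>l\<leftarrow>r. psum d \<alpha> \<beta> g x l)) ks))"
proof -
  define P where "P l = (\<Sum>j<d. [:\<alpha> * x j, \<beta>:] ^ l)" for l
  have P: "poly (P l) g = psum d \<alpha> \<beta> g x l" for l g
    by (simp add: P_def psum_def poly_sum mult.commute)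
  have P': "poly (pderiv (P l)) g = \<beta> * (of_nat l * psum d \<alpha> \<beta> g x (l - 1))" for l g
    by (simp add: P_def psum_def pderiv_sum poly_sum pderiv_power pderiv_pCons sum_distrib_left mult_ac)
  have prodP: "poly (\<Prod>l\<leftarrow>r. P l) g = (\<Prod>l\<leftarrow>r. psum d \<alpha> \<beta> g x l)" for r g
    by (induction r) (simp_all add: P)
  have dP: "degree (P l) \<le> l" for l unfolding P_def
  proof (rule degree_sum_le)
    fix j
    have "degree ([:\<alpha> * x j, \<beta>:] ^ l) \<le> degree [:\<alpha> * x j, \<beta>:] * l" by (rule degree_power_le)
    also have "\<dots> \<le> 1 * l" by (rule mult_le_mono1) simp
    finally show "degree ([:\<alpha> * x j, \<beta>:] ^ l) \<le> l" by simp
  qed simp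
  have "degree (P k * (\<Prod>l\<leftarrow>ks. P l)) \<le> k + sum_list ks"
    by (intro order_trans[OF degree_mult_le] add_mono dP degree_prod_list_family)
  then have "(\<Sum>g\<in>N. w g * (g * poly (P k * (\<Prod>l\<leftarrow>ks. P l)) g)) =
      (\<Sum>g\<in>N. w g * poly (pderiv (P k * (\<Prod>l\<leftarrow>ks. P l))) g)"
    using deg by (intro quad_by_parts) simp
  moreover have "poly (pderiv (P k * (\<Prod>l\<leftarrow>ks. P l))) g =
      \<beta> * (of_nat k * psum d \<alpha> \<beta> g x (k - 1) * (\<Prod>l\<leftarrow>ks. psum d \<alpha> \<beta> g x l) +
      pickl (\<lambda>l r. of_nat l * psum d \<alpha> \<beta> g x k * psum d \<alpha> \<beta> g x (l - 1) * (\<Prod>l\<leftarrow>r. psum d \<alpha> \<beta> g x l)) ks)" for g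
  proof -
    have "psum d \<alpha> \<beta> g x k * pickl (\<lambda>l r. \<beta> * (of_nat l * psum d \<alpha> \<beta> g x (l - 1)) * (\<Prod>l\<leftarrow>r. psum d \<alpha> \<beta> g x l)) ks =
      \<beta> * pickl (\<lambda>l r. of_nat l * psum d \<alpha> \<beta> g x k * psum d \<alpha> \<beta> g x (l - 1) * (\<Prod>l\<leftarrow>r. psum d \<alpha> \<beta> g x l)) ks"
      unfolding pickl_mult[symmetric] by (rule pickl_cong) (simp only: mult_ac)
    then show ?thesis
      unfolding pderiv_mult poly_add poly_mult poly_pderiv_prod_list prodP P P' by (simp add: algebra_simps)
  qed
  ultimately show ?thesis
    by (simp add: P prodP sum_distrib_left mult_ac)
qed

end

context quadrature
begin

text \<open>One factor \<open>\<alpha> * x i + \<beta> * g\<close> is split off the leading power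
  sum; its two summands are integrated by parts in \<open>x i\<close> and in \<open>g\<close>. The
  outcome is the recursion of \<open>loop_equation\<close> with \<open>A = \<alpha>\<^sup>2\<close>
  and \<open>B = \<beta>\<^sup>2\<close>.\<close>

lemma eigen_loop_equation:
  fixes d k :: nat and ks :: "nat list" and \<alpha> \<beta> :: complex
  assumes deg: "k + sum_list ks + 2 * d < M"
  defines "E \<equiv> eigen_sum d \<alpha> \<beta>"
  shows "E (Suc k # ks) =
    \<alpha>\<^sup>2 * ((\<Sum>i<k. E (i # (k - 1 - i) # ks)) + pickl (\<lambda>l r. of_nat l * E ((k + l - 1) # r)) ks) +
    \<beta>\<^sup>2 * (of_nat k * E ((k - 1) # ks) + pickl (\<lambda>l r. of_nat l * E (k # (l - 1) # r)) ks)"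
proof -
  let ?p = "psum d \<alpha> \<beta>" and ?V = "vdm2 d"
  let ?Q = "\<lambda>g x ks. \<Prod>l\<leftarrow>ks. ?p g x l"
  have E: "E ls = (\<Sum>g\<in>N. w g * grid_sum d (\<lambda>x. ?Q g x ls * ?V x))" for ls
    by (simp add: E_def eigen_sum_def)
  define X where "X = (\<Sum>g\<in>N. w g * (\<Sum>i<d. grid_sum d (\<lambda>x. \<alpha> * (x i * ((\<alpha> * x i + \<beta> * g) ^ k * ?Q g x ks * ?V x)))))"
  define Y where "Y = (\<Sum>g\<in>N. w g * grid_sum d (\<lambda>x. \<beta> * ?V x * (g * (?p g x k * ?Q g x ks))))"
  have split: "?p g x (Suc k) = (\<Sum>i<d. \<alpha> * (x i * (\<alpha> * x i + \<beta> * g) ^ k)) + \<beta> * g * ?p g x k" for g x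
    by (simp add: psum_def sum_distrib_left sum.distrib[symmetric] algebra_simps)
  have "E (Suc k # ks) = X + Y"
  proof -
    have "?Q g x (Suc k # ks) * ?V x = (\<Sum>i<d. \<alpha> * (x i * ((\<alpha> * x i + \<beta> * g) ^ k * ?Q g x ks * ?V x))) +
        \<beta> * ?V x * (g * (?p g x k * ?Q g x ks))" for g x
      by (simp add: split sum_distrib_right sum_distrib_left algebra_simps)
    then show ?thesis
      by (simp only: E X_def Y_def grid_sum_add grid_sum_sum distrib_left sum.distrib)
  qed
  also have "X = \<alpha>\<^sup>2 * ((\<Sum>i<k. E (i # (k - 1 - i) # ks)) + pickl (\<lambda>l r. of_nat l * E ((k + l - 1) # r)) ks)"
  proof -
    have "((\<Sum>i<k. ?p g x i * ?p g x (k - 1 - i)) * ?Q g x ks +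
        pickl (\<lambda>l r. of_nat l * ?p g x (k + l - 1) * ?Q g x r) ks) * ?V x =
      (\<Sum>i<k. ?Q g x (i # (k - 1 - i) # ks) * ?V x) + pickl (\<lambda>l r. of_nat l * (?Q g x ((k + l - 1) # r) * ?V x)) ks" for g x
    proof -
      have "pickl (\<lambda>l r. of_nat l * (?Q g x ((k + l - 1) # r) * ?V x)) ks =
          ?V x * pickl (\<lambda>l r. of_nat l * ?p g x (k + l - 1) * ?Q g x r) ks"
        unfolding pickl_mult[symmetric] by (rule pickl_cong) (simp add: mult_ac)
      then show ?thesis by (simp add: distrib_left sum_distrib_right sum_distrib_left mult_ac)
    qed
    note expand = this
    have "X = \<alpha>\<^sup>2 * (\<Sum>g\<in>N. w g * ((\<Sum>i<k. grid_sum d (\<lambda>x. ?Q g x (i # (k - 1 - i) # ks) * ?V x)) +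
        pickl (\<lambda>l r. of_nat l * grid_sum d (\<lambda>x. ?Q g x ((k + l - 1) # r) * ?V x)) ks))"
      unfolding X_def eigen_sum_by_parts_x[OF deg] expand
      by (simp only: grid_sum_add grid_sum_sum grid_sum_pickl grid_sum_mult sum_distrib_left mult.left_commute)
    also have "(\<Sum>g\<in>N. w g * ((\<Sum>i<k. grid_sum d (\<lambda>x. ?Q g x (i # (k - 1 - i) # ks) * ?V x)) +
        pickl (\<lambda>l r. of_nat l * grid_sum d (\<lambda>x. ?Q g x ((k + l - 1) # r) * ?V x)) ks)) =
      (\<Sum>i<k. E (i # (k - 1 - i) # ks)) + pickl (\<lambda>l r. of_nat l * E ((k + l - 1) # r)) ks"
    proof -
      have "(\<Sum>g\<in>N. w g * (\<Sum>i<k. grid_sum d (\<lambda>x. ?Q g x (i # (k - 1 - i) # ks) * ?V x))) = (\<Sum>i<k. E (i # (k - 1 - i) # ks))"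
        unfolding E by (subst sum.swap) (simp only: sum_distrib_left)
      moreover have "pickl (\<lambda>l r. of_nat l * E ((k + l - 1) # r)) ks =
        (\<Sum>g\<in>N. w g * pickl (\<lambda>l r. of_nat l * grid_sum d (\<lambda>x. ?Q g x ((k + l - 1) # r) * ?V x)) ks)"
        unfolding E by (simp only: sum_distrib_left pickl_sum pickl_mult[symmetric] mult.left_commute)
      ultimately show ?thesis by (simp only: distrib_left sum.distrib)
    qed
    finally show ?thesis .
  qed
  also have "Y = \<beta>\<^sup>2 * (of_nat k * E ((k - 1) # ks) + pickl (\<lambda>l r. of_nat l * E (k # (l - 1) # r)) ks)"
  proof -
    have deg': "k + sum_list ks < M" using deg by simp
    have "Y = grid_sum d (\<lambda>x. \<beta> * ?V x * (\<Sum>g\<in>N. w g * (g * (?p g x k * ?Q g x ks))))"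
      by (simp only: Y_def grid_sum_mult[symmetric] grid_sum_sum[symmetric] sum_distrib_left mult.left_commute)
    also have "\<dots> = grid_sum d (\<lambda>x. \<beta>\<^sup>2 * (\<Sum>g\<in>N. w g * (of_nat k * (?Q g x ((k - 1) # ks) * ?V x) +
        pickl (\<lambda>l r. of_nat l * (?Q g x (k # (l - 1) # r) * ?V x)) ks)))"
    proof -
      have "pickl (\<lambda>l r. of_nat l * (?Q g x (k # (l - 1) # r) * ?V x)) ks =
          ?V x * pickl (\<lambda>l r. of_nat l * ?p g x k * ?p g x (l - 1) * ?Q g x r) ks" for g x
        unfolding pickl_mult[symmetric] by (rule pickl_cong) (simp add: mult_ac)
      then show ?thesis
        unfolding eigen_sum_by_parts_g[OF deg']
        by (simp add: sum_distrib_left sum_distrib_right power2_eq_square distrib_left mult_ac)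
    qed
    also have "\<dots> = \<beta>\<^sup>2 * (\<Sum>g\<in>N. w g * (of_nat k * grid_sum d (\<lambda>x. ?Q g x ((k - 1) # ks) * ?V x) +
        pickl (\<lambda>l r. of_nat l * grid_sum d (\<lambda>x. ?Q g x (k # (l - 1) # r) * ?V x)) ks))"
      by (simp only: grid_sum_add grid_sum_sum grid_sum_pickl grid_sum_mult)
    also have "(\<Sum>g\<in>N. w g * (of_nat k * grid_sum d (\<lambda>x. ?Q g x ((k - 1) # ks) * ?V x) +
        pickl (\<lambda>l r. of_nat l * grid_sum d (\<lambda>x. ?Q g x (k # (l - 1) # r) * ?V x)) ks)) =
      of_nat k * E ((k - 1) # ks) + pickl (\<lambda>l r. of_nat l * E (k # (l - 1) # r)) ks"
    proof -
      have "pickl (\<lambda>l r. of_nat l * E (k # (l - 1) # r)) ks =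
        (\<Sum>g\<in>N. w g * pickl (\<lambda>l r. of_nat l * grid_sum d (\<lambda>x. ?Q g x (k # (l - 1) # r) * ?V x)) ks)"
        unfolding E by (simp only: sum_distrib_left pickl_sum pickl_mult[symmetric] mult.left_commute)
      moreover have "of_nat k * E ((k - 1) # ks) =
        (\<Sum>g\<in>N. w g * (of_nat k * grid_sum d (\<lambda>x. ?Q g x ((k - 1) # ks) * ?V x)))"
        unfolding E by (simp only: sum_distrib_left mult.left_commute)
      ultimately show ?thesis by (simp only: distrib_left sum.distrib)
    qed
    finally show ?thesis .
  qed
  finally show ?thesis .
qed

text \<open>Both functionals obey the same recursion. Each of its terms lowers the sum of the
  exponents by two and lengthens the list by at most one; a leading 0 shortens the list. So the
  induction runs on the sum plus the length.\<close>

lemma eigen_sum_eq_loop_sum: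
  assumes "sum_list ks + 2 * d < M"
  shows "eigen_sum d \<alpha> \<beta> ks = eigen_sum d \<alpha> \<beta> [] * loop_sum d ks (wick (entry_cov (\<alpha>\<^sup>2) (\<beta>\<^sup>2)))"
  using assms
proof (induction "sum_list ks + length ks" arbitrary: ks rule: less_induct)
  case less
  let ?W = "wick (entry_cov (\<alpha>\<^sup>2) (\<beta>\<^sup>2))" and ?E = "eigen_sum d \<alpha> \<beta>"
  have IH: "?E ls = ?E [] * loop_sum d ls ?W"
    if "sum_list ls + length ls < sum_list ks + length ks" "sum_list ls \<le> sum_list ks" for ls
    by (rule less.hyps[OF that(1)]) (use that(2) less.prems in linarith)
  show ?case
  proof (cases ks)
    case Nil
    then show ?thesis by (simp add: wick_Nil)
  next
    case (Cons k0 ls)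
    show ?thesis
    proof (cases k0)
      case 0
      then show ?thesis
        using IH[of ls] Cons by (simp add: eigen_sum_0 sum_walks_0)
    next
      case (Suc k)
      note ks = Cons[unfolded Suc]
      have mset: "sum_list (l # r) = sum_list ls \<and> length (l # r) = length ls" if "mset (l # r) = mset ls" for l r
        using that by (metis sum_mset_sum_list size_mset)
      have deg: "k + sum_list ls + 2 * d < M" using less.prems ks by simp
      have a: "(\<Sum>i<k. ?E (i # (k - 1 - i) # ls)) = ?E [] * (\<Sum>i<k. loop_sum d (i # (k - 1 - i) # ls) ?W)"
        unfolding sum_distrib_left by (intro sum.cong refl IH) (auto simp: ks)
      have b: "pickl (\<lambda>l r. of_nat l * ?E ((k + l - 1) # r)) ls = ?E [] * pickl (\<lambda>l r. of_nat l * loop_sum d ((k + l - 1) # r) ?W) ls"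
        unfolding pickl_mult[symmetric]
      proof (rule pickl_cong)
        fix l r assume m: "mset (l # r) = mset ls"
        have "of_nat l * ?E ((k + l - 1) # r) = of_nat l * (?E [] * loop_sum d ((k + l - 1) # r) ?W)"
        proof (cases l)
          case (Suc l')
          then show ?thesis using IH[of "(k + l - 1) # r"] mset[OF m] by (simp add: ks del: loop_sum.simps)
        qed simp
        then show "of_nat l * ?E ((k + l - 1) # r) = ?E [] * (of_nat l * loop_sum d ((k + l - 1) # r) ?W)"
          by (simp only: mult_ac)
      qed
      have c: "of_nat k * ?E ((k - 1) # ls) = ?E [] * (of_nat k * loop_sum d ((k - 1) # ls) ?W)"
        using IH[of "(k - 1) # ls"] by (simp add: ks del: loop_sum.simps)
      have e: "pickl (\<lambda>l r. of_nat l * ?E (k # (l - 1) # r)) ls = ?E [] * pickl (\<lambda>l r. of_nat l * loop_sum d (k # (l - 1) # r) ?W) ls"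
        unfolding pickl_mult[symmetric]
      proof (rule pickl_cong)
        fix l r assume m: "mset (l # r) = mset ls"
        have "of_nat l * ?E (k # (l - 1) # r) = of_nat l * (?E [] * loop_sum d (k # (l - 1) # r) ?W)"
        proof (cases l)
          case (Suc l')
          then show ?thesis using IH[of "k # (l - 1) # r"] mset[OF m] by (simp add: ks del: loop_sum.simps)
        qed simp
        then show "of_nat l * ?E (k # (l - 1) # r) = ?E [] * (of_nat l * loop_sum d (k # (l - 1) # r) ?W)"
          by (simp only: mult_ac)
      qed
      show ?thesis
        unfolding ks eigen_loop_equation[OF deg] loop_equation a b c e by (simp only: distrib_left mult_ac)
    qed
  qed
qed

section \<open>The one-point function by orthogonality\<close>

lemma quad_power: "r \<le> M \<Longrightarrow> (\<Sum>g\<in>N. w g * g ^ r) = gauss_moment r"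
  using quad[of "monom 1 r"] by (simp add: poly_monom gauss_monom degree_monom_eq)

lemma grid_sum_prod: "grid_sum d (\<lambda>x. \<Prod>j<d. h j (x j)) = (\<Prod>j<d. \<Sum>t\<in>N. w t * h j t)"
  unfolding grid_sum_def prod.distrib[symmetric]
  by (subst prod_sum_PiE) (auto simp: finite_N)

text \<open>The sum factorises over the variables. Orthogonality forces \<open>p j = q j\<close> for
  all \<open>j \<noteq> i\<close>, and two permutations that agree off one point are equal.\<close>

lemma grid_sum_herm:
  assumes p: "p permutes {0..<d}" "q permutes {0..<d}" and i: "i < d" and deg: "degree f + 2 * d \<le> M"
  shows "grid_sum d (\<lambda>x. poly f (x i) * ((\<Prod>j<d. poly (herm (p j)) (x j)) * (\<Prod>j<d. poly (herm (q j)) (x j)))) =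
    (if p = q then (\<Prod>j<d. fact j) * (gauss (herm (p i) * herm (p i) * f) / fact (p i)) else 0)"
proof -
  define h where "h j = herm (p j) * herm (q j) * (if j = i then f else 1)" for j
  have lt: "p j < d" "q j < d" if "j < d" for j
    using permutes_in_image[OF p(1), of j] permutes_in_image[OF p(2), of j] that by auto
  have h: "(\<Sum>t\<in>N. w t * poly (h j) t) = gauss (h j)" if "j < d" for j
  proof (rule quad)
    have "degree (h j) \<le> degree (herm (p j)) + degree (herm (q j)) + degree f"
      unfolding h_def by (intro order_trans[OF degree_mult_le] add_mono degree_mult_le) auto
    also have "\<dots> \<le> d + d + degree f"
      using lt[OF that] by (intro add_mono) (auto simp: herm_monic)
    finally show "degree (h j) \<le> M" using deg by simp
  qed
  have "grid_sum d (\<lambda>x. poly f (x i) * ((\<Prod>j<d. poly (herm (p j)) (x j)) * (\<Prod>j<d. poly (herm (q j)) (x j)))) =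
      grid_sum d (\<lambda>x. \<Prod>j<d. poly (h j) (x j))"
  proof -
    have "(\<Prod>j<d. poly (if j = i then f else 1) (x j)) = poly f (x i)" for x
    proof -
      have "(\<Prod>j<d. poly (if j = i then f else 1) (x j)) = (\<Prod>j<d. if j = i then poly f (x i) else 1)"
        by (rule prod.cong) auto
      then show ?thesis using i by simp
    qed
    then show ?thesis by (simp add: h_def prod.distrib mult_ac)
  qed
  also have "\<dots> = (\<Prod>j<d. gauss (h j))"
    unfolding grid_sum_prod[of d "\<lambda>j. poly (h j)"] by (rule prod.cong) (auto simp: h)
  also have "\<dots> = (if p = q then (\<Prod>j<d. fact j) * (gauss (herm (p i) * herm (p i) * f) / fact (p i)) else 0)"
  proof (cases "p = q")
    case True
    have "(\<Prod>j<d. gauss (h j)) = gauss (h i) * (\<Prod>j\<in>{..<d} - {i}. gauss (h j))"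
      using i by (subst prod.remove[of _ i]) auto
    also have "(\<Prod>j\<in>{..<d} - {i}. gauss (h j)) = (\<Prod>j\<in>{..<d} - {i}. fact (p j))"
      by (rule prod.cong) (auto simp: h_def True[symmetric] gauss_herm_herm)
    also have "\<dots> = (\<Prod>j<d. fact (p j)) / fact (p i)"
      using i by (subst (2) prod.remove[of _ i]) auto
    also have "(\<Prod>j<d. fact (p j)) = (\<Prod>j<d. fact j :: complex)"
      using prod.permute[OF p(1), of "fact :: nat \<Rightarrow> complex"] by (simp add: comp_def lessThan_atLeast0)
    finally show ?thesis using True by (simp add: h_def)
  next
    case False
    have "\<exists>j<d. j \<noteq> i \<and> p j \<noteq> q j"
    proof (rule ccontr)
      assume "\<not> ?thesis"
      then have *: "p j = q j" if "j \<noteq> i" for j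
        using that p unfolding permutes_def by (cases "j < d") auto
      have "p i = q i"
      proof (rule ccontr)
        assume ne: "p i \<noteq> q i"
        obtain j where j: "q j = p i" using permutes_surj[OF p(2)] by (metis surjD)
        with ne have "j \<noteq> i" by auto
        then have "p j = p i" using * j by simp
        then show False using permutes_inj[OF p(1)] \<open>j \<noteq> i\<close> by (auto dest: injD)
      qed
      with * False show False by (metis ext)
    qed
    then obtain j where "j < d" "j \<noteq> i" "p j \<noteq> q j" by blast
    then have "(\<Prod>j<d. gauss (h j)) = 0"
      by (intro prod_zero) (auto simp: h_def gauss_herm_herm intro!: bexI[of _ j])
    then show ?thesis using False by simp
  qed
  finally show ?thesis .
qed

text \<open>Both Vandermonde factors are expanded as determinants of Hermite polynomials. Only equal
  permutations survive, where the signs square to 1, and each gives the same sum over the levels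
  \<open>m < d\<close>. The constant \<open>K\<close> is uniform in \<open>f\<close>, so it can be
  removed by comparison with a constant \<open>f\<close>.\<close>

lemma grid_sum_one_point:
  "\<exists>K \<noteq> 0. \<forall>f. degree f + 2 * d \<le> M \<longrightarrow>
     grid_sum d (\<lambda>x. (\<Sum>i<d. poly f (x i)) * vdm2 d x) = K * (\<Sum>m<d. gauss (herm m * herm m * f) / fact m)"
proof -
  let ?P = "{p. p permutes {0..<d}}"
  let ?a = "\<lambda>p x. \<Prod>j<d. poly (herm (p j)) (x j)"
  obtain c where c: "c \<noteq> 0" "\<And>x. vdm2 d x = c * (\<Prod>b<d. \<Prod>a<b. x b - x a)\<^sup>2"
    using prod_differences_eq_square[of d] unfolding vdm2_def by blast
  have det: "(\<Prod>b<d. \<Prod>a<b. x b - x a) = (\<Sum>p\<in>?P. signof p * ?a p x)" for x :: "nat \<Rightarrow> complex"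
  proof -
    have "(\<Prod>b<d. \<Prod>a<b. x b - x a) = det (mat d d (\<lambda>(i, j). poly (herm j) (x i)))"
      by (rule det_monic_vandermonde[symmetric]) (simp_all add: herm_monic)
    also have "\<dots> = (\<Sum>p\<in>?P. signof p * (\<Prod>i=0..<d. mat d d (\<lambda>(i, j). poly (herm j) (x i)) $$ (i, p i)))"
      by (rule det_def') simp
    also have "\<dots> = (\<Sum>p\<in>?P. signof p * ?a p x)"
    proof (intro sum.cong refl arg_cong2[of _ _ _ _ "(*)"])
      fix p assume "p \<in> ?P"
      then have "p j < d" if "j < d" for j using permutes_in_image[of p "{0..<d}" j] that by auto
      then show "(\<Prod>i=0..<d. mat d d (\<lambda>(i, j). poly (herm j) (x i)) $$ (i, p i)) = ?a p x"
        by (auto simp: lessThan_atLeast0 intro!: prod.cong)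
    qed
    finally show ?thesis .
  qed
  \<comment> \<open>\<open>c\<close> is the sign in \<open>vdm2\<close>, \<open>fact d\<close>
    counts the permutations, and the product of factorials collects the values
    \<open>gauss (herm j * herm j)\<close>.\<close>
  define K where "K = c * (fact d * (\<Prod>j<d. fact j))"
  have "grid_sum d (\<lambda>x. (\<Sum>i<d. poly f (x i)) * vdm2 d x) = K * (\<Sum>m<d. gauss (herm m * herm m * f) / fact m)"
    if deg: "degree f + 2 * d \<le> M" for f
  proof -
    have fin: "finite ?P" by (rule finite_permutations) simp
    have "(\<Sum>i<d. poly f (x i)) * vdm2 d x =
      c * (\<Sum>i<d. \<Sum>p\<in>?P. \<Sum>q\<in>?P. signof p * signof q * (poly f (x i) * (?a p x * ?a q x)))" for x
    proof -
      have "F * (c * ((\<Sum>p\<in>?P. signof p * ?a p x) * (\<Sum>q\<in>?P. signof q * ?a q x))) =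
        c * (\<Sum>p\<in>?P. \<Sum>q\<in>?P. signof p * signof q * (F * (?a p x * ?a q x)))" for F
        unfolding sum_product by (simp only: sum_distrib_left mult_ac)
      note expand = this
      have "(\<Sum>i<d. poly f (x i)) * vdm2 d x =
        (\<Sum>i<d. poly f (x i) * (c * ((\<Sum>p\<in>?P. signof p * ?a p x) * (\<Sum>q\<in>?P. signof q * ?a q x))))"
        unfolding c(2) det power2_eq_square by (rule sum_distrib_right)
      then show ?thesis
        unfolding expand by (simp only: sum_distrib_left[of c])
    qed
    then have "grid_sum d (\<lambda>x. (\<Sum>i<d. poly f (x i)) * vdm2 d x) =
      c * (\<Sum>i<d. \<Sum>p\<in>?P. \<Sum>q\<in>?P. signof p * signof q * grid_sum d (\<lambda>x. poly f (x i) * (?a p x * ?a q x)))"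
      by (simp only: grid_sum_mult grid_sum_sum)
    also have "(\<Sum>i<d. \<Sum>p\<in>?P. \<Sum>q\<in>?P. signof p * signof q * grid_sum d (\<lambda>x. poly f (x i) * (?a p x * ?a q x))) =
      (\<Sum>i<d. \<Sum>p\<in>?P. \<Sum>q\<in>?P. if p = q then (\<Prod>j<d. fact j) * (gauss (herm (p i) * herm (p i) * f) / fact (p i)) else 0)"
    proof (intro sum.cong refl)
      fix i p q assume "i \<in> {..<d}" "p \<in> ?P" "q \<in> ?P"
      then show "signof p * signof q * grid_sum d (\<lambda>x. poly f (x i) * (?a p x * ?a q x)) =
        (if p = q then (\<Prod>j<d. fact j) * (gauss (herm (p i) * herm (p i) * f) / fact (p i)) else 0)"
        using deg by (subst grid_sum_herm) (auto simp: sign_def)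
    qed
    also have "\<dots> = (\<Sum>i<d. \<Sum>p\<in>?P. (\<Prod>j<d. fact j) * (gauss (herm (p i) * herm (p i) * f) / fact (p i)))"
      using fin by (simp add: sum.delta')
    also have "\<dots> = (\<Sum>p\<in>?P. (\<Prod>j<d. fact j) * (\<Sum>i<d. gauss (herm (p i) * herm (p i) * f) / fact (p i)))"
      by (subst sum.swap) (simp add: sum_distrib_left)
    also have "\<dots> = (\<Sum>p\<in>?P. (\<Prod>j<d. fact j) * (\<Sum>m<d. gauss (herm m * herm m * f) / fact m))"
    proof (rule sum.cong[OF refl])
      fix p assume "p \<in> ?P"
      then have "(\<Sum>i<d. gauss (herm (p i) * herm (p i) * f) / fact (p i)) = (\<Sum>m<d. gauss (herm m * herm m * f) / fact m)"
        using sum.permute[of p "{0..<d}" "\<lambda>m. gauss (herm m * herm m * f) / fact m"]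
        by (simp add: comp_def lessThan_atLeast0)
      then show "(\<Prod>j<d. fact j) * (\<Sum>i<d. gauss (herm (p i) * herm (p i) * f) / fact (p i)) =
        (\<Prod>j<d. fact j) * (\<Sum>m<d. gauss (herm m * herm m * f) / fact m)" by (simp only:)
    qed
    also have "\<dots> = fact d * ((\<Prod>j<d. fact j) * (\<Sum>m<d. gauss (herm m * herm m * f) / fact m))"
      using card_permutations[of "{0..<d}" d] by simp
    finally show ?thesis by (simp add: K_def mult_ac)
  qed
  moreover have "K \<noteq> 0" using c(1) by (simp add: K_def)
  ultimately show ?thesis by blast
qed

text \<open>The binomial theorem separates the common shift from the eigenvalues, which are
  independent of it.\<close>

lemma eigen_sum_one_point:
  assumes "d > 0" and deg: "k + 2 * d \<le> M"
  shows "eigen_sum d \<alpha> \<beta> [] \<noteq> 0 \<and> eigen_sum d \<alpha> \<beta> [k] = eigen_sum d \<alpha> \<beta> [] *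
    (\<Sum>q\<le>k. of_nat (k choose q) * \<alpha> ^ q * \<beta> ^ (k - q) * gauss_moment (k - q) *
       (\<Sum>m<d. gauss (herm m * herm m * monom 1 q) / fact m))"
proof -
  obtain K where K: "K \<noteq> 0" "\<And>f. degree f + 2 * d \<le> M \<Longrightarrow>
     grid_sum d (\<lambda>x. (\<Sum>i<d. poly f (x i)) * vdm2 d x) = K * (\<Sum>m<d. gauss (herm m * herm m * f) / fact m)"
    using grid_sum_one_point by blast
  define T where "T q = (\<Sum>m<d. gauss (herm m * herm m * monom 1 q) / fact m)" for q
  have main: "eigen_sum d \<alpha> \<beta> [k] = K * (\<Sum>q\<le>k. of_nat (k choose q) * \<alpha> ^ q * \<beta> ^ (k - q) * gauss_moment (k - q) * T q)"
    if deg: "k + 2 * d \<le> M" for k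
  proof -
    have "psum d \<alpha> \<beta> g x k * vdm2 d x =
      (\<Sum>q\<le>k. of_nat (k choose q) * \<alpha> ^ q * (\<beta> * g) ^ (k - q) * ((\<Sum>i<d. poly (monom 1 q) (x i)) * vdm2 d x))" for g x
      unfolding psum_def binomial_ring
      by (subst sum.swap) (simp add: poly_monom power_mult_distrib sum_distrib_left sum_distrib_right mult_ac)
    then have "eigen_sum d \<alpha> \<beta> [k] = (\<Sum>g\<in>N. w g * (\<Sum>q\<le>k. of_nat (k choose q) * \<alpha> ^ q * (\<beta> * g) ^ (k - q) *
        grid_sum d (\<lambda>x. (\<Sum>i<d. poly (monom 1 q) (x i)) * vdm2 d x)))"
      by (simp add: eigen_sum_def grid_sum_sum grid_sum_mult)
    also have "\<dots> = (\<Sum>g\<in>N. w g * (\<Sum>q\<le>k. of_nat (k choose q) * \<alpha> ^ q * (\<beta> * g) ^ (k - q) * (K * T q)))"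
    proof (intro sum.cong refl arg_cong2[of _ _ _ _ "(*)"])
      fix q assume "q \<in> {..k}"
      then show "grid_sum d (\<lambda>x. (\<Sum>i<d. poly (monom 1 q) (x i)) * vdm2 d x) = K * T q"
        using deg by (subst K(2)) (auto simp: T_def degree_monom_eq)
    qed
    also have "\<dots> = (\<Sum>q\<le>k. of_nat (k choose q) * \<alpha> ^ q * \<beta> ^ (k - q) * (K * T q) * (\<Sum>g\<in>N. w g * g ^ (k - q)))"
      by (simp only: sum_distrib_left power_mult_distrib mult_ac) (rule sum.swap)
    also have "\<dots> = (\<Sum>q\<le>k. of_nat (k choose q) * \<alpha> ^ q * \<beta> ^ (k - q) * (K * T q) * gauss_moment (k - q))"
      by (intro sum.cong refl arg_cong2[of _ _ _ _ "(*)"] quad_power) (use deg in auto)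
    finally show ?thesis by (simp add: sum_distrib_left mult_ac)
  qed
  \<comment> \<open>The case \<open>k = 0\<close> identifies \<open>K\<close> with the
    normalisation, since each of the \<open>d\<close> levels has total mass 1.\<close>
  have "of_nat d * eigen_sum d \<alpha> \<beta> [] = K * T 0"
    using main[of 0] deg by (simp add: eigen_sum_0)
  also have "T 0 = of_nat d"
    by (simp add: T_def gauss_herm_herm flip: one_poly_def)
  finally have "eigen_sum d \<alpha> \<beta> [] = K" using \<open>d > 0\<close> by simp
  then show ?thesis using K(1) main[OF deg] by (simp add: T_def)
qed

end

text \<open>A quadrature rule exact up to degree \<open>k + 2 * d + 1\<close> covers all polynomials
  that occur; the nodes and weights drop out on dividing by
  \<open>eigen_sum d \<alpha> \<beta> []\<close>.\<close>

theorem loop_sum_one_point: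
  assumes "d > 0"
  shows "loop_sum d [k] (wick (entry_cov (\<alpha>\<^sup>2) (\<beta>\<^sup>2))) =
    (\<Sum>q\<le>k. of_nat (k choose q) * \<alpha> ^ q * \<beta> ^ (k - q) * gauss_moment (k - q) *
       (\<Sum>m<d. gauss (herm m * herm m * monom 1 q) / fact m))"
proof -
  define M where "M = k + 2 * d + 1"
  obtain N w where "finite N" "\<forall>q. degree q \<le> M \<longrightarrow> (\<Sum>x\<in>N. w x * poly q x) = gauss q"
    using ex_quadrature by blast
  then interpret quadrature M N w by unfold_locales auto
  have "eigen_sum d \<alpha> \<beta> [k] = eigen_sum d \<alpha> \<beta> [] * loop_sum d [k] (wick (entry_cov (\<alpha>\<^sup>2) (\<beta>\<^sup>2)))"
    by (rule eigen_sum_eq_loop_sum) (simp add: M_def)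
  moreover have "k + 2 * d \<le> M" by (simp add: M_def)
  ultimately show ?thesis using eigen_sum_one_point[OF assms, of k \<alpha> \<beta>] by simp
qed

section \<open>Lengths of permutations and invariant colourings\<close>

text \<open>For \<open>p\<close> permuting \<open>{1..N}\<close> these are the colourings constant
  on the cycles of \<open>p\<close>, so their number is \<open>d\<close> to the number of cycles.
  Counting them avoids cycle decompositions.\<close>

definition fixed_colourings :: "nat \<Rightarrow> nat \<Rightarrow> (nat \<Rightarrow> nat) \<Rightarrow> (nat \<Rightarrow> nat) set" where
  "fixed_colourings d N p = {c \<in> {1..N} \<rightarrow>\<^sub>E {..<d}. c \<circ> p = c}"

lemma finite_fixed_colourings: "finite (fixed_colourings d N p)"
  unfolding fixed_colourings_def by (intro finite_subset[OF _ finite_PiE[of "{1..N}" "\<lambda>_. {..<d}"]]) auto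

lemma colouring_insert:
  "({1..Suc N} \<rightarrow>\<^sub>E {..<d}) = (\<lambda>(v, c). c(Suc N := v)) ` ({..<d} \<times> ({1..N} \<rightarrow>\<^sub>E {..<d}))"
proof -
  have "{1..Suc N} = insert (Suc N) {1..N}" by auto
  then show ?thesis using PiE_insert_eq[of "Suc N" "{1..N}" "\<lambda>_. {..<d}"] by simp
qed

lemma colouring_insert_inj: "inj_on (\<lambda>(v, c). c(Suc N := v)) ({..<d} \<times> ({1..N} \<rightarrow>\<^sub>E {..<d :: nat}))"
  by (rule inj_combinator) simp

lemma card_fixed_colourings_Suc:
  assumes p: "p permutes {1..N}"
  shows "card (fixed_colourings d (Suc N) p) = d * card (fixed_colourings d N p)"
proof -
  have b: "p (Suc N) = Suc N" using p by (simp add: permutes_def)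
  have iff: "c(Suc N := v) \<circ> p = c(Suc N := v) \<longleftrightarrow> c \<circ> p = c" for c v
  proof -
    have ne: "p x \<noteq> Suc N" if "x \<noteq> Suc N" for x
      using that b permutes_inj[OF p] by (metis injD)
    show ?thesis
    proof
      assume *: "c(Suc N := v) \<circ> p = c(Suc N := v)"
      show "c \<circ> p = c"
      proof
        fix x show "(c \<circ> p) x = c x"
          using fun_cong[OF *, of x] ne[of x] b by (cases "x = Suc N") auto
      qed
    next
      assume *: "c \<circ> p = c"
      show "c(Suc N := v) \<circ> p = c(Suc N := v)"
      proof
        fix x show "(c(Suc N := v) \<circ> p) x = (c(Suc N := v)) x"
          using fun_cong[OF *, of x] ne[of x] b by (cases "x = Suc N") auto
      qed
    qed
  qed
  have "fixed_colourings d (Suc N) p = (\<lambda>(v, c). c(Suc N := v)) ` ({..<d} \<times> fixed_colourings d N p)"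
    unfolding fixed_colourings_def colouring_insert by (auto simp: iff)
  moreover have "inj_on (\<lambda>(v, c). c(Suc N := v)) ({..<d} \<times> fixed_colourings d N p)"
    by (rule inj_on_subset[OF colouring_insert_inj]) (auto simp: fixed_colourings_def)
  ultimately show ?thesis by (simp add: card_image card_cartesian_product)
qed

text \<open>The transposition inserts \<open>Suc N\<close> into the cycle of \<open>a\<close>, so
  the colour of the new point is forced to be that of \<open>a\<close>.\<close>

lemma card_fixed_colourings_transpose:
  assumes p: "p permutes {1..N}" and a: "a \<in> {1..N}"
  shows "card (fixed_colourings d (Suc N) (Transposition.transpose a (Suc N) \<circ> p)) = card (fixed_colourings d N p)"
proof -
  let ?b = "Suc N" and ?q = "Transposition.transpose a (Suc N) \<circ> p"
  have b: "p ?b = ?b" using p by (simp add: permutes_def)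
  have ne: "p x \<noteq> ?b" if "x \<noteq> ?b" for x
    using that b permutes_inj[OF p] by (metis injD)
  have a': "a \<noteq> ?b" using a by simp
  have iff: "c(?b := v) \<circ> ?q = c(?b := v) \<longleftrightarrow> v = c a \<and> c \<circ> p = c" for c v
  proof
    assume *: "c(?b := v) \<circ> ?q = c(?b := v)"
    have v: "v = c a" using fun_cong[OF *, of ?b] b a' by (simp add: Transposition.transpose_def)
    have "(c \<circ> p) x = c x" for x
      using fun_cong[OF *, of x] ne[of x] b v a'
      by (cases "x = ?b"; cases "p x = a") (auto simp: Transposition.transpose_def)
    with v show "v = c a \<and> c \<circ> p = c" by auto
  next
    assume *: "v = c a \<and> c \<circ> p = c"
    then have cp: "c (p x) = c x" for x by (metis comp_apply)
    have "(c(?b := v) \<circ> ?q) x = (c(?b := v)) x" for x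
      using cp[of x] ne[of x] b * a'
      by (cases "x = ?b"; cases "p x = a") (auto simp: Transposition.transpose_def)
    then show "c(?b := v) \<circ> ?q = c(?b := v)" by blast
  qed
  have "fixed_colourings d ?b ?q = (\<lambda>c. c(?b := c a)) ` fixed_colourings d N p"
  proof -
    have "c a < d" if "c \<in> {1..N} \<rightarrow>\<^sub>E {..<d}" for c using that a by (auto simp: PiE_iff)
    then show ?thesis
      unfolding fixed_colourings_def colouring_insert by (auto simp: iff image_iff intro!: bexI)
  qed
  moreover have "inj_on (\<lambda>c. c(?b := c a)) (fixed_colourings d N p)"
  proof (rule inj_onI)
    fix c c' assume *: "c \<in> fixed_colourings d N p" "c' \<in> fixed_colourings d N p" "c(?b := c a) = c'(?b := c' a)"
    have "c ?b = undefined" "c' ?b = undefined" using *(1,2) by (auto simp: fixed_colourings_def PiE_iff extensional_def)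
    then show "c = c'" using *(3) by (metis fun_upd_triv fun_upd_upd)
  qed
  ultimately show ?thesis by (simp add: card_image)
qed

lemma perm_of_Sinf_transpose:
  assumes "a \<ge> 1" "b \<ge> 1"
  shows "perm_of (Sinf (Transposition.transpose a b)) = Transposition.transpose a b"
proof (rule Sinf_inverse)
  have "Transposition.transpose a b permutes {1..}"
    by (rule permutes_swap_id) (use assms in auto)
  moreover have "\<forall>k > max a b. Transposition.transpose a b k = k" by (auto simp: Transposition.transpose_def)
  ultimately show "Transposition.transpose a b \<in> {\<tau>. \<tau> permutes {1..} \<and> (\<exists>k0. \<forall>k>k0. \<tau> k = k)}" by blast
qed

text \<open>If \<open>p\<close> fixes \<open>Suc N\<close>, this point has a free colour and both
  sides gain a factor \<open>d\<close>. Otherwise one transposition reduces \<open>p\<close> to a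
  permutation of \<open>{1..N}\<close> with equally many invariant colourings.\<close>

lemma ex_factorization_card_fixed_colourings:
  assumes "p permutes {1..N}"
  shows "\<exists>\<rho>s. (\<forall>\<rho>\<in>set \<rho>s. is_transposition \<rho>) \<and> p = perm_of (sum_list \<rho>s) \<and>
    card (fixed_colourings d N p) * d ^ length \<rho>s = d ^ N"
  using assms
proof (induction N arbitrary: p)
  case 0
  then have "p = id" by simp
  moreover have "fixed_colourings d 0 id = {\<lambda>_. undefined}" by (auto simp: fixed_colourings_def)
  ultimately show ?case by (intro exI[of _ "[]"]) (simp add: zero_sinf.rep_eq id_def)
next
  case (Suc N)
  have ins: "{1..Suc N} = insert (Suc N) {1..N}" by auto
  show ?case
  proof (cases "p (Suc N) = Suc N")
    case True
    have p: "p permutes {1..N}"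
      by (rule permutes_superset[OF Suc.prems]) (use True in \<open>auto simp: le_Suc_eq\<close>)
    then show ?thesis using Suc.IH[OF p] card_fixed_colourings_Suc[OF p, of d] by (auto simp: mult.assoc)
  next
    case False
    define a where "a = p (Suc N)"
    define p' where "p' = Transposition.transpose (Suc N) a \<circ> p"
    have a: "a \<in> {1..N}"
      using permutes_in_image[OF Suc.prems, of "Suc N"] False by (auto simp: a_def)
    have p': "p' permutes {1..N}"
      unfolding p'_def a_def by (rule permutes_insert_lemma) (use Suc.prems ins in simp)
    have p: "p = Transposition.transpose a (Suc N) \<circ> p'"
      unfolding p'_def by (simp add: o_assoc Transposition.transpose_commute[of "Suc N" a] transpose_comp_involutory)
    obtain \<rho>s where \<rho>s: "\<forall>\<rho>\<in>set \<rho>s. is_transposition \<rho>" "p' = perm_of (sum_list \<rho>s)"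
      "card (fixed_colourings d N p') * d ^ length \<rho>s = d ^ N"
      using Suc.IH[OF p'] by blast
    define \<rho> where "\<rho> = Sinf (Transposition.transpose a (Suc N))"
    have r: "perm_of \<rho> = Transposition.transpose a (Suc N)"
      unfolding \<rho>_def by (rule perm_of_Sinf_transpose) (use a in auto)
    then have "is_transposition \<rho>"
      unfolding is_transposition_def using a by (intro exI[of _ a] conjI exI[of _ "Suc N"]) auto
    moreover have "card (fixed_colourings d (Suc N) p) * d ^ length (\<rho> # \<rho>s) = d ^ Suc N"
      unfolding p card_fixed_colourings_transpose[OF p' a] using \<rho>s(3) by (simp add: mult_ac)
    ultimately show ?thesis
      using \<rho>s(1,2) r p by (intro exI[of _ "\<rho> # \<rho>s"]) (auto simp: plus_sinf.rep_eq comp_def)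
  qed
qed

text \<open>The colourings invariant under \<open>p\<close> form a subgroup of \<open>(\<int>/d)\<^sup>N\<close>, and the
  constraint \<open>c a = c b\<close> is the kernel of a homomorphism to \<open>\<int>/d\<close>.\<close>

lemma card_fixed_colourings_le:
  assumes a: "a \<in> {1..N}" and b: "b \<in> {1..N}" and p: "p permutes {1..N}"
  shows "card (fixed_colourings d N p) \<le> d * card {c \<in> fixed_colourings d N p. c a = c b}"
proof -
  let ?S = "fixed_colourings d N p"
  let ?F = "{c \<in> ?S. c a = c b}"
  define G where "G v = {c \<in> ?S. (int (c a) - int (c b)) mod int d = int v}" for v
  have lt: "c x < d" if "c \<in> ?S" "x \<in> {1..N}" for c x
    using that by (auto simp: fixed_colourings_def PiE_iff)
  have "?S = (\<Union>v<d. G v)"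
  proof -
    have "\<exists>v<d. (int (c a) - int (c b)) mod int d = int v" if "c \<in> ?S" for c
    proof -
      have "d > 0" using lt[OF that a] by simp
      then show ?thesis
        by (intro exI[of _ "nat ((int (c a) - int (c b)) mod int d)"]) (simp add: nat_less_iff)
    qed
    then show ?thesis by (auto simp: G_def)
  qed
  then have "card ?S \<le> (\<Sum>v<d. card (G v))"
    by (metis card_UN_le finite_lessThan)
  also have "\<dots> \<le> (\<Sum>v<d. card ?F)"
  proof (rule sum_mono)
    fix v
    show "card (G v) \<le> card ?F"
    proof (cases "G v = {}")
      case False
      then obtain e where e: "e \<in> G v" by blast
      then have eS: "e \<in> ?S" by (simp add: G_def)
      have "d > 0" using lt[OF eS a] by simp
      \<comment> \<open>Subtracting \<open>e\<close> modulo \<open>d\<close> maps the coset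
        \<open>G v\<close> injectively into the kernel \<open>?F\<close>.\<close>
      define s where "s c = (\<lambda>x\<in>{1..N}. nat ((int (c x) - int (e x)) mod int d))" for c
      have perm_in: "p x \<in> {1..N} \<longleftrightarrow> x \<in> {1..N}" for x by (rule permutes_in_image[OF p])
      have inv: "c (p x) = c x" if "c \<in> ?S" for c x
        using that by (metis (mono_tags, lifting) comp_apply fixed_colourings_def mem_Collect_eq)
      have "s c \<in> ?F" if c: "c \<in> G v" for c
      proof -
        have cS: "c \<in> ?S" using c by (simp add: G_def)
        have "s c \<in> {1..N} \<rightarrow>\<^sub>E {..<d}" using \<open>d > 0\<close> by (auto simp: s_def nat_less_iff)
        moreover have "s c \<circ> p = s c"
        proof
          fix x show "(s c \<circ> p) x = s c x"
            using inv[OF cS, of x] inv[OF eS, of x] perm_in[of x] by (simp add: s_def restrict_def)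
        qed
        moreover have "s c a = s c b"
        proof -
          have "(int (c a) - int (c b)) mod int d = (int (e a) - int (e b)) mod int d"
            using c e by (simp add: G_def)
          then have "int d dvd (int (c a) - int (c b)) - (int (e a) - int (e b))"
            by (simp add: mod_eq_dvd_iff)
          then have "int d dvd (int (c a) - int (e a)) - (int (c b) - int (e b))"
            by (simp add: algebra_simps)
          then have "(int (c a) - int (e a)) mod int d = (int (c b) - int (e b)) mod int d"
            by (simp only: mod_eq_dvd_iff)
          then show ?thesis using a b by (simp add: s_def)
        qed
        ultimately show ?thesis by (simp add: fixed_colourings_def)
      qed
      moreover have "inj_on s (G v)"
      proof (rule inj_onI)
        fix c c' assume c: "c \<in> G v" "c' \<in> G v" and eq: "s c = s c'"
        have S: "c \<in> ?S" "c' \<in> ?S" using c by (auto simp: G_def)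
        show "c = c'"
        proof (rule PiE_ext[of _ "{1..N}" "\<lambda>_. {..<d}"])
          fix x assume x: "x \<in> {1..N}"
          have "(int (c x) - int (e x)) mod int d = (int (c' x) - int (e x)) mod int d"
            using fun_cong[OF eq, of x] x \<open>d > 0\<close> by (simp add: s_def eq_nat_nat_iff)
          then have "int d dvd int (c x) - int (c' x)" by (simp add: mod_eq_dvd_iff)
          then have "int (c x) mod int d = int (c' x) mod int d" by (simp add: mod_eq_dvd_iff)
          then show "c x = c' x" using lt[OF S(1) x] lt[OF S(2) x] by simp
        qed (use S in \<open>auto simp: fixed_colourings_def\<close>)
      qed
      ultimately show ?thesis
        by (intro card_inj_on_le[of s]) (auto intro: finite_subset[OF _ finite_fixed_colourings[of d N p]])
    qed simp
  qed
  finally show ?thesis by simp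
qed

text \<open>Composing with a transposition merges at most two cycles, so it divides the number of
  invariant colourings by at most \<open>d\<close>. This bounds the length of any factorization from
  below.\<close>

lemma card_fixed_colourings_ge:
  assumes "\<forall>\<rho>\<in>set \<rho>s. is_transposition \<rho> \<and> perm_of \<rho> permutes {1..N}"
  shows "perm_of (sum_list \<rho>s) permutes {1..N} \<and> d ^ N \<le> card (fixed_colourings d N (perm_of (sum_list \<rho>s))) * d ^ length \<rho>s"
  using assms
proof (induction \<rho>s)
  case Nil
  have "fixed_colourings d N id = {1..N} \<rightarrow>\<^sub>E {..<d}" by (auto simp: fixed_colourings_def)
  then show ?case using permutes_id[of "{1..N}"] by (simp add: zero_sinf.rep_eq card_PiE id_def)
next
  case (Cons \<rho> \<rho>s)
  let ?p = "perm_of (sum_list \<rho>s)"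
  have p: "?p permutes {1..N}" and IH: "d ^ N \<le> card (fixed_colourings d N ?p) * d ^ length \<rho>s"
    using Cons by auto
  obtain a b where ab: "a \<noteq> b" "perm_of \<rho> = Transposition.transpose a b"
    using Cons.prems by (auto simp: is_transposition_def)
  have r: "Transposition.transpose a b permutes {1..N}" using Cons.prems ab by simp
  have mem: "a \<in> {1..N}" "b \<in> {1..N}"
    using r ab(1) unfolding permutes_def by (metis transpose_apply_first, metis transpose_apply_second)
  have sub: "{c \<in> fixed_colourings d N ?p. c a = c b} \<subseteq> fixed_colourings d N (Transposition.transpose a b \<circ> ?p)"
  proof
    fix c assume c: "c \<in> {c \<in> fixed_colourings d N ?p. c a = c b}"
    have "c \<circ> Transposition.transpose a b = c"
      using c by (auto simp: fun_eq_iff Transposition.transpose_def)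
    moreover have "c \<circ> ?p = c" using c by (simp add: fixed_colourings_def)
    ultimately have "c \<circ> (Transposition.transpose a b \<circ> ?p) = c" by (simp only: o_assoc)
    then show "c \<in> fixed_colourings d N (Transposition.transpose a b \<circ> ?p)"
      using c by (simp add: fixed_colourings_def)
  qed
  have "card (fixed_colourings d N ?p) \<le> d * card {c \<in> fixed_colourings d N ?p. c a = c b}"
    by (rule card_fixed_colourings_le[OF mem p])
  also have "\<dots> \<le> d * card (fixed_colourings d N (Transposition.transpose a b \<circ> ?p))"
    by (intro mult_le_mono2 card_mono finite_fixed_colourings sub)
  finally have "d ^ N \<le> d * card (fixed_colourings d N (Transposition.transpose a b \<circ> ?p)) * d ^ length \<rho>s"
    using IH by (meson le_trans mult_le_mono1)
  then show ?case
    using permutes_compose[OF p r] by (simp add: plus_sinf.rep_eq ab mult_ac comp_def)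
qed

lemma permutes_mono_atLeastAtMost: "p permutes {1..N} \<Longrightarrow> N \<le> N' \<Longrightarrow> p permutes {1..N' :: nat}"
  by (erule permutes_subset) auto

lemma card_fixed_colourings_extend:
  "p permutes {1..N} \<Longrightarrow> card (fixed_colourings d (N + k) p) = d ^ k * card (fixed_colourings d N p)"
proof (induction k)
  case (Suc k)
  then show ?case
    using card_fixed_colourings_Suc[of p "N + k" d] permutes_mono_atLeastAtMost[of p N "N + k"] by simp
qed simp

text \<open>A factorization of a permutation of \<open>{1..N}\<close> may move points beyond
  \<open>N\<close>, so colourings are counted on a larger set. The form \<open>N + k\<close> matches
  \<open>card_fixed_colourings_extend\<close>.\<close>

lemma ex_common_support:
  "\<forall>\<rho>\<in>set \<rho>s. is_transposition \<rho> \<Longrightarrow> \<exists>k. \<forall>\<rho>\<in>set \<rho>s. perm_of \<rho> permutes {1..N + k}"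
proof (induction \<rho>s)
  case (Cons \<rho> \<rho>s)
  then obtain k where k: "\<forall>\<rho>\<in>set \<rho>s. perm_of \<rho> permutes {1..N + k}" by auto
  obtain a b where ab: "a \<ge> 1" "b \<ge> 1" "perm_of \<rho> = Transposition.transpose a b"
    using Cons.prems by (auto simp: is_transposition_def)
  have "perm_of \<rho> permutes {1..N + (k + a + b)}"
    unfolding ab(3) by (rule permutes_swap_id) (use ab in auto)
  moreover have "perm_of \<rho>' permutes {1..N + (k + a + b)}" if "\<rho>' \<in> set \<rho>s" for \<rho>'
    by (rule permutes_mono_atLeastAtMost[of _ "N + k"]) (use k that in blast, simp)
  ultimately show ?case by (metis set_ConsD)
qed simp

text \<open>The factorization constructed above attains the lower bound valid for all
  factorizations, so its length is minimal.\<close>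

lemma card_fixed_colourings_perm_length:
  assumes p: "perm_of \<tau> permutes {1..N}" and d: "d \<ge> 1"
  shows "card (fixed_colourings d N (perm_of \<tau>)) * d ^ perm_length \<tau> = d ^ N"
proof -
  obtain \<rho>s where \<rho>s: "\<forall>\<rho>\<in>set \<rho>s. is_transposition \<rho>" "perm_of \<tau> = perm_of (sum_list \<rho>s)"
      "card (fixed_colourings d N (perm_of \<tau>)) * d ^ length \<rho>s = d ^ N"
    using ex_factorization_card_fixed_colourings[OF p, of d] by blast
  show ?thesis
  \<comment> \<open>With a single colour the count says nothing about lengths, but then all powers
    of \<open>d\<close> are 1.\<close>
  proof (cases "d = 1")
    case True
    then show ?thesis using \<rho>s(3) by simp
  next
    case False
    with d have d2: "d > 1" by simp
    let ?P = "\<lambda>m. \<exists>\<rho>s. length \<rho>s = m \<and> (\<forall>\<rho>\<in>set \<rho>s. is_transposition \<rho>) \<and> \<tau> = sum_list \<rho>s"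
    have P: "?P (length \<rho>s)" using \<rho>s(1,2) by (auto simp: perm_of_inject)
    have le: "perm_length \<tau> \<le> length \<rho>s" unfolding perm_length_def by (rule Least_le) (rule P)
    have "?P (perm_length \<tau>)" unfolding perm_length_def by (rule LeastI) (rule P)
    then obtain \<sigma>s where \<sigma>s: "length \<sigma>s = perm_length \<tau>" "\<forall>\<rho>\<in>set \<sigma>s. is_transposition \<rho>" "\<tau> = sum_list \<sigma>s"
      by blast
    obtain k where "\<forall>\<rho>\<in>set \<sigma>s. perm_of \<rho> permutes {1..N + k}"
      using ex_common_support[OF \<sigma>s(2)] by blast
    with \<sigma>s have "d ^ (N + k) \<le> card (fixed_colourings d (N + k) (perm_of \<tau>)) * d ^ perm_length \<tau>"
      using card_fixed_colourings_ge[of \<sigma>s "N + k" d] by auto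
    also have "\<dots> = d ^ k * card (fixed_colourings d N (perm_of \<tau>)) * d ^ perm_length \<tau>"
      unfolding card_fixed_colourings_extend[OF p] ..
    finally have "d ^ k * (card (fixed_colourings d N (perm_of \<tau>)) * d ^ length \<rho>s) \<le>
        d ^ k * (card (fixed_colourings d N (perm_of \<tau>)) * d ^ perm_length \<tau>)"
      unfolding \<rho>s(3) by (simp add: power_add mult_ac)
    moreover have "card (fixed_colourings d N (perm_of \<tau>)) > 0"
      using \<rho>s(3) d2 by (metis mult_eq_0_iff gr0I power_not_zero not_one_less_zero)
    ultimately have "d ^ length \<rho>s \<le> d ^ perm_length \<tau>" using d2 by simp
    then have "length \<rho>s \<le> perm_length \<tau>" using d2 by simp
    then show ?thesis using le \<rho>s(3) by simp
  qed
qed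

section \<open>Moments of the star-generators\<close>

text \<open>The entry at \<open>c\<close>, \<open>c'\<close> of the matrix by which \<open>x\<close>
  acts on functions of colourings, where \<tau> sends \<open>F\<close> to the function with value
  \<open>F (c \<circ> perm_of \<tau>)\<close> at \<open>c\<close>.\<close>

definition kern :: "group_algebra \<Rightarrow> (nat \<Rightarrow> nat) \<Rightarrow> (nat \<Rightarrow> nat) \<Rightarrow> complex" where
  "kern x c c' = (\<Sum>\<tau>\<in>Poly_Mapping.keys x. Poly_Mapping.lookup x \<tau> * of_bool (c \<circ> perm_of \<tau> = c'))"

lemma kern_superset:
  "finite A \<Longrightarrow> Poly_Mapping.keys x \<subseteq> A \<Longrightarrow>
    kern x c c' = (\<Sum>\<tau>\<in>A. Poly_Mapping.lookup x \<tau> * of_bool (c \<circ> perm_of \<tau> = c'))"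
  unfolding kern_def by (rule sum.mono_neutral_left) (auto simp: in_keys_iff)

lemma kern_add: "kern (x + y) c c' = kern x c c' + kern y c c'"
proof -
  let ?A = "Poly_Mapping.keys x \<union> Poly_Mapping.keys y"
  have "Poly_Mapping.keys (x + y) \<subseteq> ?A" by (rule keys_add)
  then show ?thesis
    by (simp add: kern_superset[of ?A] lookup_add distrib_right sum.distrib)
qed

lemma kern_0: "kern 0 c c' = 0"
  by (simp add: kern_def)

lemma kern_diff: "kern (x - y) c c' = kern x c c' - kern y c c'"
  using kern_add[of "x - y" y] by (simp add: algebra_simps)

lemma kern_sum: "kern (\<Sum>i\<in>I. x i) c c' = (\<Sum>i\<in>I. kern (x i) c c')"
  by (induction I rule: infinite_finite_induct) (auto simp: kern_add kern_0)

lemma kern_single: "kern (Poly_Mapping.single \<tau> v) c c' = v * of_bool (c \<circ> perm_of \<tau> = c')"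
  by (simp add: kern_superset[of "{\<tau>}"])

lemma poly_mapping_sum_single:
  "x = (\<Sum>\<tau>\<in>Poly_Mapping.keys x. Poly_Mapping.single \<tau> (Poly_Mapping.lookup x \<tau>))"
  by (rule poly_mapping_eqI) (simp add: lookup_sum lookup_single when_def in_keys_iff)

lemma kern_single_mult: "kern (Poly_Mapping.single \<sigma> v * y) c c' = v * kern y (c \<circ> perm_of \<sigma>) c'"
proof -
  have "kern (Poly_Mapping.single \<sigma> v * (\<Sum>\<tau>\<in>I. Poly_Mapping.single \<tau> (f \<tau>))) c c' =
      v * kern (\<Sum>\<tau>\<in>I. Poly_Mapping.single \<tau> (f \<tau>)) (c \<circ> perm_of \<sigma>) c'" for I f
    by (simp add: sum_distrib_left mult_single kern_sum kern_single plus_sinf.rep_eq comp_assoc mult.assoc)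
  from this[of "\<lambda>\<tau>. Poly_Mapping.lookup y \<tau>" "Poly_Mapping.keys y"] show ?thesis
    unfolding poly_mapping_sum_single[symmetric] .
qed

lemma perm_of_0: "perm_of 0 = id"
  by (rule zero_sinf.rep_eq)

lemma kern_s_elem_mult:
  "kern (s_elem d n * y) c c' = of_real (1 / sqrt (real n)) *
    ((\<Sum>i=1..n. kern y (c \<circ> perm_of (star_generator i)) c') - of_nat n / of_nat d * kern y c c')"
  by (simp add: s_elem_def scalar_def group_elem_def mult.assoc kern_single_mult left_diff_distrib
      sum_distrib_right kern_diff kern_sum perm_of_0)

lemma kern_1: "kern 1 c c' = of_bool (c = c')"
  by (simp add: kern_single perm_of_0 flip: single_one)

lemma phi_eq_kern_trace:
  assumes "\<forall>\<tau>\<in>Poly_Mapping.keys x. perm_of \<tau> permutes {1..N}" and d: "d \<ge> 1"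
  shows "of_nat d ^ N * phi d x = (\<Sum>c\<in>{1..N} \<rightarrow>\<^sub>E {..<d}. kern x c c)"
proof -
  have "(\<Sum>c\<in>{1..N} \<rightarrow>\<^sub>E {..<d}. kern x c c) =
     (\<Sum>\<tau>\<in>Poly_Mapping.keys x. Poly_Mapping.lookup x \<tau> * (\<Sum>c\<in>{1..N} \<rightarrow>\<^sub>E {..<d}. of_bool (c \<circ> perm_of \<tau> = c)))"
    unfolding kern_def by (subst sum.swap) (simp only: sum_distrib_left)
  also have "\<dots> = (\<Sum>\<tau>\<in>Poly_Mapping.keys x. Poly_Mapping.lookup x \<tau> * (of_nat d ^ N * (1 / of_nat d) ^ perm_length \<tau>))"
  proof (intro sum.cong refl arg_cong2[of _ _ _ _ "(*)"])
    fix \<tau> assume "\<tau> \<in> Poly_Mapping.keys x"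
    then have "card (fixed_colourings d N (perm_of \<tau>)) * d ^ perm_length \<tau> = d ^ N"
      using assms by (intro card_fixed_colourings_perm_length) auto
    then have "of_nat (card (fixed_colourings d N (perm_of \<tau>)) * d ^ perm_length \<tau>) = (of_nat (d ^ N) :: complex)"
      by (rule arg_cong)
    moreover have "(\<Sum>c\<in>{1..N} \<rightarrow>\<^sub>E {..<d}. of_bool (c \<circ> perm_of \<tau> = c)) = (of_nat (card (fixed_colourings d N (perm_of \<tau>))) :: complex)"
      by (simp add: fixed_colourings_def finite_PiE Int_def)
    ultimately show "(\<Sum>c\<in>{1..N} \<rightarrow>\<^sub>E {..<d}. of_bool (c \<circ> perm_of \<tau> = c)) =
        (of_nat d ^ N * (1 / of_nat d) ^ perm_length \<tau> :: complex)"
      using d by (simp add: field_simps)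
  qed
  finally show ?thesis by (simp add: phi_def sum_distrib_left mult_ac)
qed

lemma keys_s_elem_power:
  "\<forall>\<tau>\<in>Poly_Mapping.keys (s_elem d n ^ k). perm_of \<tau> permutes {1..Suc n}"
proof -
  define P where "P x \<longleftrightarrow> (\<forall>\<tau>\<in>Poly_Mapping.keys x. perm_of \<tau> permutes {1..Suc n})" for x :: group_algebra
  have mult: "P (x * y)" if "P x" "P y" for x y
    unfolding P_def
  proof
    fix \<tau> assume "\<tau> \<in> Poly_Mapping.keys (x * y)"
    then obtain a b where "\<tau> = a + b" "a \<in> Poly_Mapping.keys x" "b \<in> Poly_Mapping.keys y"
      using keys_mult[of x y] by blast
    then have "perm_of a permutes {1..Suc n}" "perm_of b permutes {1..Suc n}"
      using that unfolding P_def by blast+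
    then show "perm_of \<tau> permutes {1..Suc n}"
      unfolding \<open>\<tau> = a + b\<close> plus_sinf.rep_eq by (intro permutes_compose)
  qed
  have diff: "P (x - y)" if "P x" "P y" for x y
    using that keys_diff[of x y] unfolding P_def by blast
  have add: "P (x + y)" if "P x" "P y" for x y
    using that keys_add[of x y] unfolding P_def by blast
  have scalar: "P (scalar z)" for z
    by (auto simp: P_def scalar_def perm_of_0 permutes_id)
  have gen: "P (group_elem (star_generator i))" if "i \<le> n" for i
  proof -
    have "Transposition.transpose 1 (i + 1) permutes {1..Suc n}"
      by (rule permutes_swap_id) (use that in auto)
    then show ?thesis by (simp add: P_def group_elem_def star_generator.rep_eq)
  qed
  have sum: "P (\<Sum>i\<in>I. group_elem (star_generator i))" if "finite I" "\<forall>i\<in>I. i \<le> n" for I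
    using that by (induction I rule: finite_induct) (auto intro: add gen, simp add: P_def)
  have s: "P (s_elem d n)"
    unfolding s_elem_def by (intro mult diff scalar sum) auto
  have "P (s_elem d n ^ k)"
  proof (induction k)
    case 0
    show ?case using scalar[of 1] by (simp add: scalar_def)
  next
    case (Suc k)
    then show ?case using mult[OF s] by simp
  qed
  then show ?thesis by (simp add: P_def)
qed

section \<open>Splitting off the colour of the point 1\<close>

text \<open>Lists make the addition of a point a \<open>Cons\<close>, so the tensor factors can be
  peeled off one at a time.\<close>

definition colour_lists :: "nat \<Rightarrow> nat \<Rightarrow> nat list set" where
  "colour_lists d n = {f. set f \<subseteq> {..<d} \<and> length f = n}"

lemma sum_colour_lists_Suc:
  "(\<Sum>f\<in>colour_lists d (Suc n). F f) = (\<Sum>v<d. \<Sum>f\<in>colour_lists d n. F (v # f))"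
proof -
  have "colour_lists d (Suc n) = (\<lambda>(v, f). v # f) ` ({..<d} \<times> colour_lists d n)"
    unfolding colour_lists_def by (auto simp: length_Suc_conv image_iff)
  then have "(\<Sum>f\<in>colour_lists d (Suc n). F f) = (\<Sum>(v, f)\<in>{..<d} \<times> colour_lists d n. F (v # f))"
    by (simp add: sum.reindex inj_on_def case_prod_unfold)
  then show ?thesis by (simp add: sum.cartesian_product)
qed

text \<open>The list \<open>f\<close> of length \<open>n\<close> represents the colouring of \<open>{1..n}\<close>
  that gives the point \<open>i + 1\<close> the colour \<open>f ! i\<close>.\<close>

definition colouring :: "nat list \<Rightarrow> nat \<Rightarrow> nat" where
  "colouring f = (\<lambda>p\<in>{1..length f}. f ! (p - 1))"

lemma colouring_inj: "length f = length f' \<Longrightarrow> colouring f = colouring f' \<longleftrightarrow> f = f'"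
proof
  assume l: "length f = length f'" and eq: "colouring f = colouring f'"
  show "f = f'"
  proof (rule nth_equalityI[OF l])
    fix i assume "i < length f"
    then show "f ! i = f' ! i" using fun_cong[OF eq, of "Suc i"] l by (simp add: colouring_def)
  qed
qed simp

lemma sum_colourings:
  "(\<Sum>c\<in>{1..n} \<rightarrow>\<^sub>E {..<d}. F c) = (\<Sum>f\<in>colour_lists d n. F (colouring f))"
proof -
  have inj: "inj_on colouring (colour_lists d n)"
    by (rule inj_onI) (auto simp: colour_lists_def colouring_inj)
  have sub: "colouring ` colour_lists d n \<subseteq> {1..n} \<rightarrow>\<^sub>E {..<d}"
  proof (rule image_subsetI)
    fix f assume "f \<in> colour_lists d n"
    then have f: "set f \<subseteq> {..<d}" "length f = n" by (auto simp: colour_lists_def)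
    then have "f ! (p - 1) < d" if "p \<in> {1..n}" for p
      using nth_mem[of "p - 1" f] that by fastforce
    then show "colouring f \<in> {1..n} \<rightarrow>\<^sub>E {..<d}" using f(2) by (auto simp: colouring_def)
  qed
  have "card (colouring ` colour_lists d n) = card ({1..n} \<rightarrow>\<^sub>E {..<d})"
    unfolding card_image[OF inj] by (simp add: colour_lists_def card_lists_length_eq card_PiE)
  then have "colouring ` colour_lists d n = {1..n} \<rightarrow>\<^sub>E {..<d}"
    by (intro card_subset_eq sub finite_PiE) auto
  then show ?thesis using sum.reindex[OF inj, of F] by simp
qed

text \<open>The tail \<open>f\<close> colours the points from 2 on, so its entry \<open>i\<close> is
  the colour of the point \<open>i + 2\<close>, and \<open>star_generator (Suc i)\<close> moves
  exactly 1 and \<open>i + 2\<close>.\<close>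

lemma colouring_star_generator:
  assumes "i < length f"
  shows "colouring (a # f) \<circ> perm_of (star_generator (Suc i)) = colouring (f ! i # f[i := a])"
proof
  fix p
  have r: "perm_of (star_generator (Suc i)) = Transposition.transpose 1 (i + 2)"
    by (simp add: star_generator.rep_eq)
  consider "p = 0" | "p = 1" | "p = i + 2" | "p \<noteq> 0" "p \<noteq> 1" "p \<noteq> i + 2" by blast
  then show "(colouring (a # f) \<circ> perm_of (star_generator (Suc i))) p = colouring (f ! i # f[i := a]) p"
  proof cases
    case 4
    then obtain j where j: "p = j + 2" by (metis add_2_eq_Suc' not0_implies_Suc One_nat_def)
    with 4 show ?thesis
      using assms by (simp add: r Transposition.transpose_def colouring_def nth_Cons')
  qed (use assms in \<open>simp_all add: r Transposition.transpose_def colouring_def\<close>)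
qed

text \<open>The action of the \<open>x\<close>-entry of the matrix of the sum of the centred generators on functions
  of the colourings of the points \<open>2, \<dots>, n + 1\<close>; the colour of the point 1 changes
  from \<open>fst x\<close> to \<open>snd x\<close>.\<close>

definition entry_op :: "nat \<Rightarrow> nat \<times> nat \<Rightarrow> (nat list \<Rightarrow> complex) \<Rightarrow> nat list \<Rightarrow> complex" where
  "entry_op d x g f = (\<Sum>i<length f. if f ! i = snd x then g (f[i := fst x]) else 0) -
     (if fst x = snd x \<and> snd x < d then of_nat (length f) / of_nat d * g f else 0)"

primrec entry_ops :: "nat \<Rightarrow> (nat \<times> nat) list \<Rightarrow> (nat list \<Rightarrow> complex) \<Rightarrow> nat list \<Rightarrow> complex" where
  "entry_ops d [] g = g"
| "entry_ops d (x # u) g = entry_op d x (entry_ops d u g)"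

lemma entry_ops_cong:
  assumes "\<And>f'. length f' = length f \<Longrightarrow> g f' = g' f'"
  shows "entry_ops d u g f = entry_ops d u g' f"
  using assms
proof (induction u arbitrary: f)
  case (Cons x u)
  have "entry_ops d u g f' = entry_ops d u g' f'" if "length f' = length f" for f'
    by (rule Cons.IH) (use Cons.prems that in auto)
  then show ?case by (simp add: entry_op_def cong: if_cong)
qed simp

lemma entry_ops_zero: "entry_ops d u (\<lambda>f. 0) f = 0"
  by (induction u arbitrary: f) (simp_all add: entry_op_def cong: if_cong)

text \<open>A walk records the successive colours of the point 1 under the \<open>k\<close> factors.
  Each step from \<open>a\<close> to \<open>c\<close> comes with the entry operator
  \<open>(a, c)\<close> on the colours of the other points.\<close>

lemma kern_s_elem_power:
  assumes "a < d" "f \<in> colour_lists d n"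
  shows "kern (s_elem d n ^ k) (colouring (a # f)) c' = of_real (1 / sqrt (real n)) ^ k *
    (\<Sum>b<d. \<Sum>u\<in>walks d k a b. entry_ops d u (\<lambda>f. of_bool (colouring (b # f) = c')) f)"
  using assms
proof (induction k arbitrary: a f)
  case 0
  then show ?case by (simp add: kern_1 sum_walks_0 sum.delta)
next
  case (Suc k)
  let ?r = "of_real (1 / sqrt (real n)) :: complex"
  define X where "X a f = (\<Sum>b<d. \<Sum>u\<in>walks d k a b. entry_ops d u (\<lambda>f. of_bool (colouring (b # f) = c')) f)" for a f
  have len: "length f = n" and sub: "set f \<subseteq> {..<d}" using Suc.prems(2) by (auto simp: colour_lists_def)
  have f: "f ! i < d" if "i < n" for i
    using sub that len nth_mem[of i f] by blast
  have upd: "f[i := a] \<in> colour_lists d n" for i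
    using Suc.prems set_update_subset_insert[of f i a] by (auto simp: colour_lists_def)
  have "(\<Sum>i=1..n. kern (s_elem d n ^ k) (colouring (a # f) \<circ> perm_of (star_generator i)) c') =
      (\<Sum>i<n. kern (s_elem d n ^ k) (colouring (f ! i # f[i := a])) c')"
    by (simp add: sum.atLeast1_atMost_eq colouring_star_generator len)
  also have "\<dots> = (\<Sum>i<n. ?r ^ k * X (f ! i) (f[i := a]))"
    unfolding X_def by (intro sum.cong refl Suc.IH f upd) auto
  also have "\<dots> = ?r ^ k * (\<Sum>i<n. X (f ! i) (f[i := a]))"
    by (simp only: sum_distrib_left)
  finally have S: "(\<Sum>i=1..n. kern (s_elem d n ^ k) (colouring (a # f) \<circ> perm_of (star_generator i)) c') =
      ?r ^ k * (\<Sum>i<n. X (f ! i) (f[i := a]))" .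
  have "kern (s_elem d n ^ Suc k) (colouring (a # f)) c' =
      ?r ^ Suc k * ((\<Sum>i<n. X (f ! i) (f[i := a])) - of_nat n / of_nat d * X a f)"
    unfolding power_Suc kern_s_elem_mult S Suc.IH[OF Suc.prems] X_def[symmetric]
    by (simp only: right_diff_distrib mult_ac)
  also have "(\<Sum>i<n. X (f ! i) (f[i := a])) = (\<Sum>i<n. \<Sum>c<d. if f ! i = c then X c (f[i := a]) else 0)"
    by (rule sum.cong) (auto simp: f sum.delta')
  also have "of_nat n / of_nat d * X a f = (\<Sum>c<d. if a = c \<and> c < d then of_nat n / of_nat d * X c f else 0)"
  proof -
    have "(\<Sum>c<d. if a = c \<and> c < d then of_nat n / of_nat d * X c f else 0) =
        (\<Sum>c<d. if a = c then of_nat n / of_nat d * X c f else 0)"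
      by (rule sum.cong) auto
    then show ?thesis using Suc.prems(1) by (simp add: sum.delta')
  qed
  also have "(\<Sum>i<n. \<Sum>c<d. if f ! i = c then X c (f[i := a]) else 0) -
      (\<Sum>c<d. if a = c \<and> c < d then of_nat n / of_nat d * X c f else 0) =
      (\<Sum>c<d. (\<Sum>i<n. if f ! i = c then X c (f[i := a]) else 0) - (if a = c \<and> c < d then of_nat n / of_nat d * X c f else 0))"
    unfolding sum_subtractf by (subst sum.swap) simp
  also have "\<dots> = (\<Sum>c<d. entry_op d (a, c) (X c) f)"
    by (simp only: entry_op_def len fst_conv snd_conv)
  also have "\<dots> = (\<Sum>c<d. \<Sum>b<d. \<Sum>u\<in>walks d k c b. entry_op d (a, c) (entry_ops d u (\<lambda>f. of_bool (colouring (b # f) = c'))) f)"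
  proof (rule sum.cong[OF refl])
    fix c
    have sum: "entry_op d x (\<lambda>f. \<Sum>i\<in>I. g i f) f = (\<Sum>i\<in>I. entry_op d x (g i) f)" for I x f and g :: "'i \<Rightarrow> nat list \<Rightarrow> complex"
    proof (induction I rule: infinite_finite_induct)
      case (insert i I)
      have "entry_op d x (\<lambda>f. g i f + h f) f = entry_op d x (g i) f + entry_op d x h f" for h
      proof -
        have "(\<Sum>j<length f. if f ! j = snd x then g i (f[j := fst x]) + h (f[j := fst x]) else 0) =
          (\<Sum>j<length f. if f ! j = snd x then g i (f[j := fst x]) else 0) + (\<Sum>j<length f. if f ! j = snd x then h (f[j := fst x]) else 0)"
          unfolding sum.distrib[symmetric] by (rule sum.cong) auto
        note split = this
        have "A + B - (if P then z * (y + y') else 0) =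
            (A - (if P then z * y else 0)) + (B - (if P then z * y' else 0))" for A B z y y' :: complex and P
          by (simp add: distrib_left)
        then show ?thesis unfolding entry_op_def split .
      qed
      then show ?case using insert by simp
    qed (simp_all add: entry_op_def)
    show "entry_op d (a, c) (X c) f = (\<Sum>b<d. \<Sum>u\<in>walks d k c b. entry_op d (a, c) (entry_ops d u (\<lambda>f. of_bool (colouring (b # f) = c'))) f)"
      unfolding X_def sum ..
  qed
  also have "\<dots> = (\<Sum>b<d. \<Sum>u\<in>walks d (Suc k) a b. entry_ops d u (\<lambda>f. of_bool (colouring (b # f) = c')) f)"
    unfolding sum_walks_Suc by (subst sum.swap) simp
  finally show ?case .
qed

text \<open>The joint moments of the entries of the sum of the centred generators, before division
  by the square root of \<open>n\<close>, under the normalised trace over the \<open>n\<close>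
  points other than 1.\<close>

definition slots_trace :: "nat \<Rightarrow> nat \<Rightarrow> (nat \<times> nat) list \<Rightarrow> complex" where
  "slots_trace d n u = 1 / of_nat d ^ n * (\<Sum>f\<in>colour_lists d n. entry_ops d u (\<lambda>f'. of_bool (f' = f)) f)"

text \<open>In the trace over the \<open>n + 1\<close> points, returning to the initial colour of
  the point 1 closes the walks. Normalising that point leaves the factor \<open>1/d\<close>; the
  other points are absorbed in \<open>slots_trace\<close>.\<close>

lemma phi_s_elem_power:
  assumes d: "d \<ge> 1"
  shows "phi d (s_elem d n ^ k) = of_real (1 / sqrt (real n)) ^ k / of_nat d * loop_sum d [k] (slots_trace d n)"
proof -
  let ?r = "of_real (1 / sqrt (real n)) :: complex"
  let ?\<delta> = "\<lambda>f f'. of_bool (f' = f) :: complex"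
  have nz: "of_nat d ^ n \<noteq> (0 :: complex)" "of_nat d \<noteq> (0 :: complex)" using d by auto
  have "of_nat d ^ Suc n * phi d (s_elem d n ^ k) =
      (\<Sum>a<d. \<Sum>f\<in>colour_lists d n. kern (s_elem d n ^ k) (colouring (a # f)) (colouring (a # f)))"
    unfolding phi_eq_kern_trace[OF keys_s_elem_power d] sum_colourings sum_colour_lists_Suc ..
  also have "\<dots> = (\<Sum>a<d. \<Sum>f\<in>colour_lists d n. ?r ^ k * (\<Sum>u\<in>walks d k a a. entry_ops d u (?\<delta> f) f))"
  proof (intro sum.cong refl)
    fix a f assume a: "a \<in> {..<d}" and f: "f \<in> colour_lists d n"
    have "entry_ops d u (\<lambda>f'. of_bool (colouring (b # f') = colouring (a # f))) f =
        (if b = a then entry_ops d u (?\<delta> f) f else 0)" for b u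
    proof -
      have "entry_ops d u (\<lambda>f'. of_bool (colouring (b # f') = colouring (a # f))) f =
          entry_ops d u (\<lambda>f'. if b = a then ?\<delta> f f' else 0) f"
        by (rule entry_ops_cong) (simp add: colouring_inj)
      then show ?thesis by (cases "b = a") (simp_all add: entry_ops_zero)
    qed
    then have "kern (s_elem d n ^ k) (colouring (a # f)) (colouring (a # f)) =
        ?r ^ k * (\<Sum>b<d. \<Sum>u\<in>walks d k a b. if b = a then entry_ops d u (?\<delta> f) f else 0)"
      using a f by (subst kern_s_elem_power) auto
    also have "(\<Sum>b<d. \<Sum>u\<in>walks d k a b. if b = a then entry_ops d u (?\<delta> f) f else 0) =
        (\<Sum>b<d. if b = a then \<Sum>u\<in>walks d k a b. entry_ops d u (?\<delta> f) f else 0)"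
      by (rule sum.cong) auto
    also have "\<dots> = (\<Sum>u\<in>walks d k a a. entry_ops d u (?\<delta> f) f)"
      using a by (simp add: sum.delta)
    finally show "kern (s_elem d n ^ k) (colouring (a # f)) (colouring (a # f)) =
        ?r ^ k * (\<Sum>u\<in>walks d k a a. entry_ops d u (?\<delta> f) f)" .
  qed
  also have "\<dots> = ?r ^ k * (\<Sum>a<d. \<Sum>u\<in>walks d k a a. \<Sum>f\<in>colour_lists d n. entry_ops d u (?\<delta> f) f)"
    unfolding sum_distrib_left by (intro sum.cong refl sum.swap)
  also have "\<dots> = ?r ^ k * (\<Sum>a<d. \<Sum>u\<in>walks d k a a. of_nat d ^ n * slots_trace d n u)"
    using nz by (simp add: slots_trace_def)
  also have "\<dots> = of_nat d ^ n * (?r ^ k * loop_sum d [k] (slots_trace d n))"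
    by (simp add: sum_distrib_left mult_ac)
  finally have "of_nat d ^ n * (of_nat d * phi d (s_elem d n ^ k)) =
      of_nat d ^ n * (?r ^ k * loop_sum d [k] (slots_trace d n))"
    by (simp only: power_Suc mult_ac)
  then have "of_nat d * phi d (s_elem d n ^ k) = ?r ^ k * loop_sum d [k] (slots_trace d n)"
    using nz(1) by (simp only: mult_cancel_left simp_thms)
  then show ?thesis
    unfolding times_divide_eq_left nonzero_eq_divide_eq[OF nz(2)]
    by (simp only: mult.commute[of _ "of_nat d"])
qed

section \<open>Independence of the points and the covariance of one point\<close>

text \<open>A centred matrix unit on the functions of one colour. The condition
  \<open>snd x < d\<close> withholds the centring from colours out of range, whose matrix units act
  as 0 on the range; so every letter is centred, as \<open>conv_power_clt\<close> demands.\<close>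

definition slot_op :: "nat \<Rightarrow> nat \<times> nat \<Rightarrow> (nat \<Rightarrow> complex) \<Rightarrow> nat \<Rightarrow> complex" where
  "slot_op d x p v = (if v = snd x then p (fst x) else 0) - (if fst x = snd x \<and> snd x < d then 1 / of_nat d * p v else 0)"

primrec slot_ops :: "nat \<Rightarrow> (nat \<times> nat) list \<Rightarrow> (nat \<Rightarrow> complex) \<Rightarrow> nat \<Rightarrow> complex" where
  "slot_ops d [] p = p"
| "slot_ops d (x # u) p = slot_op d x (slot_ops d u p)"

lemma conv_sum_left: "conv u (\<lambda>v. \<Sum>i\<in>I. f i v) g = (\<Sum>i\<in>I. conv u (f i) g)"
  by (induction I rule: infinite_finite_induct) (auto simp: conv_add_left conv_zero_left)

lemma conv_diff_left: "conv u (\<lambda>v. f v - f' v) g = conv u f g - conv u f' g"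
  using conv_add_left[of u "\<lambda>v. f v - f' v" f' g] by simp

lemma conv_diff_right: "conv u f (\<lambda>v. g v - g' v) = conv u f g - conv u f g'"
  using conv_add_right[of u f "\<lambda>v. g v - g' v" g'] by simp

lemma conv_if_left: "conv u (\<lambda>v. if P then f v else 0) g = (if P then conv u f g else 0)"
  by (simp add: conv_zero_left)

lemma conv_if_right: "conv u f (\<lambda>v. if P then g v else 0) = (if P then conv u f g else 0)"
  by (simp add: conv_zero_right)

text \<open>An entry operator is a sum of operators acting on one point each. On a product function
  every letter therefore acts either on the leading point or on the others, which is a shuffle
  convolution; the centring splits as \<open>1/d\<close> plus \<open>length f / d\<close>.\<close>

lemma entry_ops_Cons:
  assumes "\<And>v f. g (v # f) = p v * q f"
  shows "entry_ops d u g (v # f) = conv u (\<lambda>ys. slot_ops d ys p v) (\<lambda>zs. entry_ops d zs q f)"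
  using assms
proof (induction u arbitrary: v f)
  case (Cons x u)
  define G where "G = entry_ops d u g"
  have G: "G (v # f) = conv u (\<lambda>ys. slot_ops d ys p v) (\<lambda>zs. entry_ops d zs q f)" for v f
    unfolding G_def by (rule Cons.IH) (rule Cons.prems)
  let ?P = "fst x = snd x \<and> snd x < d"
  have "entry_ops d (x # u) g (v # f) =
      (if v = snd x then G (fst x # f) else 0) +
      (\<Sum>i<length f. if f ! i = snd x then G (v # f[i := fst x]) else 0) -
      (if ?P then of_nat (Suc (length f)) / of_nat d * G (v # f) else 0)"
    by (simp add: entry_op_def G_def[symmetric] sum.lessThan_Suc_shift del: sum.lessThan_Suc cong: if_cong)
  also have "\<dots> = ((if v = snd x then G (fst x # f) else 0) - (if ?P then 1 / of_nat d * G (v # f) else 0)) +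
      ((\<Sum>i<length f. if f ! i = snd x then G (v # f[i := fst x]) else 0) -
       (if ?P then of_nat (length f) / of_nat d * G (v # f) else 0))"
    by (simp add: add_divide_distrib distrib_right)
  also have "(if v = snd x then G (fst x # f) else 0) - (if ?P then 1 / of_nat d * G (v # f) else 0) =
      conv u (\<lambda>ys. slot_ops d (x # ys) p v) (\<lambda>zs. entry_ops d zs q f)"
    unfolding slot_ops.simps slot_op_def G conv_diff_left conv_if_left conv_mult_left ..
  also have "(\<Sum>i<length f. if f ! i = snd x then G (v # f[i := fst x]) else 0) -
       (if ?P then of_nat (length f) / of_nat d * G (v # f) else 0) =
      conv u (\<lambda>ys. slot_ops d ys p v) (\<lambda>zs. entry_ops d (x # zs) q f)"
    unfolding entry_ops.simps entry_op_def G conv_diff_right conv_if_right conv_mult_right conv_sum_right ..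
  finally show ?case by simp
qed simp

definition slot_trace :: "nat \<Rightarrow> (nat \<times> nat) list \<Rightarrow> complex" where
  "slot_trace d u = (\<Sum>v<d. 1 / of_nat d * slot_ops d u (\<lambda>v'. of_bool (v' = v)) v)"

lemma slots_trace_0: "slots_trace d 0 u = (if u = [] then 1 else 0)"
proof -
  have "colour_lists d 0 = {[]}" by (auto simp: colour_lists_def)
  then show ?thesis by (cases u) (simp_all add: slots_trace_def entry_op_def)
qed

text \<open>The trace is a product over points: the points are tensor independent and identically
  distributed.\<close>

lemma slots_trace_Suc: "slots_trace d (Suc n) u = conv u (slot_trace d) (slots_trace d n)"
proof -
  have "slots_trace d (Suc n) u = 1 / of_nat d ^ Suc n * (\<Sum>v<d. \<Sum>f\<in>colour_lists d n.
      conv u (\<lambda>ys. slot_ops d ys (\<lambda>v'. of_bool (v' = v)) v) (\<lambda>zs. entry_ops d zs (\<lambda>f'. of_bool (f' = f)) f))"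
    unfolding slots_trace_def sum_colour_lists_Suc
    by (intro arg_cong2[of _ _ _ _ "(*)"] sum.cong refl entry_ops_Cons) auto
  also have "\<dots> = conv u (slot_trace d) (slots_trace d n)"
    unfolding slot_trace_def[abs_def] slots_trace_def[abs_def] conv_sum_left conv_sum_right conv_mult_left conv_mult_right
    by (simp add: sum_distrib_left mult_ac)
  finally show ?thesis .
qed

lemma slot_trace_Nil: "d \<ge> 1 \<Longrightarrow> slot_trace d [] = 1"
  by (simp add: slot_trace_def)

lemma sum_delta_eq: "(\<Sum>v<d. if v = (b :: nat) then h v else 0) = (if b < d then h b else (0 :: complex))"
  by (simp add: sum.delta)

text \<open>The normalised trace of a diagonal matrix unit with colour in range is
  \<open>1/d\<close>, which the centring subtracts. All other units have trace 0 and no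
  centring.\<close>

lemma slot_trace_single:
  assumes "length u = 1"
  shows "slot_trace d u = 0"
proof -
  obtain a b where u: "u = [(a, b)]" using assms by (metis One_nat_def length_0_conv length_Suc_conv surj_pair)
  show ?thesis
  proof (cases "a = b \<and> b < d")
    case True
    then have "(\<Sum>v<d. slot_ops d u (\<lambda>v'. of_bool (v' = v)) v) = (\<Sum>v<d. (if v = b then 1 else 0) - 1 / of_nat d)"
      by (intro sum.cong refl) (auto simp: u slot_op_def)
    also have "\<dots> = 0" using True by (simp add: sum_subtractf sum_delta_eq)
    finally show ?thesis unfolding slot_trace_def sum_distrib_left[symmetric] by simp
  next
    case False
    then have "slot_ops d u (\<lambda>v'. of_bool (v' = v)) v = 0" if "v < d" for v
      using that by (auto simp: u slot_op_def)
    then show ?thesis by (simp add: slot_trace_def)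
  qed
qed

text \<open>Expanding the product of two centred matrix units gives three centring corrections. Two
  of them cancel in the trace, and the third is the \<open>- 1/d^2\<close> on pairs of diagonal
  entries.\<close>

lemma slot_trace_pair:
  assumes "fst x < d" "snd x < d" "fst y < d" "snd y < d"
  shows "slot_trace d [x, y] = entry_cov (1 / of_nat d) (- (1 / of_nat d ^ 2)) x y"
proof -
  obtain a b c e where xy: "x = (a, b)" "y = (c, e)" by (metis surj_pair)
  let ?d = "of_nat d :: complex"
  have nz: "?d \<noteq> 0" using assms by auto
  have "slot_ops d [x, y] (\<lambda>v'. of_bool (v' = v)) v =
      (if v = b then of_bool (a = e) * of_bool (b = c) - of_bool (c = e) * of_bool (a = b) / ?d else 0) -
      (if v = e then of_bool (a = b) * of_bool (c = e) / ?d else 0) + of_bool (a = b) * of_bool (c = e) / ?d ^ 2"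
    if "v < d" for v
    using that assms by (auto simp: xy slot_op_def power2_eq_square diff_divide_distrib)
  then have "(\<Sum>v<d. slot_ops d [x, y] (\<lambda>v'. of_bool (v' = v)) v) =
      (\<Sum>v<d. (if v = b then of_bool (a = e) * of_bool (b = c) - of_bool (c = e) * of_bool (a = b) / ?d else 0) -
      (if v = e then of_bool (a = b) * of_bool (c = e) / ?d else 0) + of_bool (a = b) * of_bool (c = e) / ?d ^ 2)"
    by simp
  also have "\<dots> = of_bool (a = e) * of_bool (b = c) - of_bool (c = e) * of_bool (a = b) / ?d"
    using assms nz by (simp add: sum.distrib sum_subtractf sum_delta_eq xy power2_eq_square)
  finally have "slot_trace d [x, y] = 1 / ?d * (of_bool (a = e) * of_bool (b = c) - of_bool (c = e) * of_bool (a = b) / ?d)"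
    unfolding slot_trace_def sum_distrib_left[symmetric] by simp
  then show ?thesis by (simp add: entry_cov_def xy power2_eq_square right_diff_distrib)
qed

lemma pick_cong_set:
  assumes "\<And>y. y \<in> set u \<Longrightarrow> h y = h' y"
    and "\<And>v. Suc (length v) = length u \<Longrightarrow> set v \<subseteq> set u \<Longrightarrow> w v = w' v"
  shows "pick h w u = pick h' w' u"
  using assms
proof (induction u arbitrary: w w')
  case (Cons x u)
  have "pick h (\<lambda>v. w (x # v)) u = pick h' (\<lambda>v. w' (x # v)) u"
  proof (rule Cons.IH)
    show "h y = h' y" if "y \<in> set u" for y using that Cons.prems(1) by simp
    show "w (x # v) = w' (x # v)" if "Suc (length v) = length u" "set v \<subseteq> set u" for v
      using that by (intro Cons.prems(2)) auto
  qed
  moreover have "w u = w' u" by (rule Cons.prems(2)) auto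
  moreover have "h x = h' x" by (rule Cons.prems(1)) simp
  ultimately show ?case by simp
qed simp

text \<open>Only covariances of letters that occur are compared, since
  \<open>slot_trace_pair\<close> holds for colours in range.\<close>

lemma wick_cong:
  assumes "\<And>x y. x \<in> set u \<Longrightarrow> y \<in> set u \<Longrightarrow> h x y = h' x y"
  shows "wick h u = wick h' u"
  using assms
proof (induction "length u" arbitrary: u rule: less_induct)
  case less
  show ?case
  proof (cases u)
    case (Cons x v)
    have "pick (h x) (wick h) v = pick (h' x) (wick h') v"
    proof (rule pick_cong_set)
      show "h x y = h' x y" if "y \<in> set v" for y using that less.prems Cons by simp
      show "wick h t = wick h' t" if "Suc (length t) = length v" "set t \<subseteq> set v" for t
        using that Cons by (intro less.hyps less.prems) auto
    qed
    then show ?thesis by (simp add: Cons wick_Cons)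
  qed (simp add: wick_Nil)
qed

lemma walks_colours: "u \<in> walks d k a b \<Longrightarrow> a < d \<Longrightarrow> x \<in> set u \<Longrightarrow> fst x < d \<and> snd x < d"
  by (induction k arbitrary: a u) (auto simp: walks.simps split: if_splits)

lemma phi_s_elem_power_tendsto:
  assumes d: "d \<ge> 1"
  shows "(\<lambda>n. phi d (s_elem d n ^ k)) \<longlonglongrightarrow>
    1 / of_nat d * loop_sum d [k] (wick (entry_cov (1 / of_nat d) (- (1 / of_nat d ^ 2))))"
proof -
  have lim: "(\<lambda>n. slots_trace d n u * of_real (1 / sqrt (real n)) ^ k) \<longlonglongrightarrow>
      wick (entry_cov (1 / of_nat d) (- (1 / of_nat d ^ 2))) u" if "u \<in> walks d k a a" "a < d" for u a
  proof -
    have "(\<lambda>n. slots_trace d n u * of_real (1 / sqrt (real n)) ^ length u) \<longlonglongrightarrow> wick (\<lambda>x y. slot_trace d [x, y]) u"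
      by (rule conv_power_clt) (use d in \<open>simp_all add: slots_trace_0 slots_trace_Suc slot_trace_Nil slot_trace_single\<close>)
    moreover have "wick (\<lambda>x y. slot_trace d [x, y]) u = wick (entry_cov (1 / of_nat d) (- (1 / of_nat d ^ 2))) u"
      by (rule wick_cong) (use walks_colours[OF that] in \<open>simp add: slot_trace_pair\<close>)
    ultimately show ?thesis by (simp add: length_walks[OF that(1)])
  qed
  have "(\<lambda>n. 1 / of_nat d * (\<Sum>a<d. \<Sum>u\<in>walks d k a a. slots_trace d n u * of_real (1 / sqrt (real n)) ^ k)) \<longlonglongrightarrow>
     1 / of_nat d * (\<Sum>a<d. \<Sum>u\<in>walks d k a a. wick (entry_cov (1 / of_nat d) (- (1 / of_nat d ^ 2))) u)"
    by (intro tendsto_mult tendsto_const tendsto_sum lim) auto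
  moreover have "phi d (s_elem d n ^ k) =
      1 / of_nat d * (\<Sum>a<d. \<Sum>u\<in>walks d k a a. slots_trace d n u * of_real (1 / sqrt (real n)) ^ k)" for n
  proof -
    have "r / z * X = 1 / z * (X * r)" for r z X :: complex by simp
    then show ?thesis
      unfolding phi_s_elem_power[OF d] loop_sum.simps append_Nil2 sum_distrib_right[symmetric] .
  qed
  ultimately show ?thesis by simp
qed

section \<open>The Laplace transform\<close>

lemma sums_delay:
  fixes f :: "nat \<Rightarrow> complex"
  assumes "f sums s"
  shows "(\<lambda>q. if r \<le> q then f (q - r) else 0) sums s"
proof -
  let ?g = "\<lambda>q. if r \<le> q then f (q - r) else 0"
  have "(\<lambda>n. ?g (n + r)) sums s" using assms by simp
  then have "?g sums (s + (\<Sum>i<r. ?g i))" by (rule sums_iff_shift[THEN iffD1])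
  also have "(\<Sum>i<r. ?g i) = 0" by (rule sum.neutral) auto
  finally show ?thesis by simp
qed

lemma summable_norm_delay:
  fixes f :: "nat \<Rightarrow> complex"
  assumes "summable (\<lambda>n. norm (f n))"
  shows "summable (\<lambda>q. norm (if r \<le> q then f (q - r) else 0))"
proof -
  let ?g = "\<lambda>q. norm (if r \<le> q then f (q - r) else 0)"
  have "summable (\<lambda>n. ?g (n + r))" using assms by simp
  then show ?thesis by (rule summable_iff_shift[THEN iffD1])
qed

section \<open>Generating function of the eigenvalue moments\<close>

text \<open>The moments of the one-level density of the \<open>d\<close> eigenvalues before scaling
  and shift; its total mass is \<open>d\<close>.\<close>

definition level_moment :: "nat \<Rightarrow> nat \<Rightarrow> complex" where
  "level_moment d q = (\<Sum>m<d. gauss (herm m * herm m * monom 1 q) / fact m)"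

text \<open>The \<open>fact q\<close> in the moments cancels that of the exponential series, so the
  shift by \<open>2 * j\<close> becomes multiplication of the Gaussian series by
  \<open>y ^ (2 * j)\<close>.\<close>

lemma level_moment_egf_coeff:
  "level_moment d q * y ^ q / fact q = (\<Sum>m<d. \<Sum>j\<le>m. of_nat (m choose j) / fact j * y ^ (2 * j) *
     (if 2 * j \<le> q then gauss_moment (q - 2 * j) * y ^ (q - 2 * j) / fact (q - 2 * j) else 0))"
proof -
  have "(of_nat (m choose j) / fact j * (if 2 * j \<le> q then fact q / fact (q - 2 * j) * gauss_moment (q - 2 * j) else 0)) *
      (y ^ q / fact q) =
    of_nat (m choose j) / fact j * y ^ (2 * j) *
     (if 2 * j \<le> q then gauss_moment (q - 2 * j) * y ^ (q - 2 * j) / fact (q - 2 * j) else 0)" for m j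
  proof (cases "2 * j \<le> q")
    case True
    then have "y ^ q = y ^ (2 * j) * y ^ (q - 2 * j)" by (simp flip: power_add)
    then show ?thesis using True by simp
  qed simp
  note coeff = this
  have "level_moment d q * y ^ q / fact q = level_moment d q * (y ^ q / fact q)" by simp
  also have "\<dots> = (\<Sum>m<d. \<Sum>j\<le>m. of_nat (m choose j) / fact j * y ^ (2 * j) *
     (if 2 * j \<le> q then gauss_moment (q - 2 * j) * y ^ (q - 2 * j) / fact (q - 2 * j) else 0))"
    unfolding level_moment_def gauss_herm_square_monom sum_distrib_right coeff ..
  finally show ?thesis .
qed

lemma level_moment_sums:
  "(\<lambda>q. level_moment d q * y ^ q / fact q) sums
     (\<Sum>m<d. \<Sum>j\<le>m. of_nat (m choose j) / fact j * y ^ (2 * j) * exp (y\<^sup>2 / 2))"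
  unfolding level_moment_egf_coeff
  by (intro sums_sum sums_mult sums_delay gauss_moment_sums)

lemma summable_norm_level_moment: "summable (\<lambda>q. norm (level_moment d q * y ^ q / fact q))"
proof -
  have "summable (\<lambda>q. \<Sum>m<d. \<Sum>j\<le>m. norm (of_nat (m choose j) / fact j * y ^ (2 * j)) *
     norm (if 2 * j \<le> q then gauss_moment (q - 2 * j) * y ^ (q - 2 * j) / fact (q - 2 * j) else 0))"
    by (intro summable_sum summable_mult summable_norm_delay summable_norm_gauss_moment)
  moreover have "norm (norm (level_moment d q * y ^ q / fact q)) \<le>
    (\<Sum>m<d. \<Sum>j\<le>m. norm (of_nat (m choose j) / fact j * y ^ (2 * j)) *
     norm (if 2 * j \<le> q then gauss_moment (q - 2 * j) * y ^ (q - 2 * j) / fact (q - 2 * j) else 0))" for q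
    unfolding level_moment_egf_coeff real_norm_def abs_norm_cancel
    by (intro order_trans[OF norm_sum] sum_mono) (simp only: norm_mult order_refl)
  ultimately show ?thesis by (blast intro: summable_comparison_test')
qed

text \<open>Summing \<open>m choose j\<close> over the levels gives \<open>d choose Suc j\<close>,
  which is \<open>d / (j + 1)\<close> times \<open>(d - 1) choose j\<close>. This is the origin of
  the coefficients of \<open>Q_poly\<close> and of the factorial of \<open>j + 1\<close>.\<close>

lemma sum_binomial_levels:
  assumes "d \<ge> 1"
  shows "(\<Sum>m<d. \<Sum>j\<le>m. of_nat (m choose j) / fact j * x ^ j) =
    of_nat d * (\<Sum>j=0..d-1. of_nat ((d - 1) choose j) / fact (j + 1) * x ^ j :: complex)"
proof -
  obtain e where d: "d = Suc e" using assms by (cases d) auto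
  have "(\<Sum>m<d. \<Sum>j\<le>m. of_nat (m choose j) / fact j * x ^ j) =
      (\<Sum>m\<le>e. \<Sum>j\<le>e. of_nat (m choose j) / fact j * x ^ j)"
    unfolding d lessThan_Suc_atMost
    by (intro sum.cong refl sum.mono_neutral_left) (auto simp: binomial_eq_0)
  also have "\<dots> = (\<Sum>j\<le>e. of_nat (Suc e choose Suc j) / fact j * x ^ j)"
    by (subst sum.swap) (simp only: sum_choose_upper[symmetric] of_nat_sum sum_divide_distrib sum_distrib_right)
  also have "\<dots> = (\<Sum>j\<le>e. of_nat (Suc e) * (of_nat (e choose j) / fact (j + 1) * x ^ j))"
  proof (rule sum.cong[OF refl])
    fix j
    have "of_nat (Suc j) * of_nat (Suc e choose Suc j) = (of_nat (Suc e) * of_nat (e choose j) :: complex)"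
      using Suc_times_binomial_eq[of e j] by (metis mult.commute of_nat_mult)
    moreover have "of_nat (Suc j) \<noteq> (0 :: complex)" by (simp only: of_nat_eq_0_iff)
    ultimately have "of_nat (Suc e choose Suc j) = (of_nat (Suc e) * of_nat (e choose j) / of_nat (Suc j) :: complex)"
      by (metis nonzero_mult_div_cancel_left)
    then show "of_nat (Suc e choose Suc j) / fact j * x ^ j =
        of_nat (Suc e) * (of_nat (e choose j) / fact (j + 1) * x ^ j)"
      by (simp del: of_nat_Suc binomial_Suc_Suc)
  qed
  finally show ?thesis by (simp add: d sum_distrib_left atLeast0AtMost del: of_nat_Suc)
qed

lemma perm_length_0: "perm_length 0 = 0"
  unfolding perm_length_def by (rule Least_eq_0) (rule exI[of _ "[]"], simp)

text \<open>The scaled eigenvalue and the common shift are independent, so their exponential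
  generating functions multiply. The two Gaussian exponents add up to
  \<open>(1/d - 1/d^2) * z^2 / 2\<close>, and the sum over levels at
  \<open>(\<alpha> * z)^2 = z^2 / d\<close> gives \<open>d\<close> times
  \<open>Q_poly d\<close>.\<close>

lemma limit_moment_sums:
  assumes d: "d \<ge> 1"
  shows "(\<lambda>k. (1 / of_nat d * loop_sum d [k] (wick (entry_cov (1 / of_nat d) (- (1 / of_nat d ^ 2))))) * z ^ k / fact k)
    sums (poly (Q_poly d) z * exp ((of_nat d - 1) * z ^ 2 / (2 * of_nat d ^ 2)))"
proof -
  let ?d = "of_nat d :: complex"
  define \<alpha> where "\<alpha> = complex_of_real (1 / sqrt (real d))"
  define \<beta> where "\<beta> = \<i> / ?d"
  have nz: "?d \<noteq> 0" using d by auto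
  have a2: "\<alpha>\<^sup>2 = 1 / ?d"
    unfolding \<alpha>_def of_real_power[symmetric] by (simp add: power_divide)
  have b2: "\<beta>\<^sup>2 = - (1 / ?d ^ 2)" by (simp add: \<beta>_def power_divide)
  define a where "a q = level_moment d q * (\<alpha> * z) ^ q / fact q" for q
  define b where "b r = gauss_moment r * (\<beta> * z) ^ r / fact r" for r
  have "(\<Sum>q\<le>k. a q * b (k - q)) = loop_sum d [k] (wick (entry_cov (1 / ?d) (- (1 / ?d ^ 2)))) * z ^ k / fact k" for k
  proof -
    have "a q * b (k - q) = of_nat (k choose q) * \<alpha> ^ q * \<beta> ^ (k - q) * gauss_moment (k - q) * level_moment d q * (z ^ k / fact k)"
      if "q \<le> k" for q
    proof -
      have "z ^ k = z ^ q * z ^ (k - q)" using that by (simp flip: power_add)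
      moreover have "of_nat (k choose q) = (fact k / (fact q * fact (k - q)) :: complex)"
        by (rule binomial_fact[OF that])
      ultimately show ?thesis by (simp add: a_def b_def power_mult_distrib mult_ac)
    qed
    then have "(\<Sum>q\<le>k. a q * b (k - q)) =
      (\<Sum>q\<le>k. of_nat (k choose q) * \<alpha> ^ q * \<beta> ^ (k - q) * gauss_moment (k - q) * level_moment d q * (z ^ k / fact k))"
      by (intro sum.cong) auto
    also have "\<dots> = loop_sum d [k] (wick (entry_cov (\<alpha>\<^sup>2) (\<beta>\<^sup>2))) * (z ^ k / fact k)"
      using d by (subst loop_sum_one_point) (simp_all only: sum_distrib_right level_moment_def)
    finally show ?thesis by (simp only: a2 b2 times_divide_eq_right)
  qed
  moreover have "(\<lambda>k. \<Sum>q\<le>k. a q * b (k - q)) sums (suminf a * suminf b)"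
    unfolding a_def b_def
    by (rule Cauchy_product_sums) (rule summable_norm_level_moment, rule summable_norm_gauss_moment)
  ultimately have "(\<lambda>k. loop_sum d [k] (wick (entry_cov (1 / ?d) (- (1 / ?d ^ 2)))) * z ^ k / fact k) sums
      (suminf a * suminf b)" by simp
  then have "(\<lambda>k. 1 / ?d * (loop_sum d [k] (wick (entry_cov (1 / ?d) (- (1 / ?d ^ 2)))) * z ^ k / fact k)) sums
      (1 / ?d * (suminf a * suminf b))" by (rule sums_mult)
  moreover have "1 / ?d * (suminf a * suminf b) = poly (Q_poly d) z * exp ((?d - 1) * z ^ 2 / (2 * ?d ^ 2))"
  proof -
    have sb: "suminf b = exp ((\<beta> * z)\<^sup>2 / 2)"
      unfolding b_def by (rule sums_unique[symmetric, OF gauss_moment_sums])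
    have "suminf a = (\<Sum>m<d. \<Sum>j\<le>m. of_nat (m choose j) / fact j * (\<alpha> * z) ^ (2 * j) * exp ((\<alpha> * z)\<^sup>2 / 2))"
      unfolding a_def by (rule sums_unique[symmetric, OF level_moment_sums])
    also have "\<dots> = (\<Sum>m<d. \<Sum>j\<le>m. of_nat (m choose j) / fact j * (z\<^sup>2 / ?d) ^ j) * exp ((\<alpha> * z)\<^sup>2 / 2)"
    proof -
      have "(\<alpha> * z) ^ (2 * j) = (z\<^sup>2 / ?d) ^ j" for j
        unfolding power_mult power_mult_distrib a2 by (simp add: power_divide)
      then show ?thesis by (simp only: sum_distrib_right)
    qed
    also have "(\<Sum>m<d. \<Sum>j\<le>m. of_nat (m choose j) / fact j * (z\<^sup>2 / ?d) ^ j) = ?d * poly (Q_poly d) z"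
    proof -
      have "poly (Q_poly d) z = (\<Sum>j=0..d-1. of_nat ((d - 1) choose j) / fact (j + 1) * (z\<^sup>2 / ?d) ^ j)"
        unfolding Q_poly_def poly_sum poly_monom power_mult[of z 2] power_divide
        by (intro sum.cong refl) (simp add: mult.commute del: fact_Suc)
      then show ?thesis unfolding sum_binomial_levels[OF d] by simp
    qed
    finally have sa: "suminf a = ?d * poly (Q_poly d) z * exp ((\<alpha> * z)\<^sup>2 / 2)" .
    have "(\<alpha> * z)\<^sup>2 / 2 + (\<beta> * z)\<^sup>2 / 2 = (?d - 1) * z ^ 2 / (2 * ?d ^ 2)"
      unfolding power_mult_distrib a2 b2 using nz by (simp add: field_simps power2_eq_square)
    then have "exp ((\<alpha> * z)\<^sup>2 / 2) * exp ((\<beta> * z)\<^sup>2 / 2) = exp ((?d - 1) * z ^ 2 / (2 * ?d ^ 2))"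
      by (simp only: exp_add[symmetric])
    then show ?thesis unfolding sa sb using nz by (simp add: mult.assoc)
  qed
  ultimately show ?thesis by (simp only: times_divide_eq_right mult.assoc)
qed

section \<open>From moments to the Laplace transform\<close>

text \<open>The series gives moments, not absolute moments, so a dominating function is obtained
  from even powers alone: the integral of \<open>cosh (r * t)\<close> is finite, and it controls all
  partial sums of the exponential series.\<close>

lemma laplace_transform_of_moment_series:
  fixes F :: "complex \<Rightarrow> complex"
  assumes "real_distribution \<mu>"
    and int: "\<And>k. integrable \<mu> (\<lambda>t. t ^ k)"
    and sums: "\<And>z. (\<lambda>k. of_real (\<integral>t. t ^ k \<partial>\<mu>) * z ^ k / fact k) sums F z"
  shows "integrable \<mu> (\<lambda>t. exp (z * of_real t)) \<and> (\<integral>t. exp (z * of_real t) \<partial>\<mu>) = F z"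
proof -
  interpret real_distribution \<mu> by fact
  have meas: "f \<in> borel_measurable \<mu>" if "f \<in> borel_measurable borel" for f :: "real \<Rightarrow> 'b :: topological_space"
    using that measurable_cong_sets[OF events_eq_borel refl] by auto
  define r where "r = norm z"
  \<comment> \<open>Even powers are nonnegative, so the Taylor sums of cosh increase and monotone
    convergence applies once their integrals converge.\<close>
  have cosh: "integrable \<mu> (\<lambda>t. cosh (r * t))"
  proof (rule integrable_monotone_convergence)
    define g where "g n t = (\<Sum>k<n. if even k then (r * t) ^ k / fact k else 0)" for n t
    show "integrable \<mu> (g n)" for n unfolding g_def
    proof (rule Bochner_Integration.integrable_sum)
      fix k
      show "integrable \<mu> (\<lambda>t. if even k then (r * t) ^ k / fact k else 0)"
        using int[of k] by (cases "even k") (simp_all add: power_mult_distrib)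
    qed
    show "AE t in \<mu>. mono (\<lambda>n. g n t)"
    proof (rule AE_I2)
      fix t
      show "mono (\<lambda>n. g n t)"
        unfolding g_def by (rule monoI, rule sum_mono2) (auto simp: zero_le_even_power)
    qed
    have "(\<lambda>n. g n t) \<longlonglongrightarrow> cosh (r * t)" for t
    proof -
      have "(\<lambda>k. if even k then (r * t) ^ k / fact k else 0) = (\<lambda>k. if even k then (r * t) ^ k /\<^sub>R fact k else 0)"
        by (rule ext) (simp add: divide_inverse mult.commute)
      then have "(\<lambda>k. if even k then (r * t) ^ k / fact k else 0) sums cosh (r * t)"
        using cosh_converges[of "r * t"] by (simp only:)
      then show ?thesis unfolding sums_def g_def .
    qed
    then show "AE t in \<mu>. (\<lambda>n. g n t) \<longlonglongrightarrow> cosh (r * t)" by simp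
    let ?M = "\<lambda>k. \<integral>t. t ^ k \<partial>\<mu>"
    \<comment> \<open>Averaging the convergent series at \<open>r\<close> and \<open>- r\<close>
      keeps exactly the even moments.\<close>
    have "(\<lambda>k. (of_real (?M k) * of_real r ^ k / fact k + of_real (?M k) * of_real (- r) ^ k / fact k) / 2)
        sums ((F (of_real r) + F (of_real (- r))) / 2)"
      by (intro sums_divide sums_add sums)
    then have "(\<lambda>k. Re ((of_real (?M k) * of_real r ^ k / fact k + of_real (?M k) * of_real (- r) ^ k / fact k) / 2))
        sums Re ((F (of_real r) + F (of_real (- r))) / 2)"
      by (rule sums_Re)
    moreover have "Re ((of_real (?M k) * of_real r ^ k / fact k + of_real (?M k) * of_real (- r) ^ k / fact k) / 2) =
        (\<integral>t. (if even k then (r * t) ^ k / fact k else 0) \<partial>\<mu>)" for k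
    proof -
      have "(of_real (?M k) * of_real r ^ k / fact k + of_real (?M k) * of_real (- r) ^ k / fact k) / 2 =
          complex_of_real ((?M k * r ^ k / fact k + ?M k * (- r) ^ k / fact k) / 2)"
        by simp
      note eq = this
      show ?thesis
        unfolding eq Re_complex_of_real by (cases "even k") (simp_all add: power_mult_distrib)
    qed
    ultimately have "(\<lambda>k. \<integral>t. (if even k then (r * t) ^ k / fact k else 0) \<partial>\<mu>) sums Re ((F (of_real r) + F (of_real (- r))) / 2)"
      by simp
    moreover have "(\<integral>t. g n t \<partial>\<mu>) = (\<Sum>k<n. \<integral>t. (if even k then (r * t) ^ k / fact k else 0) \<partial>\<mu>)" for n
      unfolding g_def
    proof (rule Bochner_Integration.integral_sum)
      fix k
      show "integrable \<mu> (\<lambda>t. if even k then (r * t) ^ k / fact k else 0)"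
        using int[of k] by (cases "even k") (simp_all add: power_mult_distrib)
    qed
    ultimately show "(\<lambda>n. \<integral>t. g n t \<partial>\<mu>) \<longlonglongrightarrow> Re ((F (of_real r) + F (of_real (- r))) / 2)"
      unfolding sums_def by simp
    show "(\<lambda>t. cosh (r * t)) \<in> borel_measurable \<mu>"
      by (rule meas) (intro borel_measurable_continuous_onI continuous_intros)
  qed
  define s where "s n t = (\<Sum>k<n. (z * of_real t) ^ k / fact k)" for n t
  have s_int: "integrable \<mu> (\<lambda>t. (z * of_real t) ^ k / fact k)"
    and s_val: "(\<integral>t. (z * of_real t) ^ k / fact k \<partial>\<mu>) = of_real (\<integral>t. t ^ k \<partial>\<mu>) * z ^ k / fact k" for k
  proof -
    have i: "integrable \<mu> (\<lambda>t. complex_of_real (t ^ k))"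
      using int[of k] by (rule integrable_of_real)
    have eq: "(z * of_real t) ^ k / fact k = z ^ k / fact k * complex_of_real (t ^ k)" for t
      by (simp add: power_mult_distrib)
    show "integrable \<mu> (\<lambda>t. (z * of_real t) ^ k / fact k)"
      unfolding eq by (rule integrable_mult_right) (rule i)
    show "(\<integral>t. (z * of_real t) ^ k / fact k \<partial>\<mu>) = of_real (\<integral>t. t ^ k \<partial>\<mu>) * z ^ k / fact k"
      unfolding eq integral_mult_right_zero integral_complex_of_real by simp
  qed
  have bound: "norm (s n t) \<le> 2 * cosh (r * t)" for n t
  proof -
    have "norm (s n t) \<le> (\<Sum>k<n. norm ((z * of_real t) ^ k / fact k))"
      unfolding s_def by (rule norm_sum)
    also have "\<dots> = (\<Sum>k<n. \<bar>r * t\<bar> ^ k /\<^sub>R fact k)"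
      by (intro sum.cong refl) (simp add: r_def norm_mult norm_divide norm_power abs_mult divide_inverse norm_inverse mult_ac)
    also have "\<dots> \<le> exp \<bar>r * t\<bar>"
      using sum_le_suminf[OF summable_exp_generic[of "\<bar>r * t\<bar>"], of "{..<n}"] by (simp add: exp_def)
    also have "\<dots> \<le> 2 * cosh (r * t)"
      by (simp add: cosh_def abs_real_def)
    finally show ?thesis .
  qed
  have lim: "(\<lambda>n. s n t) \<longlonglongrightarrow> exp (z * of_real t)" for t
  proof -
    have "(\<lambda>k. (z * of_real t) ^ k / fact k) = (\<lambda>k. (z * of_real t) ^ k /\<^sub>R fact k)"
      by (rule ext) (simp add: scaleR_conv_of_real divide_inverse mult.commute)
    then have "(\<lambda>k. (z * of_real t) ^ k / fact k) sums exp (z * of_real t)"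
      using exp_converges[of "z * of_real t"] by (simp only:)
    then show ?thesis unfolding sums_def s_def .
  qed
  have m1: "(\<lambda>t. exp (z * of_real t)) \<in> borel_measurable \<mu>"
    by (rule meas) (intro borel_measurable_continuous_onI continuous_intros)
  have m2: "s n \<in> borel_measurable \<mu>" for n
    unfolding s_def by (rule meas) (intro borel_measurable_continuous_onI continuous_intros, simp)
  have dom: "integrable \<mu> (\<lambda>t. 2 * cosh (r * t))" using cosh by simp
  have "integrable \<mu> (\<lambda>t. exp (z * of_real t))"
    by (rule integrable_dominated_convergence[where s = s, OF m1 m2 dom]) (use lim bound in auto)
  moreover have "(\<lambda>n. \<integral>t. s n t \<partial>\<mu>) \<longlonglongrightarrow> (\<integral>t. exp (z * of_real t) \<partial>\<mu>)"
    by (rule integral_dominated_convergence[where s = s, OF m1 m2 dom]) (use lim bound in auto)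
  moreover have "(\<integral>t. s n t \<partial>\<mu>) = (\<Sum>k<n. of_real (\<integral>t. t ^ k \<partial>\<mu>) * z ^ k / fact k)" for n
    unfolding s_def s_val[symmetric] by (rule Bochner_Integration.integral_sum) (rule s_int)
  ultimately show ?thesis
    using sums[of z] unfolding sums_def by (auto intro: LIMSEQ_unique)
qed

theorem corollary1p2:
  fixes d :: nat and \<mu> :: "real measure"
  assumes "d \<ge> 1"
    and "limit_in_moments (phi d) (s_elem d) \<mu>"
  shows "\<forall>z :: complex.
           integrable \<mu> (\<lambda>t. exp (z * of_real t)) \<and>
           (\<integral>t. exp (z * of_real t) \<partial>\<mu>) =
             poly (Q_poly d) z * exp ((of_nat d - 1) * z ^ 2 / (2 * of_nat d ^ 2))"
proof
  fix z :: complex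
  have dist: "real_distribution \<mu>"
    and pos: "\<And>k. k \<ge> 1 \<Longrightarrow> integrable \<mu> (\<lambda>t. t ^ k)"
    "\<And>k. k \<ge> 1 \<Longrightarrow> (\<lambda>n. phi d (s_elem d n ^ k)) \<longlonglongrightarrow> of_real (\<integral>t. t ^ k \<partial>\<mu>)"
    using assms(2) unfolding limit_in_moments_def by auto
  interpret real_distribution \<mu> by fact
  let ?m = "\<lambda>k. 1 / of_nat d * loop_sum d [k] (wick (entry_cov (1 / of_nat d) (- (1 / of_nat d ^ 2))))"
  have int: "integrable \<mu> (\<lambda>t. t ^ k)" for k
    using pos(1)[of k] by (cases k) auto
  have m: "of_real (\<integral>t. t ^ k \<partial>\<mu>) = ?m k" for k
  proof (cases k)
    \<comment> \<open>The hypothesis gives moments from \<open>k = 1\<close> on. The zeroth one is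
      the total mass 1, and \<open>?m 0 = 1\<close> is read off from the constant sequence
      \<open>phi d (s_elem d n ^ 0)\<close>.\<close>
    case 0
    have "phi d (s_elem d n ^ 0) = 1" for n
      using phi_group_elem[of d 0] by (simp add: group_elem_def perm_length_0)
    then have "(\<lambda>n. 1) \<longlonglongrightarrow> ?m 0"
      using phi_s_elem_power_tendsto[OF assms(1), of 0] by simp
    then have "?m 0 = 1" by (rule LIMSEQ_unique) simp
    then show ?thesis using 0 prob_space[unfolded space_eq_univ] by simp
  next
    case (Suc j)
    then show ?thesis
      using LIMSEQ_unique[OF pos(2)[of k] phi_s_elem_power_tendsto[OF assms(1), of k]] by simp
  qed
  show "integrable \<mu> (\<lambda>t. exp (z * of_real t)) \<and>
      (\<integral>t. exp (z * of_real t) \<partial>\<mu>) = poly (Q_poly d) z * exp ((of_nat d - 1) * z ^ 2 / (2 * of_nat d ^ 2))"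
    by (rule laplace_transform_of_moment_series[OF dist int]) (unfold m, rule limit_moment_sums[OF assms(1)])
qed

end
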